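(* Let $\mathrm{char}(\mathbb F)=p>0$ and $0\ne h\in R=\mathbb F[x]$. Suppose $D=uD_{\breve q}+v\breve F+D_r+\mathrm{ad}_a\in\mathrm{Inder}_{\mathbb F}(A_h)$, where $u,v\in\mathsf Z(A_h)$, $r\in\Theta$, and $a\in\mathsf N_{A_1}(A_h)$. Then $u=0=v$, $r\in\mathrm{im}\,\delta$ and $a\in A_h+\mathsf Z(A_1)$. Thus $$\mathsf{HH}^1(A_h)=\mathrm{Der}_{\mathbb F}(A_h)/\mathrm{Inder}_{\mathbb F}(A_h)\cong\mathsf Z(A_h)D_{\breve q}\oplus\mathsf Z(A_h)\breve F\oplus\mathcal H,$$ where $$\mathcal H=\ker\overline{\mathsf{Res}}=\Big(\mathcal D_\Theta+\{\mathrm{ad}_a\mid a\in\mathsf N_{A_1}(A_h)\}\Big)\Big/\Big(\mathcal D_{\mathrm{im}\,\delta}+\{\mathrm{ad}_a\mid a\in A_h\}\Big)\cong\big(\Theta/\mathrm{im}\,\delta\big)\oplus\big(\mathsf N_{A_1}(A_h)/(A_h+\mathsf Z(A_1))\big),$$ and this last decomposition of $\mathcal H$ is as an $\mathbb F[x^p]$-module.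
   Context: $\mathbb F$ is a field of characteristic $p>0$, $R=\mathbb F[x]$, $0\ne h\in R$. The Weyl algebra $A_1$ is the unital associative $\mathbb F$-algebra with generators $x,y$ and relation $yx-xy=1$; $\mathsf Z(A_1)=\mathbb F[x^p,y^p]$. $A_h$ is the unital associative $\mathbb F$-algebra with generators $x,\hat y$ and relation $\hat yx-x\hat y=h$; it is identified with the subalgebra of $A_1$ generated by $x$ and $\hat y=yh$. The center of $A_h$ is $\mathsf Z(A_h)=\mathbb F[x^p,\mathsf z_h]$ with $\mathsf z_h=h^py^p$. $\mathsf{Res}:\mathrm{Der}_{\mathbb F}(A_h)\to\mathrm{Der}_{\mathbb F}(\mathsf Z(A_h))$ is restriction and $\overline{\mathsf{Res}}:\mathsf{HH}^1(A_h)\to\mathrm{Der}_{\mathbb F}(\mathsf Z(A_h))$ the induced map. With $\mathrm{ad}_u(v)=[u,v]=uv-vu$, $\mathsf N_{A_1}(A_h)=\{u\in A_1\mid[u,A_h]\subseteq A_h\}$; for $u$ in it, $\mathrm{ad}_u$ is regarded as a derivation of $A_h$. For $r\in R$, $D_r$ is the derivation of $A_h$ with $D_r(x)=0$, $D_r(\hat y)=r$; for $M\subseteq R$, $\mathcal D_M=\{D_r\mid r\in M\}$. $\Theta=\{r\in R\mid\mathsf{Res}(D_r)=0\}$. $\delta:R\to R$ is $\delta(f)=f'h$. $\varrho_h$ is the unique monic polynomial of maximal degree in $\mathbb F[x^p]$ dividing $h$ (it also divides $h'$). Write $h^{p-1}=\sum_{i=0}^{p-1}\overline h_ix^i$ with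 $\overline h_i\in\mathbb F[x^p]$, let $\overline h$ be the greatest common divisor in $\mathbb F[x^p]$ of the $\overline h_i$, choose $\breve q_i\in\mathbb F[x^p]$ with $\overline h=\sum_i\breve q_i\overline h_i$, and put $\breve q=-\sum_{i=0}^{p-1}\breve q_ix^{p-1-i}$. $E_x\in\mathrm{Der}_{\mathbb F}(A_1)$ is given by $E_x(x)=y^{p-1}$, $E_x(y)=0$, and $\breve F=\mathsf z_hD_{\frac{h'}{\varrho_h}}-\frac{h^p}{\varrho_h}E_x$, a derivation of $A_h$. *)

theory Defs
  imports
    "HOL-Library.Poly_Mapping"
    "HOL-Computational_Algebra.Polynomial"
    "HOL-Algebra.AbelCoset"
    "HOL-Algebra.Module"
    "HOL-Algebra.Divisibility"
begin

section \<open>The Weyl algebra by generators and relations\<close>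

datatype weyl_gen = GenX | GenY

datatype weyl_word = Word (letters: "weyl_gen list")

instantiation weyl_word :: monoid_add
begin

definition zero_weyl_word :: weyl_word where "0 = Word []"

definition plus_weyl_word :: "weyl_word \<Rightarrow> weyl_word \<Rightarrow> weyl_word" where
  "u + v = Word (letters u @ letters v)"

instance
  by standard (simp_all add: zero_weyl_word_def plus_weyl_word_def)

end

text \<open>The addition on words is concatenation, so the convolution product of
  \<^theory>\<open>HOL-Library.Poly_Mapping\<close> makes this type the free unital associative algebra on
  two generators.\<close>

type_synonym 'k free_xy = "weyl_word \<Rightarrow>\<^sub>0 'k"

definition free_gen :: "weyl_gen \<Rightarrow> 'k::field free_xy" where
  "free_gen g = Poly_Mapping.single (Word [g]) 1"

definition weyl_relator :: "'k::field free_xy" where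
  "weyl_relator = free_gen GenY * free_gen GenX - free_gen GenX * free_gen GenY - 1"

inductive_set weyl_ideal :: "'k::field free_xy set" where
  zero: "0 \<in> weyl_ideal"
| relator: "a * weyl_relator * b \<in> weyl_ideal"
| add: "\<lbrakk>a \<in> weyl_ideal; b \<in> weyl_ideal\<rbrakk> \<Longrightarrow> a + b \<in> weyl_ideal"

lemma weyl_ideal_uminus: "a \<in> weyl_ideal \<Longrightarrow> - a \<in> weyl_ideal"
proof (induction rule: weyl_ideal.induct)
  case (relator a b)
  show ?case
    using weyl_ideal.relator[of "- a" b] by simp
next
  case (add a b)
  then show ?case
    using weyl_ideal.add[of "- a" "- b"] by (simp add: add.commute)
qed (simp add: weyl_ideal.zero)

lemma weyl_ideal_diff: "\<lbrakk>a \<in> weyl_ideal; b \<in> weyl_ideal\<rbrakk> \<Longrightarrow> a - b \<in> weyl_ideal"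
  using weyl_ideal.add[of a "- b"] weyl_ideal_uminus[of b] by simp

lemma weyl_ideal_mult_left: "a \<in> weyl_ideal \<Longrightarrow> c * a \<in> weyl_ideal"
  by (induction rule: weyl_ideal.induct)
    (auto simp: distrib_left weyl_ideal.zero weyl_ideal.add mult.assoc[symmetric]
      intro: weyl_ideal.relator)

lemma weyl_ideal_mult_right: "a \<in> weyl_ideal \<Longrightarrow> a * c \<in> weyl_ideal"
proof (induction rule: weyl_ideal.induct)
  case (relator a b)
  show ?case
    using weyl_ideal.relator[of a "b * c"] by (simp add: mult.assoc)
qed (auto simp: distrib_right weyl_ideal.zero weyl_ideal.add)

quotient_type (overloaded) 'k weyl = "('k::field) free_xy" / "\<lambda>a b. a - b \<in> weyl_ideal"
proof (rule equivpI)
  show "reflp (\<lambda>a b :: 'k free_xy. a - b \<in> weyl_ideal)"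
    by (simp add: reflp_def weyl_ideal.zero)
  show "symp (\<lambda>a b :: 'k free_xy. a - b \<in> weyl_ideal)"
    using weyl_ideal_uminus by (force simp: symp_def)
  show "transp (\<lambda>a b :: 'k free_xy. a - b \<in> weyl_ideal)"
  proof (rule transpI)
    fix a b c :: "'k free_xy"
    assume "a - b \<in> weyl_ideal" "b - c \<in> weyl_ideal"
    from weyl_ideal.add[OF this] show "a - c \<in> weyl_ideal" by simp
  qed
qed

text \<open>The relations do not collapse the algebra: it acts on polynomials, with the generators
  acting as multiplication by the variable and as differentiation.\<close>

fun gen_act :: "weyl_gen \<Rightarrow> 'k::field poly \<Rightarrow> 'k poly" where
  "gen_act GenX f = pCons 0 f"
| "gen_act GenY f = pderiv f"

definition word_act :: "weyl_word \<Rightarrow> 'k::field poly \<Rightarrow> 'k poly" where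
  "word_act w f = foldr gen_act (letters w) f"

definition free_act :: "'k::field free_xy \<Rightarrow> 'k poly \<Rightarrow> 'k poly" where
  "free_act a f = (\<Sum>w\<in>Poly_Mapping.keys a. Polynomial.smult (Poly_Mapping.lookup a w) (word_act w f))"

lemma gen_act_linear:
  "gen_act g (f + f') = gen_act g f + gen_act g f'"
  "gen_act g (Polynomial.smult c f) = Polynomial.smult c (gen_act g f)"
  "gen_act g 0 = 0"
  by (cases g; simp add: pderiv_add pderiv_smult)+

lemma word_act_linear:
  "word_act w (f + f') = word_act w f + word_act w (f' :: 'k::field poly)"
  "word_act w (Polynomial.smult c f) = Polynomial.smult c (word_act w f)"
  "word_act w 0 = (0 :: 'k::field poly)"
proof -
  have "foldr gen_act gs (f + f') = foldr gen_act gs f + foldr gen_act gs f' \<and>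
    foldr gen_act gs (Polynomial.smult c f) = Polynomial.smult c (foldr gen_act gs f) \<and>
    foldr gen_act gs 0 = (0 :: 'k poly)" for gs
    by (induction gs) (simp_all add: gen_act_linear)
  then show
    "word_act w (f + f') = word_act w f + word_act w f'"
    "word_act w (Polynomial.smult c f) = Polynomial.smult c (word_act w f)"
    "word_act w 0 = (0 :: 'k poly)"
    by (simp_all add: word_act_def)
qed

lemma free_act_superset:
  assumes "finite S" "Poly_Mapping.keys a \<subseteq> S"
  shows "free_act a f = (\<Sum>w\<in>S. Polynomial.smult (Poly_Mapping.lookup a w) (word_act w f))"
  unfolding free_act_def
  using assms by (intro sum.mono_neutral_left) (auto simp: in_keys_iff)

lemma free_act_add: "free_act (a + b) f = free_act a f + free_act b f"
proof -
  let ?S = "Poly_Mapping.keys a \<union> Poly_Mapping.keys b"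
  have "Poly_Mapping.keys (a + b) \<subseteq> ?S"
    by (rule Poly_Mapping.keys_add)
  then show ?thesis
    by (simp add: free_act_superset[of ?S] lookup_add smult_add_left sum.distrib)
qed

lemma free_act_single: "free_act (Poly_Mapping.single w c) f = Polynomial.smult c (word_act w f)"
  by (simp add: free_act_superset[of "{w}"])

lemma free_act_zero: "free_act 0 f = 0"
  by (simp add: free_act_def)

lemma free_act_uminus: "free_act (- a) f = - free_act a f"
  using free_act_add[of a "- a" f] by (simp add: free_act_zero eq_neg_iff_add_eq_0 add.commute)

lemma free_act_diff: "free_act (a - b) f = free_act a f - free_act b f"
  using free_act_add[of a "- b" f] by (simp add: free_act_uminus)

lemma smult_sum: "Polynomial.smult c (sum g S) = (\<Sum>s\<in>S. Polynomial.smult c (g s))"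
  by (induction S rule: infinite_finite_induct) (simp_all add: smult_add_right)

lemma free_act_linear:
  "free_act a (f + f') = free_act a f + free_act a f'"
  "free_act a (Polynomial.smult c f) = Polynomial.smult c (free_act a f)"
  "free_act a 0 = 0"
  by (simp_all add: free_act_def word_act_linear smult_add_right sum.distrib smult_sum mult.commute)

lemma poly_mapping_as_sum:
  "a = (\<Sum>w\<in>Poly_Mapping.keys a. Poly_Mapping.single w (Poly_Mapping.lookup a w))"
  by (rule poly_mapping_eqI)
    (auto simp: lookup_sum lookup_single when_def in_keys_iff sum.delta)

lemma free_act_mult: "free_act (a * b) f = free_act a (free_act b f)"
proof -
  have sum_left: "free_act (sum g S) f' = (\<Sum>s\<in>S. free_act (g s) f')" for g :: "weyl_word \<Rightarrow> 'a free_xy" and S f'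
    by (induction S rule: infinite_finite_induct) (simp_all add: free_act_zero free_act_add)
  have sum_right: "free_act c (sum g S) = (\<Sum>s\<in>S. free_act c (g s))" for g :: "weyl_word \<Rightarrow> 'a poly" and S c
    by (induction S rule: infinite_finite_induct) (simp_all add: free_act_linear)
  have single: "free_act (Poly_Mapping.single v c * Poly_Mapping.single w d) f
      = free_act (Poly_Mapping.single v c) (free_act (Poly_Mapping.single w d) f)" for v w c d
    by (simp add: mult_single free_act_single word_act_linear)
      (simp add: word_act_def plus_weyl_word_def)
  show ?thesis
    by (subst (1 2) poly_mapping_as_sum[of a], subst (1 2) poly_mapping_as_sum[of b])
      (simp only: sum_product sum_left sum_right single sum.swap[of _ "Poly_Mapping.keys b"])
qed

lemma free_act_one: "free_act 1 f = f"
  using free_act_single[of 0 1 f] by (simp add: word_act_def) (simp add: zero_weyl_word_def)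

lemma free_act_relator: "free_act weyl_relator f = (0 :: 'k::field poly)"
  by (simp add: weyl_relator_def free_gen_def free_act_diff free_act_mult free_act_single
      free_act_one word_act_def pderiv_pCons)

lemma free_act_ideal: "a \<in> weyl_ideal \<Longrightarrow> free_act a f = 0"
  by (induction arbitrary: f rule: weyl_ideal.induct)
    (simp_all add: free_act_zero free_act_add free_act_mult free_act_relator free_act_linear)

lemma one_notin_weyl_ideal: "(1 :: 'k::field free_xy) \<notin> weyl_ideal"
  using free_act_ideal[of 1 1] by (auto simp: free_act_one)

instantiation weyl :: (field) ring_1
begin

lift_definition zero_weyl :: "'a weyl" is 0 .

lift_definition one_weyl :: "'a weyl" is 1 .

lift_definition plus_weyl :: "'a weyl \<Rightarrow> 'a weyl \<Rightarrow> 'a weyl" is "(+)"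
  using weyl_ideal.add by (force simp: algebra_simps)

lift_definition uminus_weyl :: "'a weyl \<Rightarrow> 'a weyl" is uminus
  using weyl_ideal_uminus by force

lift_definition minus_weyl :: "'a weyl \<Rightarrow> 'a weyl \<Rightarrow> 'a weyl" is "(-)"
  using weyl_ideal_diff by (force simp: algebra_simps)

lift_definition times_weyl :: "'a weyl \<Rightarrow> 'a weyl \<Rightarrow> 'a weyl" is "(*)"
proof -
  fix a a' b b' :: "'a free_xy"
  assume "a - a' \<in> weyl_ideal" "b - b' \<in> weyl_ideal"
  then have "(a - a') * b + a' * (b - b') \<in> weyl_ideal"
    by (intro weyl_ideal.add weyl_ideal_mult_left weyl_ideal_mult_right)
  then show "a * b - a' * b' \<in> weyl_ideal"
    by (simp add: algebra_simps)
qed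

instance
proof
  show "(0 :: 'a weyl) \<noteq> 1"
    by transfer (use weyl_ideal_uminus one_notin_weyl_ideal in force)
qed (transfer; simp add: algebra_simps weyl_ideal.zero)+

end

lift_definition weyl_const :: "'k::field \<Rightarrow> 'k weyl" is "\<lambda>c. Poly_Mapping.single 0 c" .

lift_definition weyl_x :: "'k::field weyl" is "free_gen GenX" .

lift_definition weyl_y :: "'k::field weyl" is "free_gen GenY" .

lemma weyl_relation: "weyl_y * weyl_x - weyl_x * weyl_y = (1 :: 'k::field weyl)"
  by transfer (use weyl_ideal.relator[of 1 1] in \<open>simp add: weyl_relator_def\<close>)


section \<open>Rings and modules on subsets\<close>

text \<open>The fields \<open>mult\<close> and \<open>one\<close> of a module record play no role in the locale
  \<^locale>\<open>module\<close>.\<close>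

definition ring_on :: "'a::ring_1 set \<Rightarrow> 'a ring" where
  "ring_on S = \<lparr>carrier = S, mult = (*), one = 1, zero = 0, add = (+)\<rparr>"

definition module_on :: "'m::ab_group_add set \<Rightarrow> ('r \<Rightarrow> 'm \<Rightarrow> 'm) \<Rightarrow> ('r, 'm) module" where
  "module_on S s = \<lparr>carrier = S, mult = undefined, one = undefined, zero = 0, add = (+), smult = s\<rparr>"

definition restrict_scalars :: "('r' \<Rightarrow> 'r) \<Rightarrow> ('r, 'm) module \<Rightarrow> ('r', 'm) module" where
  "restrict_scalars \<phi> M = \<lparr>carrier = carrier M, mult = undefined, one = undefined,
     zero = \<zero>\<^bsub>M\<^esub>, add = add M, smult = (\<lambda>c m. \<phi> c \<odot>\<^bsub>M\<^esub> m)\<rparr>"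

definition quot_module :: "('r, 'm) module \<Rightarrow> 'm set \<Rightarrow> ('r, 'm set) module" where
  "quot_module M N = \<lparr>carrier = a_rcosets\<^bsub>M\<^esub> N, mult = undefined, one = undefined,
     zero = N, add = set_add M, smult = (\<lambda>c C. \<Union>m\<in>C. N +>\<^bsub>M\<^esub> (c \<odot>\<^bsub>M\<^esub> m))\<rparr>"

definition direct_sum :: "('r, 'm) module \<Rightarrow> ('r, 'n) module \<Rightarrow> ('r, 'm \<times> 'n) module" where
  "direct_sum M N = \<lparr>carrier = carrier M \<times> carrier N, mult = undefined, one = undefined,
     zero = (\<zero>\<^bsub>M\<^esub>, \<zero>\<^bsub>N\<^esub>),
     add = (\<lambda>(a, b) (c, d). (a \<oplus>\<^bsub>M\<^esub> c, b \<oplus>\<^bsub>N\<^esub> d)),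
     smult = (\<lambda>r (a, b). (r \<odot>\<^bsub>M\<^esub> a, r \<odot>\<^bsub>N\<^esub> b))\<rparr>"

definition module_iso :: "'r ring \<Rightarrow> ('r, 'm) module \<Rightarrow> ('r, 'n) module \<Rightarrow> ('m \<Rightarrow> 'n) set" where
  "module_iso R M N = {f. module R M \<and> module R N \<and> bij_betw f (carrier M) (carrier N) \<and>
     (\<forall>a\<in>carrier M. \<forall>b\<in>carrier M. f (a \<oplus>\<^bsub>M\<^esub> b) = f a \<oplus>\<^bsub>N\<^esub> f b) \<and>
     (\<forall>r\<in>carrier R. \<forall>a\<in>carrier M. f (r \<odot>\<^bsub>M\<^esub> a) = r \<odot>\<^bsub>N\<^esub> f a)}"


section \<open>Centers and derivations of subalgebras of the Weyl algebra\<close>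

inductive_set subalgebra_gen :: "'k::field weyl set \<Rightarrow> 'k weyl set" for S where
  gen: "a \<in> S \<Longrightarrow> a \<in> subalgebra_gen S"
| const: "weyl_const c \<in> subalgebra_gen S"
| add: "\<lbrakk>a \<in> subalgebra_gen S; b \<in> subalgebra_gen S\<rbrakk> \<Longrightarrow> a + b \<in> subalgebra_gen S"
| mult: "\<lbrakk>a \<in> subalgebra_gen S; b \<in> subalgebra_gen S\<rbrakk> \<Longrightarrow> a * b \<in> subalgebra_gen S"

definition center :: "'k::field weyl set \<Rightarrow> 'k weyl set" where
  "center A = {z \<in> A. \<forall>a\<in>A. z * a = a * z}"

text \<open>Derivations of a subalgebra \<open>A\<close> are extensional functions, so that they are equal as soon
  as they agree on \<open>A\<close>.\<close>

definition derivations :: "'k::field weyl set \<Rightarrow> ('k weyl \<Rightarrow> 'k weyl) set" where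
  "derivations A = {d \<in> A \<rightarrow>\<^sub>E A.
     (\<forall>a\<in>A. \<forall>b\<in>A. d (a + b) = d a + d b) \<and>
     (\<forall>c. \<forall>a\<in>A. d (weyl_const c * a) = weyl_const c * d a) \<and>
     (\<forall>a\<in>A. \<forall>b\<in>A. d (a * b) = d a * b + a * d b)}"

definition Der :: "'k::field weyl set \<Rightarrow> ('k weyl, 'k weyl \<Rightarrow> 'k weyl) module" where
  "Der A = \<lparr>carrier = derivations A, mult = undefined, one = undefined,
     zero = (\<lambda>a\<in>A. 0),
     add = (\<lambda>d e. \<lambda>a\<in>A. d a + e a),
     smult = (\<lambda>z d. \<lambda>a\<in>A. z * d a)\<rparr>"

definition ad :: "'k::field weyl set \<Rightarrow> 'k weyl \<Rightarrow> 'k weyl \<Rightarrow> 'k weyl" where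
  "ad A u = (\<lambda>v\<in>A. u * v - v * u)"

definition Inder :: "'k::field weyl set \<Rightarrow> ('k weyl \<Rightarrow> 'k weyl) set" where
  "Inder A = ad A ` A"

definition HH1 :: "'k::field weyl set \<Rightarrow> ('k weyl, ('k weyl \<Rightarrow> 'k weyl) set) module" where
  "HH1 A = quot_module (Der A) (Inder A)"

definition Res :: "'k::field weyl set \<Rightarrow> ('k weyl \<Rightarrow> 'k weyl) \<Rightarrow> 'k weyl \<Rightarrow> 'k weyl" where
  "Res A d = restrict d (center A)"

text \<open>All derivations in a class modulo inner derivations have the same restriction to the
  center.\<close>

definition Res_bar :: "'k::field weyl set \<Rightarrow> ('k weyl \<Rightarrow> 'k weyl) set \<Rightarrow> 'k weyl \<Rightarrow> 'k weyl" where
  "Res_bar A C = the_elem (Res A ` C)"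

definition ker_Res_bar :: "'k::field weyl set \<Rightarrow> ('k weyl, ('k weyl \<Rightarrow> 'k weyl) set) module" where
  "ker_Res_bar A =
     (HH1 A)\<lparr>carrier := {C \<in> carrier (HH1 A). Res_bar A C = \<zero>\<^bsub>Der (center A)\<^esub>}\<rparr>"


section \<open>The algebras \<open>A\<^sub>h\<close>\<close>

definition weyl_poly :: "'k::field poly \<Rightarrow> 'k weyl" where
  "weyl_poly f = (\<Sum>i\<le>degree f. weyl_const (coeff f i) * weyl_x ^ i)"

definition A_alg :: "'k::field poly \<Rightarrow> 'k weyl set" where
  "A_alg h = subalgebra_gen {weyl_x, weyl_y * weyl_poly h}"

definition normalizer_A :: "'k::field poly \<Rightarrow> 'k weyl set" where
  "normalizer_A h = {u. \<forall>a\<in>A_alg h. u * a - a * u \<in> A_alg h}"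

definition A_plus_center :: "'k::field poly \<Rightarrow> 'k weyl set" where
  "A_plus_center h = {a + z | a z. a \<in> A_alg h \<and> z \<in> center UNIV}"

definition D_der :: "'k::field poly \<Rightarrow> 'k poly \<Rightarrow> 'k weyl \<Rightarrow> 'k weyl" where
  "D_der h r = (THE d. d \<in> derivations (A_alg h) \<and> d weyl_x = 0 \<and> d (weyl_y * weyl_poly h) = weyl_poly r)"

definition Theta :: "'k::field poly \<Rightarrow> 'k poly set" where
  "Theta h = {r. Res (A_alg h) (D_der h r) = \<zero>\<^bsub>Der (center (A_alg h))\<^esub>}"

definition delta :: "'k::field poly \<Rightarrow> 'k poly \<Rightarrow> 'k poly" where
  "delta h f = pderiv f * h"

text \<open>The subring of polynomials in the \<open>p\<close>-th power of the variable, where \<open>p\<close> is the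
  characteristic.\<close>

definition Fxp :: "'k::field poly set" where
  "Fxp = range (\<lambda>g. pcompose g (monom 1 CHAR('k)))"

definition is_monic_gcd_Fxp :: "'k::field poly set \<Rightarrow> 'k poly \<Rightarrow> bool" where
  "is_monic_gcd_Fxp S g \<longleftrightarrow> g \<in> Fxp \<and> lead_coeff g = 1 \<and>
     (\<forall>f\<in>S. g divides\<^bsub>ring_on Fxp\<^esub> f) \<and>
     (\<forall>c\<in>Fxp. (\<forall>f\<in>S. c divides\<^bsub>ring_on Fxp\<^esub> f) \<longrightarrow> c divides\<^bsub>ring_on Fxp\<^esub> g)"

definition rho :: "'k::field poly \<Rightarrow> 'k poly" where
  "rho h = (THE r. r \<in> Fxp \<and> lead_coeff r = 1 \<and> r dvd h \<and>
     (\<forall>s\<in>Fxp. lead_coeff s = 1 \<and> s dvd h \<longrightarrow> degree s \<le> degree r))"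

definition z_central :: "'k::field poly \<Rightarrow> 'k weyl" where
  "z_central h = weyl_poly (h ^ CHAR('k)) * weyl_y ^ CHAR('k)"

definition E_x :: "'k::field weyl \<Rightarrow> 'k weyl" where
  "E_x = (THE d. d \<in> derivations UNIV \<and> d weyl_x = weyl_y ^ (CHAR('k) - 1) \<and> d weyl_y = 0)"

definition F_breve :: "'k::field poly \<Rightarrow> 'k weyl \<Rightarrow> 'k weyl" where
  "F_breve h = (\<lambda>a\<in>A_alg h. z_central h * D_der h (pderiv h div rho h) a
     - weyl_poly (h ^ CHAR('k) div rho h) * E_x a)"

end

theory Submission
  imports Defs "HOL-Library.Product_Plus"
begin

text \<open>Write an element of the Weyl algebra as \<open>\<Sum> f\<^sub>j y\<^sup>j\<close> with \<open>f\<^sub>j \<in> R\<close>, and identify it with its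
  symbol \<open>\<Sum> f\<^sub>j t\<^sup>j\<close>. Then \<open>[y, _]\<close> and \<open>[_, x]\<close> become \<open>\<partial>\<^sub>x\<close> and \<open>\<partial>\<^sub>t\<close>, and \<open>A\<^sub>h\<close> consists of
  the elements with \<open>h\<^sup>j\<close> dividing \<open>f\<^sub>j\<close>. For a derivation \<open>D\<close> of \<open>A\<^sub>h\<close>, the symbol of \<open>D(x\<^sup>p)\<close> is
  \<open>\<partial>\<^sub>t\<^sup>p\<^sup>-\<^sup>1\<close> applied to the symbol of \<open>D(x)\<close>. As \<open>D(x\<^sup>p)\<close> is central, the coefficients of \<open>D(x)\<close> at
  the exponents congruent to \<open>-1\<close> modulo \<open>p\<close> lie in \<open>\<bbbF>[x\<^sup>p]\<close>, and a central multiple of \<open>F\<close> (the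
  derivation \<open>F_breve\<close>) removes them. What is left of \<open>D(x)\<close> is a commutator \<open>[a, x]\<close>. After
  subtracting \<open>ad\<^sub>a\<close>, the image of \<open>y h\<close> commutes with \<open>x\<close>, so it is a polynomial in \<open>y\<^sup>p\<close> over \<open>R\<close>.
  Since \<open>D\<^sub>r\<close> maps \<open>z\<^sub>h\<close> to \<open>\<partial>\<^sub>x\<^sup>p\<^sup>-\<^sup>1(r h\<^sup>p\<^sup>-\<^sup>1)\<close>, which vanishes iff \<open>r \<in> \<Theta>\<close>, a central
  multiple of the derivation given by \<open>qb\<close> reduces its coefficients to \<open>\<Theta>\<close>, and then the terms of positive degree in
  \<open>y\<^sup>p\<close> are inner. Conversely, the values on \<open>x\<^sup>p\<close> and \<open>z\<^sub>h\<close> determine both central multiples.\<close>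

subsection \<open>Representations and the normal form\<close>

text \<open>Two obstacles shape the proof: \<open>D_der h r\<close> would have to send y to r/h, and
  an a with [a, x] = D(x) may lie outside \<open>A_alg h\<close>. Both times the work is done in the
  full Weyl algebra while the powers of h are tracked. Derivations of A_h arise by dividing
  derivations of the Weyl algebra by the central polynomial h^p. For a, integrating the symbol of
  D(x) in t costs one factor h: a = c y with c in A_h. Then ad a may leave A_h, and for the
  corrected image of y h divisibility of the coefficient at y^n by h^n is known only for p | n. This
  suffices, as commuting with x leaves no other exponents. That a normalizes A_h is read off at the
  end, since all other terms preserve A_h. The constants come from the F[x^p]-bilinear form given by
  the (p-1)-st derivative of f g, for which x^i and x^(p-1-i) are dual bases up to (p-1)!. Its
  values on h^(p-1) form the ideal spanned by the gcd of the coordinates of h^(p-1), and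
  \<open>qb\<close> is the Bezout combination in the dual basis. Likewise h^p / rho generates the
  ideal of the elements of F[x^p] that h^(p-1) divides.\<close>

lemma weyl_const_hom:
  "weyl_const 0 = (0::'k::field weyl)" "weyl_const 1 = (1::'k weyl)"
  "weyl_const (c + d) = weyl_const c + (weyl_const d :: 'k weyl)"
  "weyl_const (c * d) = weyl_const c * (weyl_const d :: 'k weyl)"
     apply (transfer; simp add: weyl_ideal.zero)
    apply (transfer; simp add: weyl_ideal.zero)
   apply (transfer; simp add: single_add weyl_ideal.zero)
  apply (transfer; simp add: mult_single weyl_ideal.zero)
  done

lemma weyl_const_uminus: "weyl_const (- c) = - (weyl_const c :: 'k::field weyl)"
  using weyl_const_hom(3)[of c "- c"] by (simp add: weyl_const_hom(1) eq_neg_iff_add_eq_0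
      add.commute)

lemma abs_weyl_hom:
  "abs_weyl (a + b) = abs_weyl a + abs_weyl b"
  "abs_weyl (a * b) = abs_weyl a * abs_weyl b"
  "abs_weyl 0 = 0" "abs_weyl 1 = 1"
  by (simp_all add: plus_weyl.abs_eq times_weyl.abs_eq zero_weyl_def one_weyl_def)

lemma abs_weyl_single_Cons:
  "abs_weyl (Poly_Mapping.single (Word (g # gs)) c)
     = abs_weyl (free_gen g) * abs_weyl (Poly_Mapping.single (Word gs) c)"
  by (simp add: abs_weyl_hom[symmetric] free_gen_def mult_single plus_weyl_word_def)

text \<open>Every element is a sum of scalar multiples of words, and a word grows by prepending a
  letter. So only left multiplication by the generators is needed, which is also the side on which
  the representations below are defined.\<close>

lemma weyl_induct [case_names const add x y]:
  fixes a :: "'k::field weyl"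
  assumes "\<And>c. P (weyl_const c)" "\<And>a b. P a \<Longrightarrow> P b \<Longrightarrow> P (a + b)"
    "\<And>a. P a \<Longrightarrow> P (weyl_x * a)" "\<And>a. P a \<Longrightarrow> P (weyl_y * a)"
  shows "P a"
proof -
  have word: "P (abs_weyl (Poly_Mapping.single (Word gs) c))" for gs c
  proof (induction gs)
    case Nil
    show ?case using assms(1)[of c] by (simp add: weyl_const_def zero_weyl_word_def)
  next
    case (Cons g gs)
    then show ?case
      by (cases g) (simp_all add: abs_weyl_single_Cons assms(3,4)[unfolded weyl_x_def weyl_y_def])
  qed
  have "P (abs_weyl (\<Sum>w\<in>S. Poly_Mapping.single w (f w)))" for S and f :: "weyl_word \<Rightarrow> 'k"
  proof (induction S rule: infinite_finite_induct)
    case (insert w S)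
    then show ?case using word[of "letters w" "f w"] by (simp add: abs_weyl_hom assms(2))
  qed (use assms(1)[of 0] in \<open>simp_all add: abs_weyl_hom weyl_const_hom\<close>)
  then have "P (abs_weyl b)" for b
    by (subst poly_mapping_as_sum)
  then show ?thesis by (induction a rule: weyl.abs_induct)
qed

text \<open>By the presentation, two operators satisfying the Weyl relation are the same as an
  action of the whole algebra. This is used for the left regular representation on symbols, which
  gives normal forms, and for the dual-number module that produces derivations.\<close>

locale weyl_module = vector_space scale
  for scale :: "'k::field \<Rightarrow> 'm::ab_group_add \<Rightarrow> 'm" +
  fixes X Y :: "'m \<Rightarrow> 'm"
  assumes X_add: "X (u + v) = X u + X v" and Y_add: "Y (u + v) = Y u + Y v"
    and X_scale: "X (scale c v) = scale c (X v)" and Y_scale: "Y (scale c v) = scale c (Y v)"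
    and YX: "Y (X v) = X (Y v) + v"
begin

primrec gen_op :: "weyl_gen \<Rightarrow> 'm \<Rightarrow> 'm" where
  "gen_op GenX = X" | "gen_op GenY = Y"

definition word_op :: "weyl_word \<Rightarrow> 'm \<Rightarrow> 'm" where
  "word_op w = foldr gen_op (letters w)"

definition free_op :: "'k free_xy \<Rightarrow> 'm \<Rightarrow> 'm" where
  "free_op a v = (\<Sum>w\<in>Poly_Mapping.keys a. scale (Poly_Mapping.lookup a w) (word_op w v))"

definition act :: "'k weyl \<Rightarrow> 'm \<Rightarrow> 'm" where
  "act a = free_op (rep_weyl a)"

lemma gen_op_add: "gen_op g (u + v) = gen_op g u + gen_op g v"
  by (cases g) (simp_all add: X_add Y_add)

lemma gen_op_scale: "gen_op g (scale c v) = scale c (gen_op g v)"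
  by (cases g) (simp_all add: X_scale Y_scale)

lemma word_op_add: "word_op w (u + v) = word_op w u + word_op w v"
proof -
  have "foldr gen_op gs (u + v) = foldr gen_op gs u + foldr gen_op gs v" for gs
    by (induction gs) (simp_all add: gen_op_add)
  then show ?thesis by (simp add: word_op_def)
qed

lemma word_op_scale: "word_op w (scale c v) = scale c (word_op w v)"
proof -
  have "foldr gen_op gs (scale c v) = scale c (foldr gen_op gs v)" for gs
    by (induction gs) (simp_all add: gen_op_scale)
  then show ?thesis by (simp add: word_op_def)
qed

lemma free_op_superset:
  assumes "finite S" "Poly_Mapping.keys a \<subseteq> S"
  shows "free_op a v = (\<Sum>w\<in>S. scale (Poly_Mapping.lookup a w) (word_op w v))"
  unfolding free_op_def
  using assms by (intro sum.mono_neutral_left) (auto simp: in_keys_iff)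

lemma free_op_add_left: "free_op (a + b) v = free_op a v + free_op b v"
proof -
  let ?S = "Poly_Mapping.keys a \<union> Poly_Mapping.keys b"
  have "Poly_Mapping.keys (a + b) \<subseteq> ?S"
    by (rule Poly_Mapping.keys_add)
  then show ?thesis
    by (simp add: free_op_superset[of ?S] lookup_add scale_left_distrib sum.distrib)
qed

lemma free_op_single: "free_op (Poly_Mapping.single w c) v = scale c (word_op w v)"
  by (simp add: free_op_superset[of "{w}"])

lemma free_op_0: "free_op 0 v = 0"
  by (simp add: free_op_def)

lemma free_op_add: "free_op a (u + v) = free_op a u + free_op a v"
  by (simp add: free_op_def word_op_add scale_right_distrib sum.distrib)

lemma free_op_scale: "free_op a (scale c v) = scale c (free_op a v)"
  by (simp add: free_op_def word_op_scale scale_sum_right mult.commute)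

lemma free_op_mult: "free_op (a * b) v = free_op a (free_op b v)"
proof -
  have zero: "free_op c 0 = 0" for c
    using free_op_scale[of c 0 0] by simp
  have sum_left: "free_op (sum g S) u = (\<Sum>s\<in>S. free_op (g s) u)"
    for g :: "weyl_word \<Rightarrow> 'k free_xy" and S u
    by (induction S rule: infinite_finite_induct) (simp_all add: free_op_0 free_op_add_left)
  have sum_right: "free_op c (sum g S) = (\<Sum>s\<in>S. free_op c (g s))"
    for g :: "weyl_word \<Rightarrow> 'm" and S c
    by (induction S rule: infinite_finite_induct) (simp_all add: zero free_op_add)
  have single: "free_op (Poly_Mapping.single w c * Poly_Mapping.single w' d) v
      = free_op (Poly_Mapping.single w c) (free_op (Poly_Mapping.single w' d) v)" for w c w' d
    by (simp add: mult_single free_op_single word_op_scale)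
      (simp add: word_op_def plus_weyl_word_def)
  show ?thesis
    by (subst (1 2) poly_mapping_as_sum[of a], subst (1 2) poly_mapping_as_sum[of b])
      (simp only: sum_product sum_left sum_right single sum.swap[of _ "Poly_Mapping.keys b"])
qed

lemma free_op_uminus: "free_op (- a) v = - free_op a v"
  using free_op_add_left[of a "- a" v] by (simp add: free_op_0 eq_neg_iff_add_eq_0 add.commute)

lemma free_op_diff: "free_op (a - b) v = free_op a v - free_op b v"
  using free_op_add_left[of a "- b" v] by (simp add: free_op_uminus)

lemma free_op_const: "free_op (Poly_Mapping.single 0 c) v = scale c v"
  by (simp add: free_op_single) (simp add: word_op_def zero_weyl_word_def)

lemma free_op_ideal: "a \<in> weyl_ideal \<Longrightarrow> free_op a v = 0"
proof (induction arbitrary: v rule: weyl_ideal.induct)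
  case (relator a b)
  have "free_op weyl_relator u = 0" for u
    using free_op_const[of 1 u]
    by (simp add: weyl_relator_def free_gen_def free_op_diff free_op_mult free_op_single
        word_op_def YX)
  then show ?case using free_op_scale[of a 0 0] by (simp add: free_op_mult)
qed (simp_all add: free_op_0 free_op_add_left)

text \<open>The representative picked by \<open>rep_weyl\<close> differs from \<open>a\<close> by an
  element of the ideal, and the ideal acts as zero, so the choice made in \<open>act\<close> is
  invisible.\<close>

lemma act_abs: "act (abs_weyl a) v = free_op a v"
proof -
  have "rep_weyl (abs_weyl a) - a \<in> weyl_ideal"
    using Quotient3_rel_rep[OF Quotient3_weyl] Quotient3_abs_rep[OF Quotient3_weyl]
      Quotient3_rel[OF Quotient3_weyl, of "rep_weyl (abs_weyl a)" a]
    by (auto simp: weyl_ideal.zero)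
  from free_op_ideal[OF this, of v] show ?thesis
    by (simp add: act_def free_op_diff)
qed

lemma act_add_left: "act (a + b) v = act a v + act b v"
  by (induction a rule: weyl.abs_induct, induction b rule: weyl.abs_induct)
    (simp add: abs_weyl_hom(1)[symmetric] act_abs free_op_add_left)

lemma act_mult: "act (a * b) v = act a (act b v)"
  by (induction a rule: weyl.abs_induct, induction b rule: weyl.abs_induct)
    (simp add: abs_weyl_hom(2)[symmetric] act_abs free_op_mult)

lemma act_const: "act (weyl_const c) v = scale c v"
  by (simp add: weyl_const_def act_abs free_op_const)

lemma act_x: "act weyl_x v = X v" and act_y: "act weyl_y v = Y v"
  by (simp_all add: weyl_x_def weyl_y_def act_abs free_gen_def free_op_single word_op_def)

end

lemma weyl_const_commute: "a * weyl_const c = weyl_const c * (a :: 'k::field weyl)"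
proof (induction a rule: weyl_induct)
  case (x a)
  have "weyl_x * weyl_const c = weyl_const c * (weyl_x :: 'k weyl)"
    by transfer (simp add: free_gen_def mult_single weyl_ideal.zero)
  with x show ?case by (metis mult.assoc)
next
  case (y a)
  have "weyl_y * weyl_const c = weyl_const c * (weyl_y :: 'k weyl)"
    by transfer (simp add: free_gen_def mult_single weyl_ideal.zero)
  with y show ?case by (metis mult.assoc)
qed (simp_all add: weyl_const_hom(4)[symmetric] mult.commute distrib_left distrib_right)

lemma weyl_poly_0 [simp]: "weyl_poly 0 = (0 :: 'k::field weyl)"
  by (simp add: weyl_poly_def weyl_const_hom)

lemma weyl_poly_superset:
  "degree f \<le> n \<Longrightarrow> weyl_poly f = (\<Sum>i\<le>n. weyl_const (coeff f i) * weyl_x ^ i)"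
  unfolding weyl_poly_def
  by (rule sum.mono_neutral_left) (auto simp: coeff_eq_0 weyl_const_hom)

lemma weyl_poly_pCons: "weyl_poly (pCons c f) = weyl_const c + weyl_x * (weyl_poly f :: 'k::field
    weyl)"
proof -
  have "weyl_poly (pCons c f) = (\<Sum>i\<le>Suc (degree f). weyl_const (coeff (pCons c f) i) * weyl_x ^ i)"
    by (rule weyl_poly_superset) (simp add: degree_pCons_le)
  also have "\<dots> = weyl_const c + weyl_x * weyl_poly f"
    by (simp add: sum.atMost_Suc_shift weyl_poly_def sum_distrib_left del: sum.atMost_Suc)
      (simp add: mult.assoc[symmetric] weyl_const_commute)
  finally show ?thesis .
qed

lemma weyl_poly_add: "weyl_poly (f + g) = weyl_poly f + (weyl_poly g :: 'k::field weyl)"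
  by (induction f g rule: poly_induct2)
    (simp_all add: weyl_poly_pCons weyl_const_hom algebra_simps)

lemma weyl_poly_smult: "weyl_poly (Polynomial.smult c f) = weyl_const c * (weyl_poly f ::
    'k::field weyl)"
proof (induction f)
  case (pCons a f)
  have "weyl_x * (weyl_const c * weyl_poly f) = weyl_const c * (weyl_x * weyl_poly f)"
    by (metis weyl_const_commute mult.assoc)
  with pCons show ?case by (simp add: weyl_poly_pCons weyl_const_hom distrib_left)
qed simp

lemma weyl_poly_mult: "weyl_poly (f * g) = weyl_poly f * (weyl_poly g :: 'k::field weyl)"
  by (induction f)
    (simp_all add: weyl_poly_pCons weyl_poly_add weyl_poly_smult weyl_const_hom distrib_right
        mult.assoc)

lemma weyl_poly_const: "weyl_poly [:c:] = weyl_const c"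
  by (simp add: weyl_poly_pCons)

lemma weyl_poly_1 [simp]: "weyl_poly 1 = (1 :: 'k::field weyl)"
  using weyl_poly_const[of "1::'k"] by (simp add: weyl_const_hom one_pCons)

lemma weyl_poly_x: "weyl_poly [:0, 1:] = weyl_x"
  by (simp add: weyl_poly_pCons weyl_const_hom)

lemma weyl_poly_power: "weyl_poly (f ^ n) = (weyl_poly f :: 'k::field weyl) ^ n"
  by (induction n) (simp_all add: weyl_poly_mult)

lemma weyl_poly_commute: "weyl_poly f * weyl_poly g = weyl_poly g * (weyl_poly f :: 'k::field weyl)"
  by (simp add: weyl_poly_mult[symmetric] mult.commute)

text \<open>Symbols are polynomials in t over F[x]: this is their derivative in x, while
  \<open>pderiv\<close> is their derivative in t.\<close>

abbreviation coeff_deriv :: "'k::field poly poly \<Rightarrow> 'k poly poly" where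
  "coeff_deriv \<equiv> map_poly pderiv"

lemma coeff_coeff_deriv [simp]: "coeff (coeff_deriv P) n = pderiv (coeff P n)"
  by (simp add: coeff_map_poly)

lemma coeff_deriv_add: "coeff_deriv (P + Q) = coeff_deriv P + coeff_deriv Q"
  by (rule poly_eqI) (simp add: pderiv_add)

lemma coeff_deriv_smult:
  "coeff_deriv (Polynomial.smult f P) = Polynomial.smult (pderiv f) P + Polynomial.smult f
      (coeff_deriv P)"
  by (rule poly_eqI) (simp add: pderiv_mult mult.commute add.commute)

lemma coeff_deriv_pCons: "coeff_deriv (pCons f P) = pCons (pderiv f) (coeff_deriv P)"
  by (rule poly_eqI) (simp add: coeff_pCons split: nat.split)

text \<open>The left regular representation on symbols: \<open>\<Sum> f\<^sub>j y\<^sup>j\<close> corresponds to \<open>\<Sum> f\<^sub>j t\<^sup>j\<close>,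
  a polynomial in \<open>t\<close> over \<open>\<bbbF>[x]\<close>, so that \<open>y\<close> acts as \<open>\<partial>\<^sub>x + t\<close>.\<close>

interpretation symbol: weyl_module
  "\<lambda>c P. Polynomial.smult [:c:] P :: 'k::field poly poly" "Polynomial.smult [:0, 1:]"
  "\<lambda>P. coeff_deriv P + pCons 0 P"
proof unfold_locales
  fix v :: "'k poly poly"
  show one: "Polynomial.smult [:1:] v = v"
    by (metis one_pCons smult_1_left)
  show "coeff_deriv (Polynomial.smult [:0, 1:] v) + pCons 0 (Polynomial.smult [:0, 1:] v)
      = Polynomial.smult [:0, 1:] (coeff_deriv v + pCons 0 v) + v"
    by (simp add: coeff_deriv_smult pderiv_pCons smult_add_right add_ac one)
  show "Polynomial.smult [:a + b:] v = Polynomial.smult [:a:] v + Polynomial.smult [:b:] v" for a b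
    by (simp flip: smult_add_left)
qed (simp_all add: coeff_deriv_smult coeff_deriv_add smult_add_right mult.commute add_ac)

text \<open>The action is left multiplication transported to symbols, so applying an element to the
  symbol of the unit returns its own symbol. No reordering of words has to be carried out.\<close>

definition nf :: "'k::field weyl \<Rightarrow> 'k poly poly" where
  "nf a = symbol.act a 1"

lemma nf_add: "nf (a + b) = nf a + nf b"
  by (simp add: nf_def symbol.act_add_left)

lemma nf_const: "nf (weyl_const c) = [:[:c:]:]"
  by (simp add: nf_def symbol.act_const)

lemma nf_x_mult: "nf (weyl_x * a) = Polynomial.smult [:0, 1:] (nf a)"
  and nf_y_mult: "nf (weyl_y * a) = coeff_deriv (nf a) + pCons 0 (nf a)"
  and nf_const_mult: "nf (weyl_const c * a) = Polynomial.smult [:c:] (nf a)"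
  by (simp_all add: nf_def symbol.act_mult symbol.act_x symbol.act_y symbol.act_const)

lemma nf_0 [simp]: "nf 0 = 0" and nf_1 [simp]: "nf 1 = 1"
  using nf_const[of 0] nf_const[of 1] by (simp_all add: weyl_const_hom one_pCons)

lemma nf_uminus: "nf (- a) = - nf a"
  using nf_add[of a "- a"] by (simp add: eq_neg_iff_add_eq_0 add.commute)

lemma nf_diff: "nf (a - b) = nf a - nf b"
  using nf_add[of a "- b"] by (simp add: nf_uminus)

lemma nf_sum: "nf (sum f S) = (\<Sum>s\<in>S. nf (f s))"
  by (induction S rule: infinite_finite_induct) (simp_all add: nf_add)

lemma nf_poly_mult: "nf (weyl_poly f * a) = Polynomial.smult f (nf a)"
proof (induction f)
  case (pCons c f)
  have "nf (weyl_poly (pCons c f) * a) = Polynomial.smult [:c:] (nf a) + Polynomial.smult [:0, 1:]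
      (Polynomial.smult f (nf a))"
    using pCons by (simp add: weyl_poly_pCons distrib_right nf_add nf_const_mult mult.assoc
        nf_x_mult)
  then show ?case by (simp flip: smult_add_left)
qed simp

lemma nf_poly: "nf (weyl_poly f) = [:f:]"
  using nf_poly_mult[of f 1] by simp

lemma nf_mult_y: "nf (a * weyl_y) = pCons 0 (nf a)"
proof (induction a rule: weyl_induct)
  case (const c)
  have "nf (weyl_y :: 'a weyl) = pCons 0 1"
    using nf_y_mult[of "1 :: 'a weyl"] by (simp add: one_pCons coeff_deriv_pCons)
  then show ?case by (simp add: nf_const_mult nf_const one_pCons)
next
  case (y a)
  then show ?case by (simp add: mult.assoc nf_y_mult coeff_deriv_pCons)
qed (simp_all add: distrib_right nf_add mult.assoc nf_x_mult)

text \<open>Moving x to the left past y^j costs j y^(j-1), the derivative of t^j. In the induction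
  the case of y rests on the two partial derivatives commuting.\<close>

lemma nf_mult_x: "nf (a * weyl_x) = Polynomial.smult [:0, 1:] (nf a) + pderiv (nf a)"
proof (induction a rule: weyl_induct)
  case (const c)
  have "nf (weyl_x :: 'a weyl) = [:[:0, 1:]:]"
    using nf_x_mult[of "1 :: 'a weyl"] by simp
  then show ?case by (simp add: nf_const_mult nf_const pderiv_pCons)
next
  case (y a)
  have "pderiv (coeff_deriv P) = coeff_deriv (pderiv P)" for P :: "'a poly poly"
    by (rule poly_eqI) (simp add: coeff_pderiv pderiv_mult flip: of_nat_Suc)
  with y show ?case
    by (simp add: mult.assoc nf_y_mult coeff_deriv_add coeff_deriv_smult pderiv_add pderiv_pCons
        smult_add_right add_ac)
qed (simp_all add: distrib_right nf_add mult.assoc nf_x_mult smult_add_right pderiv_add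
    pderiv_smult add_ac mult.commute)

lemma weyl_y_poly: "weyl_y * weyl_poly f = weyl_poly f * weyl_y + weyl_poly (pderiv f :: 'k::field
    poly)"
proof (induction f)
  case (pCons c f)
  have "weyl_y * weyl_poly (pCons c f) = weyl_const c * weyl_y + weyl_y * weyl_x * weyl_poly f"
    by (simp add: weyl_poly_pCons distrib_left weyl_const_commute mult.assoc)
  also have "weyl_y * weyl_x = weyl_x * weyl_y + (1 :: 'k weyl)"
    using weyl_relation[where 'k='k] by (simp add: diff_eq_eq add.commute)
  also have "(weyl_x * weyl_y + 1) * weyl_poly f = weyl_x * (weyl_y * weyl_poly f) + weyl_poly f"
    by (simp add: distrib_right mult.assoc)
  finally show ?case
    by (simp add: pCons weyl_poly_pCons pderiv_pCons weyl_poly_add weyl_const_hom algebra_simps)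
qed simp

lemma nf_surj: "\<exists>a. nf a = P"
proof (induction P)
  case (pCons f P)
  then obtain a where "nf a = P" by blast
  then have "nf (weyl_poly f + a * weyl_y) = pCons f P"
    by (simp add: nf_add nf_poly nf_mult_y)
  then show ?case by blast
qed (use nf_0 in blast)

text \<open>The expressions \<open>\<Sum> f\<^sub>j y\<^sup>j\<close> form a left ideal containing 1, and the symbol of such an
  expression determines it.\<close>

lemma inj_nf: "inj (nf :: 'k::field weyl \<Rightarrow> 'k poly poly)"
proof -
  define W :: "'k poly poly \<Rightarrow> 'k weyl" where
    "W P = (\<Sum>j\<le>degree P. weyl_poly (coeff P j) * weyl_y ^ j)" for P
  have W_superset: "W P = (\<Sum>j\<le>n. weyl_poly (coeff P j) * weyl_y ^ j)" if "degree P \<le> n" for P n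
    unfolding W_def using that by (intro sum.mono_neutral_left) (auto simp: coeff_eq_0)
  have W_pCons: "W (pCons f P) = weyl_poly f + W P * weyl_y" for f P
  proof -
    have "W (pCons f P) = (\<Sum>j\<le>Suc (degree P). weyl_poly (coeff (pCons f P) j) * weyl_y ^ j)"
      by (rule W_superset) (simp add: degree_pCons_le)
    also have "\<dots> = weyl_poly f + W P * weyl_y"
      by (simp add: sum.atMost_Suc_shift W_def sum_distrib_right mult.assoc power_commutes
          del: sum.atMost_Suc)
    finally show ?thesis .
  qed
  have W_0: "W 0 = 0" by (simp add: W_def)
  have W_add: "W (P + Q) = W P + W Q" for P Q
    by (induction P Q rule: poly_induct2) (simp_all add: W_pCons W_0 weyl_poly_add algebra_simps)
  have W_smult: "W (Polynomial.smult f P) = weyl_poly f * W P" for f P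
    by (induction P) (simp_all add: W_pCons W_0 weyl_poly_mult weyl_poly_commute[of f]
        algebra_simps)
  have W_y: "W (coeff_deriv P + pCons 0 P) = weyl_y * W P" for P
  proof (induction P)
    case (pCons f P)
    have "weyl_y * W (pCons f P) = weyl_poly (pderiv f) + (weyl_poly f + weyl_y * W P) * weyl_y"
      by (simp add: W_pCons distrib_left distrib_right weyl_y_poly mult.assoc add_ac)
    also have "\<dots> = W (coeff_deriv (pCons f P) + pCons 0 (pCons f P))"
      using pCons by (simp add: coeff_deriv_pCons W_pCons W_add algebra_simps)
    finally show ?case by simp
  qed (simp add: W_0)
  have "W (nf a) = a" for a
  proof (induction a rule: weyl_induct)
    case (const c)
    show ?case by (simp add: nf_const W_pCons W_0 weyl_poly_const)
  next
    case (y a)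
    then show ?case using W_y[of "nf a"] by (simp add: nf_y_mult)
  qed (simp_all add: nf_add W_add nf_x_mult W_smult weyl_poly_x)
  then show ?thesis by (rule inj_on_inverseI)
qed

lemma nf_eq_iff [simp]: "nf a = nf b \<longleftrightarrow> a = b"
  using inj_nf by (auto dest: injD)

lemma nf_eq_0_iff [simp]: "nf a = 0 \<longleftrightarrow> a = 0"
  using nf_eq_iff[of a 0] by simp

lemma nf_commutator_x: "nf (a * weyl_x - weyl_x * a) = pderiv (nf a)"
  by (simp add: nf_diff nf_mult_x nf_x_mult)

lemma nf_commutator_y: "nf (weyl_y * a - a * weyl_y) = coeff_deriv (nf a)"
  by (simp add: nf_diff nf_mult_y nf_y_mult)

lemma nf_mult_y_power: "nf (a * weyl_y ^ n) = monom 1 n * nf a"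
  by (induction n) (simp_all add: power_Suc2 mult.assoc[symmetric] nf_mult_y monom_Suc del:
      power_Suc)

lemma commute_poly:
  fixes z :: "'k::field weyl"
  assumes "z * weyl_x = weyl_x * z"
  shows "z * weyl_poly f = weyl_poly f * z"
proof (induction f)
  case (pCons c f)
  have "z * (weyl_x * weyl_poly f) = weyl_x * weyl_poly f * z"
    using assms pCons by (metis mult.assoc)
  then show ?case by (simp add: weyl_poly_pCons algebra_simps weyl_const_commute)
qed simp

lemma center_UNIV_iff:
  fixes z :: "'k::field weyl"
  shows "z \<in> center UNIV \<longleftrightarrow> z * weyl_x = weyl_x * z \<and> z * weyl_y = weyl_y * z"
proof
  assume *: "z * weyl_x = weyl_x * z \<and> z * weyl_y = weyl_y * z"
  have "z * a = a * z" for a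
  proof (induction a rule: weyl_induct)
    case (x a) then show ?case using * by (metis mult.assoc)
  next
    case (y a) then show ?case using * by (metis mult.assoc)
  qed (simp_all add: weyl_const_commute algebra_simps)
  then show "z \<in> center UNIV" by (simp add: center_def)
qed (simp add: center_def)

lemma commutes_x_iff_nf: "z * weyl_x = weyl_x * z \<longleftrightarrow> pderiv (nf z) = 0"
  by (metis nf_commutator_x nf_eq_0_iff right_minus_eq)

lemma commutes_y_iff_nf: "z * weyl_y = weyl_y * z \<longleftrightarrow> coeff_deriv (nf z) = 0"
  by (metis nf_commutator_y nf_eq_0_iff right_minus_eq)

lemma center_UNIV_iff_nf: "z \<in> center UNIV \<longleftrightarrow> pderiv (nf z) = 0 \<and> coeff_deriv (nf z) = 0"
  by (simp add: center_UNIV_iff commutes_x_iff_nf commutes_y_iff_nf)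

subsection \<open>Polynomials in characteristic \<open>p\<close>\<close>

text \<open>Later symbols are built one coefficient at a time from solvability at each exponent. The
  second hypothesis allows the value 0 beyond a bound, so that the chosen coefficients do form a
  polynomial.\<close>

lemma poly_choice:
  fixes Q :: "nat \<Rightarrow> 'a::zero \<Rightarrow> bool"
  assumes "\<And>n. \<exists>c. Q n c" "\<And>n. n > N \<Longrightarrow> Q n 0"
  shows "\<exists>P. \<forall>n. Q n (coeff P n)"
proof -
  from assms(1) obtain c where c: "Q n (c n)" for n by metis
  define d where "d n = (if n \<le> N then c n else 0)" for n
  have "coeff (Abs_poly d) = d"
    by (rule coeff_Abs_poly[of N]) (simp add: d_def)
  moreover have "Q n (d n)" for n
    using c assms(2) by (auto simp: d_def)
  ultimately show ?thesis by metis
qed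

text \<open>Bezout over the integers gives the inverse. The ring is not assumed to be a field,
  because symbols have their coefficients in F[x].\<close>

lemma of_nat_unit:
  assumes "Factorial_Ring.prime CHAR('a::comm_ring_1)" "\<not> CHAR('a) dvd n"
  shows "\<exists>u. u * of_nat n = (1 :: 'a)"
proof -
  have "coprime CHAR('a) n"
    using assms by (simp add: prime_imp_coprime)
  then obtain u v :: int where "u * int n + v * int CHAR('a) = 1"
    using bezout_int[of "int n" "int CHAR('a)"] by (auto simp: coprime_commute gcd_int_int_eq)
  then have "of_int (u * int n + v * int CHAR('a)) = (1 :: 'a)"
    by simp
  then show ?thesis by auto
qed

lemma pderiv_eq_0_iff_coeff:
  fixes f :: "'a::idom poly"
  shows "pderiv f = 0 \<longleftrightarrow> (\<forall>n. \<not> CHAR('a) dvd n \<longrightarrow> coeff f n = 0)"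
proof -
  have "pderiv f = 0 \<longleftrightarrow> (\<forall>n. CHAR('a) dvd Suc n \<or> coeff f (Suc n) = 0)"
    by (simp add: poly_eq_iff coeff_pderiv of_nat_eq_0_iff_char_dvd del: of_nat_Suc)
  also have "\<dots> \<longleftrightarrow> (\<forall>n. \<not> CHAR('a) dvd n \<longrightarrow> coeff f n = 0)"
    by (metis dvd_0_right not0_implies_Suc)
  finally show ?thesis .
qed

text \<open>Integration of t^n divides by n + 1, which is possible unless p divides n + 1, and there
  the coefficient is assumed to vanish. The divisibility in the conclusion keeps the powers of h in
  the coefficients through the integration; where p divides n + 1 it forces the new coefficient to
  be 0.\<close>

lemma antiderivative:
  fixes f :: "'a::idom poly"
  assumes char: "CHAR('a) > 0" and "\<And>n. CHAR('a) dvd Suc n \<Longrightarrow> coeff f n = 0"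
  shows "\<exists>g. pderiv g = f \<and> coeff g 0 = 0 \<and> (\<forall>n. coeff f n dvd coeff g (Suc n))"
proof -
  define Q where "Q n c \<longleftrightarrow> (case n of 0 \<Rightarrow> c = 0 | Suc m \<Rightarrow> of_nat n * c = coeff f m \<and> coeff f m dvd
      c)"
    for n and c :: 'a
  have "\<exists>c. Q n c" for n
  proof (cases n)
    case (Suc m)
    show ?thesis
    proof (cases "CHAR('a) dvd n")
      case False
      then obtain u where "u * of_nat n = (1 :: 'a)"
        using of_nat_unit prime_CHAR_semidom char by blast
      then have "Q n (u * coeff f m)"
        using Suc by (simp add: Q_def mult.assoc[symmetric] mult.commute)
      then show ?thesis ..
    qed (use assms(2) Suc in \<open>auto simp: Q_def\<close>)
  qed (simp add: Q_def)
  moreover have "Q n 0" if "n > Suc (degree f)" for n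
    using that by (auto simp: Q_def coeff_eq_0 split: nat.split)
  ultimately obtain g where "Q n (coeff g n)" for n
    using poly_choice[of Q] by blast
  then have g: "Q 0 (coeff g 0)" "Q (Suc n) (coeff g (Suc n))" for n by blast+
  have "pderiv g = f"
    by (rule poly_eqI) (use g(2) in \<open>simp add: Q_def coeff_pderiv\<close>)
  with g show ?thesis by (auto simp: Q_def)
qed

lemma fact_CHAR_neq_0:
  assumes "CHAR('a::idom) > 0"
  shows "of_nat (fact (CHAR('a) - 1)) \<noteq> (0 :: 'a)"
proof -
  have "Factorial_Ring.prime CHAR('a)" using prime_CHAR_semidom assms .
  moreover have "\<not> CHAR('a) \<le> CHAR('a) - 1" using assms by simp
  ultimately have "\<not> CHAR('a) dvd fact (CHAR('a) - 1)"
    using prime_dvd_fact_iff by blast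
  then show ?thesis
    by (simp add: of_nat_eq_0_iff_char_dvd)
qed

text \<open>The factor (n+1)...(n+p-1) is congruent to (p-1)! if p divides n, and contains a
  multiple of p otherwise.\<close>

lemma coeff_higher_pderiv_CHAR:
  fixes f :: "'a::idom poly"
  assumes char: "CHAR('a) > 0"
  shows "coeff ((pderiv ^^ (CHAR('a) - 1)) f) n
    = (if CHAR('a) dvd n then of_nat (fact (CHAR('a) - 1)) * coeff f (n + (CHAR('a) - 1)) else 0)"
proof (cases "CHAR('a) dvd n")
  case True
  then have "of_nat (Suc n) = (of_nat 1 :: 'a)"
    by (simp add: of_nat_eq_0_iff_char_dvd[symmetric])
  with True show ?thesis
    by (simp only: coeff_higher_pderiv pochhammer_of_nat) (simp add: pochhammer_fact)
next
  case False
  \<comment> \<open>Chosen so that n + 1 + i is the next multiple of p after n; this factor occurs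
    in the product because i < p - 1.\<close>
  define i where "i = CHAR('a) - 1 - n mod CHAR('a)"
  have "n mod CHAR('a) > 0" "n mod CHAR('a) < CHAR('a)"
    using False char by (auto simp: mod_greater_zero_iff_not_dvd)
  then have i: "i < CHAR('a) - 1" "Suc n + i = CHAR('a) * (n div CHAR('a)) + CHAR('a)"
    using mult_div_mod_eq[of "CHAR('a)" n] unfolding i_def by linarith+
  then have "of_nat (Suc n + i) = (0::'a)"
    by (simp only: of_nat_eq_0_iff_char_dvd) simp
  then have "of_nat (Suc n) = (- of_nat i :: 'a)"
    by (simp only: of_nat_add eq_neg_iff_add_eq_0)
  with i(1) have "pochhammer (of_nat (Suc n) :: 'a) (CHAR('a) - 1) = 0"
    by (metis pochhammer_of_nat_eq_0_lemma)
  with False show ?thesis by (simp add: coeff_higher_pderiv)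
qed

text \<open>The exponents that survive p - 1 derivatives are exactly those at which integration is
  obstructed.\<close>

lemma higher_pderiv_eq_0_imp_pderiv:
  fixes f :: "'a::idom poly"
  assumes char: "CHAR('a) > 0" and f: "(pderiv ^^ (CHAR('a) - 1)) f = 0"
  shows "\<exists>g. pderiv g = f"
proof -
  have "coeff f n = 0" if "CHAR('a) dvd Suc n" for n
  proof -
    have n: "n = Suc n - CHAR('a) + (CHAR('a) - 1)"
      using dvd_imp_le[OF that] char by simp
    have "CHAR('a) dvd Suc n - CHAR('a)"
      using that by (simp add: dvd_diff_nat)
    then have "of_nat (fact (CHAR('a) - 1)) * coeff f n = 0"
      using coeff_higher_pderiv_CHAR[OF char, of f "Suc n - CHAR('a)"] f n by simp
    then show ?thesis using fact_CHAR_neq_0[OF char] by simp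
  qed
  from antiderivative[OF char this] show ?thesis by blast
qed

lemma higher_pderiv_mult_const:
  fixes f g :: "'a::idom poly"
  assumes "pderiv g = 0"
  shows "(pderiv ^^ n) (g * f) = g * (pderiv ^^ n) f"
  by (induction n) (simp_all add: pderiv_mult assms)

lemma pderiv_power_CHAR: "pderiv (f ^ CHAR('a)) = (0 :: 'a::idom poly)"
proof (cases "CHAR('a) = 0")
  case False
  then obtain n where "CHAR('a) = Suc n" by (cases "CHAR('a)") auto
  then have "of_nat (Suc n) = (0 :: 'a)"
    using of_nat_CHAR[where 'a='a] by simp
  then show ?thesis
    by (simp add: \<open>CHAR('a) = Suc n\<close> pderiv_power_Suc del: of_nat_Suc power_Suc)
qed simp

text \<open>If \<open>L\<close> and \<open>R\<close> are commuting operators with \<open>R - L = l\<close>, then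
  \<open>\<Sum>\<^sub>i L\<^sup>i R\<^sup>p\<^sup>-\<^sup>1\<^sup>-\<^sup>i = l\<^sup>p\<^sup>-\<^sup>1\<close> in characteristic \<open>p\<close>; here \<open>L\<close> is multiplication by \<open>\<tau>\<close>,
  and the sums for the exponents \<open>n\<close> are given by their recursion.\<close>

lemma char_p_power_sum:
  fixes \<tau> f :: "'a::idom"
  assumes char: "CHAR('a) > 0"
    and add: "\<And>a b. l (a + b) = l a + l b" and mult: "\<And>a. l (\<tau> * a) = \<tau> * l a"
    and P: "P 0 = 0" "\<And>n. P (Suc n) = \<tau> * P n + l (P n) + \<tau> ^ n * f"
  shows "P CHAR('a) = (l ^^ (CHAR('a) - 1)) f"
proof -
  have l_0: "l 0 = 0" using add[of 0 0] by (metis add_0 add_cancel_right_right)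
  have l_power: "l (\<tau> ^ n * a) = \<tau> ^ n * l a" for n a
    by (induction n) (simp_all add: mult mult.assoc)
  have l_of_nat: "l (of_nat n * a) = of_nat n * l a" for n a
    by (induction n) (simp_all add: l_0 add algebra_simps)
  have l_sum: "l (sum g S) = (\<Sum>s\<in>S. l (g s))" for g :: "nat \<Rightarrow> 'a" and S
    by (induction S rule: infinite_finite_induct) (simp_all add: l_0 add)
  let ?T = "\<lambda>n j. \<tau> ^ (n - j) * (l ^^ j) f"
  \<comment> \<open>The recursion says formally that P n = (((\<tau> + l)^n - \<tau>^n) / l) f, and
    this is its binomial expansion. For n = p all binomial coefficients but the last are divisible
    by p.\<close>
  have "P (Suc n) = (\<Sum>j\<le>n. of_nat (Suc n choose Suc j) * ?T n j)" for n
  proof (induction n)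
    case 0
    show ?case by (simp add: P l_0)
  next
    case (Suc n)
    have "\<tau> * P (Suc n) = (\<Sum>j\<le>n. of_nat (Suc n choose Suc j) * ?T (Suc n) j)"
      by (simp add: Suc sum_distrib_left Suc_diff_le mult_ac del: binomial_Suc_Suc)
    also have "\<dots> = (\<Sum>j\<le>Suc n. of_nat (Suc n choose Suc j) * ?T (Suc n) j)"
      by (simp add: binomial_eq_0 del: binomial_Suc_Suc)
    finally have 1: "\<tau> * P (Suc n) = (\<Sum>j\<le>Suc n. of_nat (Suc n choose Suc j) * ?T (Suc n) j)" .
    have "l (P (Suc n)) = (\<Sum>j\<le>n. of_nat (Suc n choose Suc j) * ?T (Suc n) (Suc j))"
      by (simp add: Suc l_sum l_power l_of_nat mult.assoc del: binomial_Suc_Suc)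
    then have 2: "l (P (Suc n)) + \<tau> ^ Suc n * f = (\<Sum>j\<le>Suc n. of_nat (Suc n choose j) * ?T (Suc n)
        j)"
      by (simp only: sum.atMost_Suc_shift) simp
    have C: "of_nat (Suc (Suc n) choose Suc j) = (of_nat (Suc n choose j) + of_nat (Suc n choose
        Suc j) :: 'a)" for j
      by (simp only: binomial_Suc_Suc[of "Suc n"] of_nat_add)
    show ?case
      unfolding P(2)[of "Suc n"] add.assoc 1 2 C distrib_right sum.distrib by (rule add.commute)
  qed
  from this[of "CHAR('a) - 1"]
  have "P CHAR('a) = (\<Sum>j\<le>CHAR('a) - 1. of_nat (CHAR('a) choose Suc j) * ?T (CHAR('a) - 1) j)"
    using char by (simp del: binomial_Suc_Suc)
  also have "\<dots> = (\<Sum>j\<in>{CHAR('a) - 1}. of_nat (CHAR('a) choose Suc j) * ?T (CHAR('a) - 1) j)"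
  proof (intro sum.mono_neutral_right ballI)
    fix j assume "j \<in> {..CHAR('a) - 1} - {CHAR('a) - 1}"
    then have j: "j \<le> CHAR('a) - 1" "j \<noteq> CHAR('a) - 1" by auto
    then have "CHAR('a) dvd (CHAR('a) choose Suc j)"
      by (intro dvd_choose_prime prime_CHAR_semidom char) auto
    then have "of_nat (CHAR('a) choose Suc j) = (0 :: 'a)"
      by (simp add: of_nat_eq_0_iff_char_dvd)
    then show "of_nat (CHAR('a) choose Suc j) * ?T (CHAR('a) - 1) j = 0" by simp
  qed auto
  also have "\<dots> = (l ^^ (CHAR('a) - 1)) f"
    using char by simp
  finally show ?thesis .
qed

subsection \<open>The subring \<open>\<bbbF>[x\<^sup>p]\<close>\<close>

text \<open>A zero derivative leaves only exponents divisible by p. Splitting off the constant term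
  and dividing the rest by x^p lowers the degree and keeps the derivative zero, so induction yields
  the preimage under substitution of x^p.\<close>

lemma Fxp_iff:
  fixes f :: "'k::field poly"
  assumes char: "CHAR('k) > 0"
  shows "f \<in> Fxp \<longleftrightarrow> pderiv f = 0"
proof
  assume "f \<in> Fxp"
  then obtain g where "f = pcompose g (monom 1 CHAR('k))" by (auto simp: Fxp_def)
  then show "pderiv f = 0" by (simp add: pderiv_pcompose pderiv_monom)
next
  assume "pderiv f = 0"
  then show "f \<in> Fxp"
  proof (induction "degree f" arbitrary: f rule: less_induct)
    case less
    show ?case
    proof (cases "degree f = 0")
      case True
      then obtain c where "f = [:c:]" by (metis degree_eq_zeroE)
      then have "f = pcompose [:c:] (monom 1 CHAR('k))" by simp
      then show ?thesis unfolding Fxp_def by blast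
    next
      case False
      have zero: "coeff f n = 0" if "\<not> CHAR('k) dvd n" for n
        using less.prems that by (simp add: pderiv_eq_0_iff_coeff)
      have "CHAR('k) dvd degree f"
        using zero[of "degree f"] False by (metis degree_0 leading_coeff_0_iff)
      then have le: "CHAR('k) \<le> degree f" using False by (simp add: dvd_imp_le)
      define g where "g = poly_shift CHAR('k) f"
      have "coeff g n = 0" if "n > degree f - CHAR('k)" for n
        using that by (simp add: g_def coeff_poly_shift coeff_eq_0)
      then have "degree g \<le> degree f - CHAR('k)" by (simp add: degree_le)
      with char le have "degree g < degree f" by linarith
      moreover have "pderiv g = 0"
        by (auto simp: pderiv_eq_0_iff_coeff g_def coeff_poly_shift intro!: zero)
      ultimately obtain g' where g': "g = pcompose g' (monom 1 CHAR('k))"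
        using less.hyps by (auto simp: Fxp_def)
      have "f = [:coeff f 0:] + monom 1 CHAR('k) * g"
      proof (rule poly_eqI)
        fix n
        show "coeff f n = coeff ([:coeff f 0:] + monom 1 CHAR('k) * g) n"
        proof (cases "n = 0 \<or> n \<ge> CHAR('k)")
          case False
          then have "\<not> CHAR('k) dvd n" using dvd_imp_le by blast
          then show ?thesis using False zero
            by (auto simp: coeff_monom_mult coeff_pCons split: nat.split)
        qed (use char in \<open>auto simp: coeff_monom_mult g_def coeff_poly_shift coeff_pCons split:
            nat.split\<close>)
      qed
      then have "f = pcompose (pCons (coeff f 0) g') (monom 1 CHAR('k))"
        by (simp add: pcompose_pCons g')
      then show ?thesis unfolding Fxp_def by blast
    qed
  qed
qed

lemma bezout_euclidean:
  fixes a b :: "'a::euclidean_ring"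
  shows "\<exists>d u v. d = u * a + v * b \<and> d dvd a \<and> d dvd b"
proof (induction "euclidean_size b" arbitrary: a b rule: less_induct)
  case less
  show ?case
  proof (cases "b = 0")
    case True
    then have "a = 1 * a + 0 * b \<and> a dvd a \<and> a dvd b" by simp
    then show ?thesis by blast
  next
    case False
    then obtain d u v where d: "d = u * b + v * (a mod b)" "d dvd b" "d dvd a mod b"
      using less[of "a mod b" b] mod_size_less by blast
    have "d = v * a + (u - v * (a div b)) * b"
      by (simp add: d(1) minus_div_mult_eq_mod[symmetric] algebra_simps)
    moreover have "d dvd a" using d(2,3) by (simp add: dvd_mod_iff)
    ultimately show ?thesis using d(2) by blast
  qed
qed

lemma monic_dvd_antisym:
  fixes f g :: "'k::field poly"
  assumes "f dvd g" "g dvd f" "lead_coeff f = 1" "lead_coeff g = 1"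
  shows "f = g"
proof -
  obtain e where e: "g = f * e" using assms(1) unfolding dvd_def by blast
  have nz: "f \<noteq> 0" "e \<noteq> 0" using assms e by auto
  then have "degree e = 0"
    using dvd_imp_degree_le[OF assms(2)] e by (simp add: degree_mult_eq)
  then obtain c where "e = [:c:]" by (metis degree_eq_zeroE)
  then show ?thesis using e assms(3,4) nz by (simp add: one_pCons[symmetric])
qed

context
  assumes char: "CHAR('k::field) > 0"
begin

lemma power_CHAR: "h ^ CHAR('k) = h * (h :: 'k poly) ^ (CHAR('k) - 1)"
  using power_minus_mult[OF char, of h] by (simp add: mult.commute)

lemma Fxp_closed:
  fixes f g :: "'k poly"
  shows "0 \<in> (Fxp :: 'k poly set)" "1 \<in> (Fxp :: 'k poly set)" "[:c:] \<in> (Fxp :: 'k poly set)"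
    "f \<in> Fxp \<Longrightarrow> g \<in> Fxp \<Longrightarrow> f + g \<in> Fxp" "f \<in> Fxp \<Longrightarrow> - f \<in> Fxp"
    "f \<in> Fxp \<Longrightarrow> g \<in> Fxp \<Longrightarrow> f * g \<in> Fxp" "f \<in> Fxp \<Longrightarrow> Polynomial.smult c f \<in> Fxp"
    "f \<in> Fxp \<Longrightarrow> f ^ n \<in> Fxp" "f ^ CHAR('k) \<in> Fxp"
  using char
  by (simp_all add: Fxp_iff pderiv_add pderiv_minus pderiv_mult pderiv_smult pderiv_power
      pderiv_power_CHAR pderiv_pCons)

lemma Fxp_sum: "(\<And>i. i \<in> S \<Longrightarrow> f i \<in> Fxp) \<Longrightarrow> sum f S \<in> (Fxp :: 'k poly set)"
  by (induction S rule: infinite_finite_induct) (simp_all add: Fxp_closed)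

lemma Fxp_cofactor:
  fixes a b :: "'k poly"
  assumes "a * b \<in> Fxp" "a \<in> Fxp" "a \<noteq> 0"
  shows "b \<in> Fxp"
  using assms char by (simp add: Fxp_iff pderiv_mult)

text \<open>The Bezout identity is taken in F[x] for the preimages and transported by the
  substitution of x^p, so that the coefficients and the cofactors lie in F[x^p] as well.\<close>

lemma Fxp_bezout:
  fixes a b :: "'k poly"
  assumes "a \<in> Fxp" "b \<in> Fxp"
  shows "\<exists>d\<in>Fxp. \<exists>u\<in>Fxp. \<exists>v\<in>Fxp. \<exists>a'\<in>Fxp. \<exists>b'\<in>Fxp. d = u * a + v * b \<and> a = d * a' \<and> b = d * b'"
proof -
  let ?\<phi> = "\<lambda>g. pcompose g (monom 1 CHAR('k) :: 'k poly)"
  obtain a1 b1 where "a = ?\<phi> a1" "b = ?\<phi> b1" using assms by (auto simp: Fxp_def)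
  moreover obtain d u v a2 b2 where "d = u * a1 + v * b1" "a1 = d * a2" "b1 = d * b2"
    using bezout_euclidean[of a1 b1] unfolding dvd_def by blast
  ultimately have "?\<phi> d = ?\<phi> u * a + ?\<phi> v * b" "a = ?\<phi> d * ?\<phi> a2" "b = ?\<phi> d * ?\<phi> b2"
    by (metis pcompose_add pcompose_mult)+
  then show ?thesis unfolding Fxp_def by blast
qed

text \<open>Maximal degree is upgraded to greatest with respect to divisibility. If r is maximal and
  s = g b is another divisor of h in F[x^p], with g the gcd of r and s, then the least common
  multiple r b still divides h and lies in F[x^p], so b is constant and s divides r.\<close>

lemma rho_props:
  fixes h :: "'k poly"
  assumes "h \<noteq> 0"
  shows "rho h \<in> Fxp \<and> lead_coeff (rho h) = 1 \<and> rho h dvd h \<and> (\<forall>s\<in>Fxp. s dvd h \<longrightarrow> s dvd rho h)"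
proof -
  define P where "P r \<longleftrightarrow> r \<in> Fxp \<and> lead_coeff r = 1 \<and> r dvd h \<and>
     (\<forall>s\<in>Fxp. lead_coeff s = 1 \<and> s dvd h \<longrightarrow> degree s \<le> degree r)" for r
  let ?S = "{s \<in> Fxp. lead_coeff s = 1 \<and> s dvd h}"
  have maximal: "s dvd r" if r: "P r" and s: "s \<in> Fxp" "s dvd h" for r s
  proof -
    have r': "r \<in> Fxp" "lead_coeff r = 1" "r dvd h" using r by (auto simp: P_def)
    obtain g u v a b where g: "g \<in> Fxp" "u \<in> Fxp" "v \<in> Fxp" "a \<in> Fxp" "b \<in> Fxp"
      "g = u * r + v * s" "r = g * a" "s = g * b"
      using Fxp_bezout r'(1) s(1) by blast
    have "s \<noteq> 0" "r \<noteq> 0" using s r' assms by auto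
    then have nz: "g \<noteq> 0" "a \<noteq> 0" "b \<noteq> 0" using g(7,8) by auto
    have "g * 1 = g * (u * a + v * b)" using g(6-8) by (simp add: algebra_simps)
    then have 1: "u * a + v * b = 1" using nz by simp
    obtain m n where mn: "h = r * m" "h = s * n" using r'(3) s(2) unfolding dvd_def by blast
    then have "a * m = b * n" using g(7,8) nz by (simp add: mult.assoc)
    moreover have "m = u * (a * m) + b * (v * m)"
      using arg_cong[OF 1, of "\<lambda>c. c * m"] by (simp add: algebra_simps)
    ultimately have "m = b * (u * n + v * m)" by (simp add: algebra_simps)
    then have "r * b dvd h" using mn(1) by (metis dvd_triv_left mult.assoc)
    \<comment> \<open>Maximality speaks of monic divisors only, so b is normalized before it is
      used.\<close>
    define c where "c = Polynomial.smult (inverse (lead_coeff b)) b"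
    have c: "c \<in> Fxp" "lead_coeff c = 1" "degree c = degree b"
      using nz g(5) by (simp_all add: c_def Fxp_closed)
    have "r * c dvd h"
      using \<open>r * b dvd h\<close> nz by (simp add: c_def smult_dvd_iff)
    moreover have "r * c \<in> Fxp" "lead_coeff (r * c) = 1"
      using Fxp_closed(6)[OF r'(1) c(1)] lead_coeff_mult[of r c] c(2) r'(2) by simp_all
    ultimately have "degree (r * c) \<le> degree r"
      using r unfolding P_def by blast
    moreover have "degree (r * c) = degree r + degree b"
      using c \<open>r \<noteq> 0\<close> by (subst degree_mult_eq) auto
    ultimately have "degree b = 0" by simp
    then have "is_unit b" using nz by (simp add: is_unit_iff_degree)
    then show ?thesis using g(7,8) by (metis dvd_triv_left mult_unit_dvd_iff)
  qed
  have "1 \<in> ?S" by (simp add: Fxp_closed)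
  moreover have "degree ` ?S \<subseteq> {..degree h}"
    using assms by (auto intro: dvd_imp_degree_le)
  ultimately obtain r where r: "r \<in> ?S" "degree r = Max (degree ` ?S)"
    using Max_in[of "degree ` ?S"] finite_subset[of _ "{..degree h}"] by (smt (verit) empty_iff
        finite_atMost image_iff)
  have "P r" unfolding P_def
    using r \<open>degree ` ?S \<subseteq> {..degree h}\<close> by (auto intro!: Max_ge finite_subset[of _ "{..degree h}"])
  moreover have "r' = r" if "P r'" for r'
    using maximal[OF that, of r] maximal[OF \<open>P r\<close>, of r'] \<open>P r\<close> that
    by (intro monic_dvd_antisym) (auto simp: P_def)
  ultimately have "P (rho h)" unfolding rho_def P_def[symmetric] by (metis theI)
  then show ?thesis using maximal unfolding P_def by blast
qed

lemmas rho_Fxp = rho_props[THEN conjunct1]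
  and rho_dvd = rho_props[THEN conjunct2, THEN conjunct2, THEN conjunct1]
  and rho_greatest = rho_props[THEN conjunct2, THEN conjunct2, THEN conjunct2]

lemma rho_neq_0: "(h :: 'k poly) \<noteq> 0 \<Longrightarrow> rho h \<noteq> 0"
  using rho_dvd by force

lemma rho_dvd_pderiv: "(h :: 'k poly) \<noteq> 0 \<Longrightarrow> rho h dvd pderiv h"
proof -
  assume h: "h \<noteq> 0"
  then obtain k where "h = rho h * k" using rho_dvd by (auto elim: dvdE)
  then have "pderiv h = rho h * pderiv k"
    using rho_Fxp[OF h] char by (metis Fxp_iff add.right_neutral mult_zero_right pderiv_mult)
  then show ?thesis by simp
qed

lemma rho_dvd_power: "(h :: 'k poly) \<noteq> 0 \<Longrightarrow> rho h dvd h ^ CHAR('k)"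
  using rho_dvd char by (metis dvd_power dvd_trans)

text \<open>In lowest terms over \<open>\<bbbF>[x\<^sup>p]\<close>, the denominator \<open>b\<close> of \<open>g / h\<^sup>p\<close> divides \<open>h\<close>, hence \<open>\<rho>\<^sub>h\<close>.\<close>

lemma Fxp_dvd_by_power:
  fixes g h :: "'k poly"
  assumes h: "h \<noteq> 0" and g: "g \<in> Fxp" "h ^ (CHAR('k) - 1) dvd g"
  shows "\<exists>c\<in>Fxp. g = (h ^ CHAR('k) div rho h) * c"
proof -
  define H where "H = h ^ CHAR('k)"
  obtain w where w: "g = h ^ (CHAR('k) - 1) * w" using g by (auto elim: dvdE)
  have H: "H = h * h ^ (CHAR('k) - 1)" unfolding H_def by (rule power_CHAR)
  have "H \<in> Fxp" by (simp add: H_def Fxp_closed)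
  then obtain d u v a b where d: "d \<in> Fxp" "a \<in> Fxp" "b \<in> Fxp"
    "d = u * g + v * H" "g = d * a" "H = d * b"
    using Fxp_bezout[OF g(1)] by blast
  have nz: "d \<noteq> 0" "b \<noteq> 0" "H \<noteq> 0" using d(6) h by (auto simp: H_def)
  have "d * 1 = d * (u * a + v * b)" using d(4-6) by (simp add: algebra_simps)
  then have 1: "u * a + v * b = 1" using nz by simp
  have "d * (b * w) = H * w" by (simp add: d(6) mult.assoc)
  also have "\<dots> = h * g" by (simp add: H w mult_ac)
  also have "\<dots> = d * (h * a)" by (simp add: d(5) mult_ac)
  finally have "h * a = b * w" using nz by simp
  moreover have "h = u * (h * a) + b * (v * h)"
    using arg_cong[OF 1, of "\<lambda>c. c * h"] by (simp add: algebra_simps)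
  ultimately have "h = b * (u * w + v * h)" by (simp add: algebra_simps)
  then have "b dvd rho h" using rho_greatest[OF h] d(3) by (metis dvd_triv_left)
  then obtain c where c: "rho h = b * c" by (auto elim: dvdE)
  then have "c \<in> Fxp" using Fxp_cofactor[of b c] d(3) nz rho_Fxp[OF h] by simp
  have "H = rho h * (H div rho h)" using rho_dvd_power[OF h] by (simp add: H_def)
  then have "b * d = b * (c * (H div rho h))" using c d(6) by (simp add: mult_ac)
  then have "d = c * (H div rho h)" using nz by simp
  then have "g = (H div rho h) * (c * a)" using d(5) by (simp add: mult_ac)
  then show ?thesis using \<open>c \<in> Fxp\<close> d(2) by (auto simp: H_def Fxp_closed)
qed

text \<open>The quotient is h^(p-1) times h / rho. It can therefore stand as a coefficient of
  y^(p-1), or of any lower power of y, in an element of A_h.\<close>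

lemma power_dvd_power_div_rho:
  fixes h :: "'k poly"
  assumes h: "h \<noteq> 0"
  shows "h ^ (CHAR('k) - 1) dvd h ^ CHAR('k) div rho h"
proof -
  have "rho h * h ^ (CHAR('k) - 1) dvd h * h ^ (CHAR('k) - 1)"
    using rho_dvd[OF h] by simp
  also have "h * h ^ (CHAR('k) - 1) = rho h * (h ^ CHAR('k) div rho h)"
    using rho_dvd_power[OF h] by (metis power_CHAR dvd_mult_div_cancel)
  finally show ?thesis using rho_neq_0[OF h] by simp
qed

lemma Fxp_coordinates:
  fixes f :: "'k poly"
  shows "\<exists>\<beta>. (\<forall>i. \<beta> i \<in> Fxp) \<and> f = (\<Sum>i<CHAR('k). \<beta> i * monom 1 i)"
proof -
  have "\<exists>b. \<forall>n. coeff b n = (if CHAR('k) dvd n then coeff f (n + i) else 0)" for i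
    by (rule poly_choice[of _ "degree f"]) (auto simp: coeff_eq_0)
  then obtain \<beta> where \<beta>: "coeff (\<beta> i) n = (if CHAR('k) dvd n then coeff f (n + i) else 0)" for i n
    by metis
  have "\<beta> i \<in> Fxp" for i
    using char by (simp add: Fxp_iff pderiv_eq_0_iff_coeff \<beta>)
  moreover have "f = (\<Sum>i<CHAR('k). \<beta> i * monom 1 i)"
  proof (rule poly_eqI)
    fix n
    have "CHAR('k) dvd n - i \<and> i \<le> n \<longleftrightarrow> i = n mod CHAR('k)" if "i < CHAR('k)" for i
      using that by (metis mod_eq_dvd_iff_nat mod_less mod_less_eq_dividend)
    moreover have "coeff (\<beta> i * monom 1 i) n = (if CHAR('k) dvd n - i \<and> i \<le> n then coeff f n else
        0)" for i
      by (auto simp: coeff_monom_mult mult.commute[of "\<beta> i"] \<beta> not_less)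
    ultimately have "(\<Sum>i<CHAR('k). coeff (\<beta> i * monom 1 i) n) = (\<Sum>i<CHAR('k). if i = n mod
        CHAR('k) then coeff f n else 0)"
      by (intro sum.cong) simp_all
    also have "\<dots> = coeff f n" using char by simp
    finally show "coeff f n = coeff (\<Sum>i<CHAR('k). \<beta> i * monom 1 i) n"
      by (simp add: coeff_sum)
  qed
  ultimately show ?thesis by blast
qed

text \<open>The operator is F[x^p]-linear, and on the monomials x^k with k at most 2p-2 that occur
  it vanishes unless k = p-1. Hence the families x^(p-1-i) and x^j are dual up to (p-1)!, which
  explains the reversed exponents in \<open>qb\<close>.\<close>

lemma higher_pderiv_pairing:
  fixes \<alpha> \<beta> :: "nat \<Rightarrow> 'k poly"
  assumes "\<And>i. i < CHAR('k) \<Longrightarrow> \<alpha> i \<in> Fxp" "\<And>i. i < CHAR('k) \<Longrightarrow> \<beta> i \<in> Fxp"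
  shows "(pderiv ^^ (CHAR('k) - 1)) ((\<Sum>i<CHAR('k). \<alpha> i * monom 1 (CHAR('k) - 1 - i)) *
      (\<Sum>j<CHAR('k). \<beta> j * monom 1 j))
    = of_nat (fact (CHAR('k) - 1)) * (\<Sum>i<CHAR('k). \<alpha> i * \<beta> i)"
proof -
  let ?p = "CHAR('k)" and ?w = "of_nat (fact (CHAR('k) - 1)) :: 'k poly"
  have monom: "(pderiv ^^ (?p - 1)) (monom 1 (?p - 1 - i + j)) = (if i = j then ?w else 0)"
    if ij: "i < ?p" "j < ?p" for i j
  proof (rule poly_eqI)
    fix n
    have "?p dvd n \<and> n + (?p - 1) = ?p - 1 - i + j \<longleftrightarrow> i = j \<and> n = 0"
    proof
      assume *: "?p dvd n \<and> n + (?p - 1) = ?p - 1 - i + j"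
      then have "n < ?p" using ij by arith
      then have "n = 0" using * by (auto dest: dvd_imp_le)
      then show "i = j \<and> n = 0" using * ij by simp
    qed (use ij in auto)
    then have "coeff ((pderiv ^^ (?p - 1)) (monom 1 (?p - 1 - i + j) :: 'k poly)) n
        = (if i = j \<and> n = 0 then of_nat (fact (?p - 1)) else 0)"
      unfolding coeff_higher_pderiv_CHAR[OF char] coeff_monom by auto
    then show "coeff ((pderiv ^^ (?p - 1)) (monom 1 (?p - 1 - i + j))) n = coeff (if i = j then ?w
        else 0 :: 'k poly) n"
      by (auto simp: of_nat_poly coeff_pCons split: nat.split)
  qed
  have "(pderiv ^^ (?p - 1)) ((\<Sum>i<?p. \<alpha> i * monom 1 (?p - 1 - i)) * (\<Sum>j<?p. \<beta> j * monom 1 j))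
      = (\<Sum>i<?p. \<Sum>j<?p. (pderiv ^^ (?p - 1)) (\<alpha> i * \<beta> j * monom 1 (?p - 1 - i + j)))"
  proof -
    have "(\<alpha> i * monom 1 (?p - 1 - i)) * (\<beta> j * monom 1 j) = \<alpha> i * \<beta> j * monom 1 (?p - 1 - i + j)"
        for i j
    proof -
      have "(\<alpha> i * monom 1 (?p - 1 - i)) * (\<beta> j * monom 1 j) = \<alpha> i * \<beta> j * (monom 1 (?p - 1 - i) *
          monom 1 j)"
        by (simp only: mult_ac)
      then show ?thesis by (simp only: mult_monom mult_1)
    qed
    then show ?thesis by (simp only: sum_product higher_pderiv_sum)
  qed
  also have "\<dots> = (\<Sum>i<?p. \<Sum>j<?p. if i = j then ?w * (\<alpha> i * \<beta> i) else 0)"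
  proof (intro sum.cong refl)
    fix i j assume "i \<in> {..<?p}" "j \<in> {..<?p}"
    then show "(pderiv ^^ (?p - 1)) (\<alpha> i * \<beta> j * monom 1 (?p - 1 - i + j)) = (if i = j then ?w *
        (\<alpha> i * \<beta> i) else 0)"
      using assms char monom by (simp add: higher_pderiv_mult_const Fxp_iff[symmetric] Fxp_closed)
  qed
  also have "\<dots> = ?w * (\<Sum>i<?p. \<alpha> i * \<beta> i)"
    by (simp add: sum_distrib_left)
  finally show ?thesis .
qed

end

subsection \<open>Quotients and direct sums of modules\<close>

definition module_hom_on :: "('r, 'm) module \<Rightarrow> 'r ring \<Rightarrow> ('r, 'n) module \<Rightarrow> ('m \<Rightarrow> 'n) \<Rightarrow> bool" where
  "module_hom_on M R P f \<longleftrightarrow> (\<forall>a\<in>carrier M. f a \<in> carrier P) \<and>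
     (\<forall>a\<in>carrier M. \<forall>b\<in>carrier M. f (a \<oplus>\<^bsub>M\<^esub> b) = f a \<oplus>\<^bsub>P\<^esub> f b) \<and>
     (\<forall>r\<in>carrier R. \<forall>a\<in>carrier M. f (r \<odot>\<^bsub>M\<^esub> a) = r \<odot>\<^bsub>P\<^esub> f a)"

lemma module_isoI:
  assumes M: "module R M" and P: "module R P" and hom: "module_hom_on M R P f"
    and ker: "\<And>a. a \<in> carrier M \<Longrightarrow> f a = \<zero>\<^bsub>P\<^esub> \<Longrightarrow> a = \<zero>\<^bsub>M\<^esub>"
    and surj: "\<And>b. b \<in> carrier P \<Longrightarrow> \<exists>a\<in>carrier M. f a = b"
  shows "f \<in> module_iso R M P"
proof -
  interpret M: module R M by fact
  interpret P: module R P by fact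
  have f: "f a \<in> carrier P" if "a \<in> carrier M" for a
    using hom that by (simp add: module_hom_on_def)
  have "inj_on f (carrier M)"
  proof (rule inj_onI)
    fix a b assume ab: "a \<in> carrier M" "b \<in> carrier M" "f a = f b"
    have "f (a \<ominus>\<^bsub>M\<^esub> b) \<oplus>\<^bsub>P\<^esub> f b = f (a \<ominus>\<^bsub>M\<^esub> b \<oplus>\<^bsub>M\<^esub> b)"
      using hom ab by (simp add: module_hom_on_def)
    also have "a \<ominus>\<^bsub>M\<^esub> b \<oplus>\<^bsub>M\<^esub> b = a"
      using ab by (simp add: M.minus_eq M.a_assoc M.l_neg)
    finally have "f (a \<ominus>\<^bsub>M\<^esub> b) = \<zero>\<^bsub>P\<^esub>"
      using ab f by (metis M.minus_closed P.add.r_cancel_one)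
    then have "a \<ominus>\<^bsub>M\<^esub> b = \<zero>\<^bsub>M\<^esub>" using ker ab by simp
    then show "a = b" using ab \<open>a \<ominus>\<^bsub>M\<^esub> b \<oplus>\<^bsub>M\<^esub> b = a\<close> by simp
  qed
  moreover have "f ` carrier M = carrier P" using f surj by blast
  ultimately show ?thesis
    using M P hom by (auto simp: module_iso_def bij_betw_def module_hom_on_def)
qed

lemma a_r_coset_carrier_update [simp]: "a_r_coset (M\<lparr>carrier := S\<rparr>) = a_r_coset M"
  by (intro ext) (simp add: a_r_coset_def')

lemma set_add_carrier_update [simp]: "set_add (M\<lparr>carrier := S\<rparr>) = set_add M"
  by (intro ext) (simp add: set_add_def')

lemma quot_module_simps [simp]:
  "add (quot_module M N) = set_add M" "zero (quot_module M N) = N"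
  by (simp_all add: quot_module_def)

lemma carrier_quot_module: "carrier (quot_module M N) = a_r_coset M N ` carrier M"
  by (auto simp: quot_module_def A_RCOSETS_def')

context
  fixes R :: "'r ring" and M :: "('r, 'm) module" and N :: "'m set"
  assumes M: "module R M" and N: "submodule N R M"
begin

interpretation M: module R M by (rule M)

interpretation N: abelian_subgroup N M
  by (rule abelian_subgroupI3[OF additive_subgroup.intro[OF submodule.axioms(1)[OF N]]
      M.abelian_group_axioms])

lemma quot_add:
  "a \<in> carrier M \<Longrightarrow> b \<in> carrier M \<Longrightarrow> (N +>\<^bsub>M\<^esub> a) <+>\<^bsub>M\<^esub> (N +>\<^bsub>M\<^esub> b) = N +>\<^bsub>M\<^esub> (a \<oplus>\<^bsub>M\<^esub> b)"
  by (rule N.a_rcos_sum)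

lemma quot_coset_eq_N_iff: "a \<in> carrier M \<Longrightarrow> N +>\<^bsub>M\<^esub> a = N \<longleftrightarrow> a \<in> N"
  using N.a_rcos_const[of a] N.a_rcos_self[of a] by auto

lemma quot_coset_zero: "N +>\<^bsub>M\<^esub> \<zero>\<^bsub>M\<^esub> = N"
  by (simp add: quot_coset_eq_N_iff)

lemma quot_coset_add_left:
  assumes "n \<in> N" "a \<in> carrier M"
  shows "N +>\<^bsub>M\<^esub> (n \<oplus>\<^bsub>M\<^esub> a) = N +>\<^bsub>M\<^esub> a"
proof -
  have n: "n \<in> carrier M" "N +>\<^bsub>M\<^esub> n = N" using assms by (simp_all add: quot_coset_eq_N_iff)
  have "N +>\<^bsub>M\<^esub> (n \<oplus>\<^bsub>M\<^esub> a) = (N +>\<^bsub>M\<^esub> \<zero>\<^bsub>M\<^esub>) <+>\<^bsub>M\<^esub> (N +>\<^bsub>M\<^esub> a)"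
    using quot_add[OF n(1) assms(2)] n(2) quot_coset_zero by simp
  also have "\<dots> = N +>\<^bsub>M\<^esub> a" using assms by (simp add: quot_add)
  finally show ?thesis .
qed

lemma quot_coset_mem: "b \<in> N +>\<^bsub>M\<^esub> a \<longleftrightarrow> (\<exists>n\<in>N. b = n \<oplus>\<^bsub>M\<^esub> a)"
  by (auto simp: a_r_coset_def')

text \<open>N is stable under scalars, so all members of a coset are sent to the same coset and the
  union that defines the scalar action collapses to it.\<close>

lemma quot_smult:
  assumes c: "c \<in> carrier R" and a: "a \<in> carrier M"
  shows "c \<odot>\<^bsub>quot_module M N\<^esub> (N +>\<^bsub>M\<^esub> a) = N +>\<^bsub>M\<^esub> (c \<odot>\<^bsub>M\<^esub> a)"
proof -
  have "N +>\<^bsub>M\<^esub> (c \<odot>\<^bsub>M\<^esub> b) = N +>\<^bsub>M\<^esub> (c \<odot>\<^bsub>M\<^esub> a)" if b: "b \<in> N +>\<^bsub>M\<^esub> a" for b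
  proof -
    obtain n where n: "n \<in> N" "b = n \<oplus>\<^bsub>M\<^esub> a" using b quot_coset_mem by blast
    then have "c \<odot>\<^bsub>M\<^esub> b = c \<odot>\<^bsub>M\<^esub> n \<oplus>\<^bsub>M\<^esub> c \<odot>\<^bsub>M\<^esub> a" "c \<odot>\<^bsub>M\<^esub> n \<in> N"
      using c a submodule.smult_closed[OF N] by (simp_all add: M.smult_r_distr)
    then show ?thesis using c a by (simp add: quot_coset_add_left)
  qed
  moreover have "a \<in> N +>\<^bsub>M\<^esub> a" using a by (rule N.a_rcos_self)
  ultimately have "(\<Union>b\<in>N +>\<^bsub>M\<^esub> a. N +>\<^bsub>M\<^esub> (c \<odot>\<^bsub>M\<^esub> b)) = N +>\<^bsub>M\<^esub> (c \<odot>\<^bsub>M\<^esub> a)"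
    by blast
  then show ?thesis by (simp only: quot_module_def module.simps)
qed

lemma quot_module_module: "module R (quot_module M N)"
proof (rule moduleI)
  show "abelian_group (quot_module M N)"
  proof (rule abelian_groupI)
    fix x assume x: "x \<in> carrier (quot_module M N)"
    then obtain a where a: "a \<in> carrier M" "x = N +>\<^bsub>M\<^esub> a" by (auto simp: carrier_quot_module)
    then have "(N +>\<^bsub>M\<^esub> (\<ominus>\<^bsub>M\<^esub> a)) \<oplus>\<^bsub>quot_module M N\<^esub> x = \<zero>\<^bsub>quot_module M N\<^esub>"
      by (simp add: quot_add M.l_neg quot_coset_zero)
    then show "\<exists>y\<in>carrier (quot_module M N). y \<oplus>\<^bsub>quot_module M N\<^esub> x = \<zero>\<^bsub>quot_module M N\<^esub>"
      using a by (auto simp: carrier_quot_module)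
    have "(N +>\<^bsub>M\<^esub> \<zero>\<^bsub>M\<^esub>) <+>\<^bsub>M\<^esub> x = x"
      using a by (simp add: quot_add del: N.a_rcos_const M.a_coset_add_zero)
    then show "\<zero>\<^bsub>quot_module M N\<^esub> \<oplus>\<^bsub>quot_module M N\<^esub> x = x" by (simp add: quot_coset_zero)
  next
    have "N +>\<^bsub>M\<^esub> \<zero>\<^bsub>M\<^esub> \<in> carrier (quot_module M N)"
      unfolding carrier_quot_module by (rule imageI) simp
    then show "\<zero>\<^bsub>quot_module M N\<^esub> \<in> carrier (quot_module M N)" by (simp add: quot_coset_zero)
  qed (auto simp: carrier_quot_module quot_add M.a_ac)
qed (use M.R.cring_axioms M.smult_l_distr M.smult_r_distr M.smult_assoc1 in
    \<open>auto simp: carrier_quot_module quot_add quot_smult\<close>)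

lemma quot_submodule:
  assumes K: "submodule K R M"
  shows "submodule (a_r_coset M N ` K) R (quot_module M N)"
proof -
  interpret Q: module R "quot_module M N" by (rule quot_module_module)
  note K' = M.submoduleE[OF K]
  have sub: "k \<in> K \<Longrightarrow> k \<in> carrier M" for k using K'(1) by blast
  have inv: "\<ominus>\<^bsub>quot_module M N\<^esub> (N +>\<^bsub>M\<^esub> k) = N +>\<^bsub>M\<^esub> (\<ominus>\<^bsub>M\<^esub> k)" if "k \<in> K" for k
    using sub[OF that] by (intro Q.minus_equality) (auto simp: carrier_quot_module quot_add
        M.l_neg quot_coset_zero)
  show ?thesis
  proof (rule Q.submoduleI)
    obtain k where "k \<in> K" using K'(2) by blast
    then have "\<zero>\<^bsub>R\<^esub> \<odot>\<^bsub>M\<^esub> k \<in> K" using K'(4) by blast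
    then have "\<zero>\<^bsub>M\<^esub> \<in> K" using sub \<open>k \<in> K\<close> by simp
    then have "N +>\<^bsub>M\<^esub> \<zero>\<^bsub>M\<^esub> \<in> a_r_coset M N ` K" by (rule imageI)
    then show "\<zero>\<^bsub>quot_module M N\<^esub> \<in> a_r_coset M N ` K" by (simp add: quot_coset_zero)
  qed (use K' sub in \<open>auto simp: carrier_quot_module inv quot_add quot_smult\<close>)
qed

end

lemma direct_sum_simps:
  "carrier (direct_sum M N) = carrier M \<times> carrier N"
  "\<zero>\<^bsub>direct_sum M N\<^esub> = (\<zero>\<^bsub>M\<^esub>, \<zero>\<^bsub>N\<^esub>)"
  "(a, b) \<oplus>\<^bsub>direct_sum M N\<^esub> (c, d) = (a \<oplus>\<^bsub>M\<^esub> c, b \<oplus>\<^bsub>N\<^esub> d)"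
  "r \<odot>\<^bsub>direct_sum M N\<^esub> (a, b) = (r \<odot>\<^bsub>M\<^esub> a, r \<odot>\<^bsub>N\<^esub> b)"
  by (simp_all add: direct_sum_def)

lemma direct_sum_module:
  assumes "module R M" "module R N"
  shows "module R (direct_sum M N)"
proof -
  interpret M: module R M by fact
  interpret N: module R N by fact
  show ?thesis
  proof (rule moduleI)
    show "abelian_group (direct_sum M N)"
    proof (rule abelian_groupI)
      fix x assume "x \<in> carrier (direct_sum M N)"
      then obtain a b where "a \<in> carrier M" "b \<in> carrier N" "x = (a, b)"
        by (auto simp: direct_sum_simps)
      then have "(\<ominus>\<^bsub>M\<^esub> a, \<ominus>\<^bsub>N\<^esub> b) \<in> carrier (direct_sum M N) \<and>
          (\<ominus>\<^bsub>M\<^esub> a, \<ominus>\<^bsub>N\<^esub> b) \<oplus>\<^bsub>direct_sum M N\<^esub> x = \<zero>\<^bsub>direct_sum M N\<^esub>"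
        by (simp add: direct_sum_simps M.l_neg N.l_neg)
      then show "\<exists>y\<in>carrier (direct_sum M N). y \<oplus>\<^bsub>direct_sum M N\<^esub> x = \<zero>\<^bsub>direct_sum M N\<^esub>" by blast
    qed (auto simp: direct_sum_simps M.a_ac N.a_ac)
  qed (use M.R.cring_axioms in \<open>auto simp: direct_sum_simps M.smult_l_distr M.smult_r_distr
      M.smult_assoc1
      N.smult_l_distr N.smult_r_distr N.smult_assoc1\<close>)
qed

lemma restrict_scalars_module:
  assumes M: "module R M" and S: "cring S"
    and \<phi>: "\<And>c. c \<in> carrier S \<Longrightarrow> \<phi> c \<in> carrier R"
      "\<And>c d. c \<in> carrier S \<Longrightarrow> d \<in> carrier S \<Longrightarrow> \<phi> (c \<oplus>\<^bsub>S\<^esub> d) = \<phi> c \<oplus>\<^bsub>R\<^esub> \<phi> d"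
      "\<And>c d. c \<in> carrier S \<Longrightarrow> d \<in> carrier S \<Longrightarrow> \<phi> (c \<otimes>\<^bsub>S\<^esub> d) = \<phi> c \<otimes>\<^bsub>R\<^esub> \<phi> d"
      "\<phi> \<one>\<^bsub>S\<^esub> = \<one>\<^bsub>R\<^esub>"
  shows "module S (restrict_scalars \<phi> M)"
proof -
  interpret M: module R M by fact
  show ?thesis
  proof (rule moduleI)
    show "abelian_group (restrict_scalars \<phi> M)"
      by (rule abelian_groupI)
        (auto simp: restrict_scalars_def M.a_ac intro: bexI[of _ "\<ominus>\<^bsub>M\<^esub> _"] M.l_neg)
  qed (use S in \<open>auto simp: restrict_scalars_def \<phi> M.smult_l_distr M.smult_r_distr M.smult_assoc1\<close>)
qed

text \<open>Since N is contained in K, \<open>indep\<close> makes U and V meet N trivially. They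
  embed into M/N unchanged, while K contributes the cosets of N it contains. In the application N
  consists of the inner derivations and K of the derivations that vanish on the centre.\<close>

lemma direct_sum_quot_iso:
  assumes M: "module R M" and N: "submodule N R M" and U: "submodule U R M" and V: "submodule V R M"
    and K: "submodule K R M" "N \<subseteq> K"
    and span: "\<And>m. m \<in> carrier M \<Longrightarrow> \<exists>u\<in>U. \<exists>v\<in>V. \<exists>k\<in>K. m = u \<oplus>\<^bsub>M\<^esub> v \<oplus>\<^bsub>M\<^esub> k"
    and indep: "\<And>u v. u \<in> U \<Longrightarrow> v \<in> V \<Longrightarrow> u \<oplus>\<^bsub>M\<^esub> v \<in> K \<Longrightarrow> u = \<zero>\<^bsub>M\<^esub> \<and> v = \<zero>\<^bsub>M\<^esub>"
  shows "(\<lambda>(u, v, C). (N +>\<^bsub>M\<^esub> (u \<oplus>\<^bsub>M\<^esub> v)) \<oplus>\<^bsub>quot_module M N\<^esub> C)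
    \<in> module_iso R (direct_sum (M\<lparr>carrier := U\<rparr>) (direct_sum (M\<lparr>carrier := V\<rparr>)
        ((quot_module M N)\<lparr>carrier := a_r_coset M N ` K\<rparr>))) (quot_module M N)"
    (is "?f \<in> module_iso R ?S ?Q")
proof -
  interpret M: module R M by fact
  note QM = quot_module_module[OF M N] and add = quot_add[OF M N] and smult = quot_smult[OF M N]
  interpret Q: module R ?Q by (rule QM)
  have sub: "U \<subseteq> carrier M" "V \<subseteq> carrier M" "K \<subseteq> carrier M"
    using M.submoduleE(1) U V K(1) by blast+
  then have mem: "u \<in> U \<Longrightarrow> u \<in> carrier M" "v \<in> V \<Longrightarrow> v \<in> carrier M" "k \<in> K \<Longrightarrow> k \<in> carrier M" for u v k
    by blast+
  have carrier_S: "carrier ?S = U \<times> V \<times> a_r_coset M N ` K" by (simp add: direct_sum_simps)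
  have f: "?f (u, v, N +>\<^bsub>M\<^esub> k) = N +>\<^bsub>M\<^esub> (u \<oplus>\<^bsub>M\<^esub> v \<oplus>\<^bsub>M\<^esub> k)" if "u \<in> U" "v \<in> V" "k \<in> K" for u v k
    using mem that by (simp add: add)
  show ?thesis
  proof (rule module_isoI[OF _ QM])
    show "module R ?S"
      by (intro direct_sum_module submodule.submodule_is_module U V M QM quot_submodule[OF M N
          K(1)])
    show "module_hom_on ?S R ?Q ?f"
      unfolding module_hom_on_def carrier_S
    proof (intro conjI ballI)
      fix a assume "a \<in> U \<times> V \<times> a_r_coset M N ` K"
      then obtain u v k where a: "a = (u, v, N +>\<^bsub>M\<^esub> k)" and m: "u \<in> U" "v \<in> V" "k \<in> K" by auto
      show "?f a \<in> carrier ?Q" unfolding a f[OF m] using mem m by (simp add: carrier_quot_module)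
      {
        fix b assume "b \<in> U \<times> V \<times> a_r_coset M N ` K"
        then obtain u' v' k' where b: "b = (u', v', N +>\<^bsub>M\<^esub> k')" and m': "u' \<in> U" "v' \<in> V" "k' \<in>
            K" by auto
        have "a \<oplus>\<^bsub>?S\<^esub> b = (u \<oplus>\<^bsub>M\<^esub> u', v \<oplus>\<^bsub>M\<^esub> v', N +>\<^bsub>M\<^esub> (k \<oplus>\<^bsub>M\<^esub> k'))"
          using mem m m' by (simp add: a b direct_sum_simps add)
        moreover have "u \<oplus>\<^bsub>M\<^esub> u' \<in> U" "v \<oplus>\<^bsub>M\<^esub> v' \<in> V" "k \<oplus>\<^bsub>M\<^esub> k' \<in> K"
          using m m' U V K(1) M.submoduleE(5) by blast+
        moreover have "(u \<oplus>\<^bsub>M\<^esub> u') \<oplus>\<^bsub>M\<^esub> (v \<oplus>\<^bsub>M\<^esub> v') \<oplus>\<^bsub>M\<^esub> (k \<oplus>\<^bsub>M\<^esub> k')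
            = (u \<oplus>\<^bsub>M\<^esub> v \<oplus>\<^bsub>M\<^esub> k) \<oplus>\<^bsub>M\<^esub> (u' \<oplus>\<^bsub>M\<^esub> v' \<oplus>\<^bsub>M\<^esub> k')"
          using mem m m' by (simp add: M.a_ac)
        ultimately show "?f (a \<oplus>\<^bsub>?S\<^esub> b) = ?f a \<oplus>\<^bsub>?Q\<^esub> ?f b"
          using mem m m' f by (simp only: a b) (simp add: add)
      }
      fix r assume r: "r \<in> carrier R"
      have "r \<odot>\<^bsub>?S\<^esub> a = (r \<odot>\<^bsub>M\<^esub> u, r \<odot>\<^bsub>M\<^esub> v, N +>\<^bsub>M\<^esub> (r \<odot>\<^bsub>M\<^esub> k))"
        using mem m r by (simp add: a direct_sum_simps smult)
      moreover have "r \<odot>\<^bsub>M\<^esub> u \<in> U" "r \<odot>\<^bsub>M\<^esub> v \<in> V" "r \<odot>\<^bsub>M\<^esub> k \<in> K"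
        using m r U V K(1) M.submoduleE(4) by blast+
      moreover have "r \<odot>\<^bsub>M\<^esub> u \<oplus>\<^bsub>M\<^esub> r \<odot>\<^bsub>M\<^esub> v \<oplus>\<^bsub>M\<^esub> r \<odot>\<^bsub>M\<^esub> k = r \<odot>\<^bsub>M\<^esub> (u \<oplus>\<^bsub>M\<^esub> v \<oplus>\<^bsub>M\<^esub> k)"
        using mem m r by (simp add: M.smult_r_distr)
      ultimately show "?f (r \<odot>\<^bsub>?S\<^esub> a) = r \<odot>\<^bsub>?Q\<^esub> ?f a"
        using f[OF m] f mem m r by (simp only: a) (simp add: smult)
    qed
    show "a = \<zero>\<^bsub>?S\<^esub>" if a': "a \<in> carrier ?S" "?f a = \<zero>\<^bsub>?Q\<^esub>" for a
    proof -
      obtain u v k where a: "a = (u, v, N +>\<^bsub>M\<^esub> k)" and m: "u \<in> U" "v \<in> V" "k \<in> K"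
        using a'(1) unfolding carrier_S by blast
      have "N +>\<^bsub>M\<^esub> (u \<oplus>\<^bsub>M\<^esub> v \<oplus>\<^bsub>M\<^esub> k) = N"
        using a'(2) unfolding a f[OF m] by simp
      then have uvk: "u \<oplus>\<^bsub>M\<^esub> v \<oplus>\<^bsub>M\<^esub> k \<in> N"
        using quot_coset_eq_N_iff[OF M N] mem m by (metis M.a_closed)
      then have "(u \<oplus>\<^bsub>M\<^esub> v \<oplus>\<^bsub>M\<^esub> k) \<oplus>\<^bsub>M\<^esub> \<ominus>\<^bsub>M\<^esub> k \<in> K"
        using K m M.submoduleE(3,5) by blast
      moreover have "(u \<oplus>\<^bsub>M\<^esub> v \<oplus>\<^bsub>M\<^esub> k) \<oplus>\<^bsub>M\<^esub> \<ominus>\<^bsub>M\<^esub> k = u \<oplus>\<^bsub>M\<^esub> v"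
        using mem m by (simp add: M.a_assoc M.r_neg)
      ultimately have uv: "u = \<zero>\<^bsub>M\<^esub>" "v = \<zero>\<^bsub>M\<^esub>" using indep[OF m(1,2)] by simp_all
      then have "k \<in> N" using uvk mem m by simp
      then have "N +>\<^bsub>M\<^esub> k = N" using quot_coset_eq_N_iff[OF M N] mem m by simp
      then show ?thesis by (simp add: a uv direct_sum_simps)
    qed
    show "\<exists>a\<in>carrier ?S. ?f a = b" if b: "b \<in> carrier ?Q" for b
    proof -
      obtain m where "m \<in> carrier M" "b = N +>\<^bsub>M\<^esub> m" using b by (auto simp: carrier_quot_module)
      moreover then obtain u v k where m: "u \<in> U" "v \<in> V" "k \<in> K" "m = u \<oplus>\<^bsub>M\<^esub> v \<oplus>\<^bsub>M\<^esub> k" using span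
          by blast
      ultimately have "?f (u, v, N +>\<^bsub>M\<^esub> k) = b" using f by simp
      moreover have "(u, v, N +>\<^bsub>M\<^esub> k) \<in> carrier ?S" using m unfolding carrier_S by blast
      ultimately show ?thesis by blast
    qed
  qed
qed

text \<open>The map f1 + f2 is onto with kernel N1 x N2, so it factors through the two quotients.
  Its value on cosets is recorded, because the bare existence of an isomorphism would not identify
  the classes.\<close>

lemma direct_sum_of_quots_iso:
  assumes M1: "module R M1" and M2: "module R M2" and P: "module R P"
    and N1: "submodule N1 R M1" and N2: "submodule N2 R M2"
    and f1: "module_hom_on M1 R P f1" and f2: "module_hom_on M2 R P f2"
    and zero1: "\<And>a. a \<in> N1 \<Longrightarrow> f1 a = \<zero>\<^bsub>P\<^esub>" and zero2: "\<And>b. b \<in> N2 \<Longrightarrow> f2 b = \<zero>\<^bsub>P\<^esub>"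
    and ker: "\<And>a b. a \<in> carrier M1 \<Longrightarrow> b \<in> carrier M2 \<Longrightarrow> f1 a \<oplus>\<^bsub>P\<^esub> f2 b = \<zero>\<^bsub>P\<^esub> \<Longrightarrow> a \<in> N1 \<and> b \<in> N2"
    and surj: "\<And>c. c \<in> carrier P \<Longrightarrow> \<exists>a\<in>carrier M1. \<exists>b\<in>carrier M2. c = f1 a \<oplus>\<^bsub>P\<^esub> f2 b"
  shows "\<exists>\<phi> \<in> module_iso R (direct_sum (quot_module M1 N1) (quot_module M2 N2)) P.
    \<forall>a\<in>carrier M1. \<forall>b\<in>carrier M2. \<phi> (N1 +>\<^bsub>M1\<^esub> a, N2 +>\<^bsub>M2\<^esub> b) = f1 a \<oplus>\<^bsub>P\<^esub> f2 b"
proof -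
  interpret M1: module R M1 by fact
  interpret M2: module R M2 by fact
  interpret P: module R P by fact
  have f: "f1 a \<in> carrier P" "f1 (a \<oplus>\<^bsub>M1\<^esub> a') = f1 a \<oplus>\<^bsub>P\<^esub> f1 a'"
      "c \<in> carrier R \<Longrightarrow> f1 (c \<odot>\<^bsub>M1\<^esub> a) = c \<odot>\<^bsub>P\<^esub> f1 a" if "a \<in> carrier M1" "a' \<in> carrier M1" for a
          a' c
    using f1 that by (simp_all add: module_hom_on_def)
  have g: "f2 a \<in> carrier P" "f2 (a \<oplus>\<^bsub>M2\<^esub> a') = f2 a \<oplus>\<^bsub>P\<^esub> f2 a'"
      "c \<in> carrier R \<Longrightarrow> f2 (c \<odot>\<^bsub>M2\<^esub> a) = c \<odot>\<^bsub>P\<^esub> f2 a" if "a \<in> carrier M2" "a' \<in> carrier M2" for a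
          a' c
    using f2 that by (simp_all add: module_hom_on_def)
  let ?S = "direct_sum (quot_module M1 N1) (quot_module M2 N2)"
  \<comment> \<open>Arbitrary representatives are harmless: f1 and f2 vanish on N1 and N2.\<close>
  define \<phi> where "\<phi> = (\<lambda>(C1, C2). f1 (SOME a. a \<in> C1) \<oplus>\<^bsub>P\<^esub> f2 (SOME b. b \<in> C2))"
  have \<phi>: "\<phi> (N1 +>\<^bsub>M1\<^esub> a, N2 +>\<^bsub>M2\<^esub> b) = f1 a \<oplus>\<^bsub>P\<^esub> f2 b" if a: "a \<in> carrier M1" and b: "b \<in>
      carrier M2" for a b
  proof -
    have "\<zero>\<^bsub>M1\<^esub> \<oplus>\<^bsub>M1\<^esub> a \<in> N1 +>\<^bsub>M1\<^esub> a" "\<zero>\<^bsub>M2\<^esub> \<oplus>\<^bsub>M2\<^esub> b \<in> N2 +>\<^bsub>M2\<^esub> b"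
      using subgroup.one_closed[OF submodule.axioms(1)[OF N1]] subgroup.one_closed[OF
          submodule.axioms(1)[OF N2]]
      unfolding quot_coset_mem[OF M1 N1] quot_coset_mem[OF M2 N2] by auto
    then obtain n1 n2 where n: "n1 \<in> N1" "(SOME a'. a' \<in> N1 +>\<^bsub>M1\<^esub> a) = n1 \<oplus>\<^bsub>M1\<^esub> a"
      "n2 \<in> N2" "(SOME b'. b' \<in> N2 +>\<^bsub>M2\<^esub> b) = n2 \<oplus>\<^bsub>M2\<^esub> b"
      by (metis quot_coset_mem[OF M1 N1] quot_coset_mem[OF M2 N2] someI_ex)
    moreover have "n1 \<in> carrier M1" "n2 \<in> carrier M2"
      using n M1.submoduleE(1)[OF N1] M2.submoduleE(1)[OF N2] by blast+
    ultimately show ?thesis using a b f g zero1 zero2 by (simp add: \<phi>_def)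
  qed
  have carrier_S: "x \<in> carrier ?S \<longleftrightarrow> (\<exists>a\<in>carrier M1. \<exists>b\<in>carrier M2. x = (N1 +>\<^bsub>M1\<^esub> a, N2 +>\<^bsub>M2\<^esub>
      b))" for x
    by (auto simp: direct_sum_simps carrier_quot_module)
  note Q1 = quot_module_module[OF M1 N1] and Q2 = quot_module_module[OF M2 N2]
  have "\<phi> \<in> module_iso R ?S P"
  proof (rule module_isoI[OF direct_sum_module[OF Q1 Q2] P])
    show "module_hom_on ?S R P \<phi>"
      unfolding module_hom_on_def
    proof (intro conjI ballI)
      fix x assume "x \<in> carrier ?S"
      then obtain a b where x: "a \<in> carrier M1" "b \<in> carrier M2" "x = (N1 +>\<^bsub>M1\<^esub> a, N2 +>\<^bsub>M2\<^esub> b)"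
        unfolding carrier_S by blast
      show "\<phi> x \<in> carrier P" using x f g by (simp add: \<phi>)
      {
        fix y assume "y \<in> carrier ?S"
        then obtain c d where y: "c \<in> carrier M1" "d \<in> carrier M2" "y = (N1 +>\<^bsub>M1\<^esub> c, N2 +>\<^bsub>M2\<^esub> d)"
          unfolding carrier_S by blast
        have "x \<oplus>\<^bsub>?S\<^esub> y = (N1 +>\<^bsub>M1\<^esub> (a \<oplus>\<^bsub>M1\<^esub> c), N2 +>\<^bsub>M2\<^esub> (b \<oplus>\<^bsub>M2\<^esub> d))"
          using x y by (simp add: direct_sum_simps quot_add[OF M1 N1] quot_add[OF M2 N2])
        then show "\<phi> (x \<oplus>\<^bsub>?S\<^esub> y) = \<phi> x \<oplus>\<^bsub>P\<^esub> \<phi> y"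
          using x y f g by (simp add: \<phi> P.a_ac)
      }
      fix r assume r: "r \<in> carrier R"
      have "r \<odot>\<^bsub>?S\<^esub> x = (N1 +>\<^bsub>M1\<^esub> (r \<odot>\<^bsub>M1\<^esub> a), N2 +>\<^bsub>M2\<^esub> (r \<odot>\<^bsub>M2\<^esub> b))"
        using x r by (simp add: direct_sum_simps quot_smult[OF M1 N1] quot_smult[OF M2 N2])
      then show "\<phi> (r \<odot>\<^bsub>?S\<^esub> x) = r \<odot>\<^bsub>P\<^esub> \<phi> x"
        using x r f g by (simp add: \<phi> P.smult_r_distr)
    qed
    show "x = \<zero>\<^bsub>?S\<^esub>" if x: "x \<in> carrier ?S" "\<phi> x = \<zero>\<^bsub>P\<^esub>" for x
    proof -
      obtain a b where ab: "a \<in> carrier M1" "b \<in> carrier M2" "x = (N1 +>\<^bsub>M1\<^esub> a, N2 +>\<^bsub>M2\<^esub> b)"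
        using x(1) unfolding carrier_S by blast
      then have "a \<in> N1 \<and> b \<in> N2" using ker x(2) by (simp add: \<phi>)
      then show ?thesis
        using ab quot_coset_eq_N_iff[OF M1 N1] quot_coset_eq_N_iff[OF M2 N2] by (simp add:
            direct_sum_simps)
    qed
    show "\<exists>x\<in>carrier ?S. \<phi> x = c" if "c \<in> carrier P" for c
      using surj[OF that] \<phi> carrier_S by metis
  qed
  with \<phi> show ?thesis by blast
qed

lemma cring_ring_on:
  fixes S :: "'a::ring_1 set"
  assumes "0 \<in> S" "1 \<in> S" "\<And>a b. a \<in> S \<Longrightarrow> b \<in> S \<Longrightarrow> a + b \<in> S" "\<And>a b. a \<in> S \<Longrightarrow> b \<in> S \<Longrightarrow> a * b \<in> S"
    "\<And>a. a \<in> S \<Longrightarrow> - a \<in> S" "\<And>a b. a \<in> S \<Longrightarrow> b \<in> S \<Longrightarrow> a * b = b * a"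
  shows "cring (ring_on S)"
proof (rule cringI)
  show "abelian_group (ring_on S)"
    by (rule abelian_groupI) (auto simp: ring_on_def assms algebra_simps intro!: bexI[of _ "- _"])
  show "comm_monoid (ring_on S)"
    by (rule comm_monoidI) (auto simp: ring_on_def assms(1-4) mult.assoc intro: assms(6))
qed (simp add: ring_on_def distrib_right)

lemma module_on_module:
  assumes "cring R" "0 \<in> S" "\<And>a b. a \<in> S \<Longrightarrow> b \<in> S \<Longrightarrow> a + b \<in> S" "\<And>a. a \<in> S \<Longrightarrow> - a \<in> S"
    and "\<And>c a. c \<in> carrier R \<Longrightarrow> a \<in> S \<Longrightarrow> s c a \<in> S"
    and "\<And>c d a. c \<in> carrier R \<Longrightarrow> d \<in> carrier R \<Longrightarrow> a \<in> S \<Longrightarrow> s (c \<oplus>\<^bsub>R\<^esub> d) a = s c a + s d a"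
    and "\<And>c a b. c \<in> carrier R \<Longrightarrow> a \<in> S \<Longrightarrow> b \<in> S \<Longrightarrow> s c (a + b) = s c a + s c b"
    and "\<And>c d a. c \<in> carrier R \<Longrightarrow> d \<in> carrier R \<Longrightarrow> a \<in> S \<Longrightarrow> s (c \<otimes>\<^bsub>R\<^esub> d) a = s c (s d a)"
    and "\<And>a. a \<in> S \<Longrightarrow> s \<one>\<^bsub>R\<^esub> a = a"
  shows "module R (module_on S s)"
proof (rule moduleI)
  show "abelian_group (module_on S s)"
    by (rule abelian_groupI) (auto simp: module_on_def assms(2-4) algebra_simps intro!: bexI[of _
        "- _"])
qed (use assms in \<open>auto simp: module_on_def\<close>)

lemma module_on_submodule:
  assumes M: "module R (module_on S s)" and "T \<subseteq> S" "0 \<in> T" "\<And>a b. a \<in> T \<Longrightarrow> b \<in> T \<Longrightarrow> a + b \<in> T"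
    "\<And>a. a \<in> T \<Longrightarrow> - a \<in> T" "\<And>c a. c \<in> carrier R \<Longrightarrow> a \<in> T \<Longrightarrow> s c a \<in> T"
  shows "submodule T R (module_on S s)"
proof -
  interpret M: module R "module_on S s" by fact
  have "\<ominus>\<^bsub>module_on S s\<^esub> a = - a" if "a \<in> T" for a
    using that assms(2,5) by (intro M.minus_equality) (auto simp: module_on_def)
  then show ?thesis
    using assms(2-) by (intro M.submoduleI) (auto simp: module_on_def)
qed

lemma submoduleI':
  assumes M: "module R M" and "S \<subseteq> carrier M" "\<zero>\<^bsub>M\<^esub> \<in> S"
    "\<And>a b. a \<in> S \<Longrightarrow> b \<in> S \<Longrightarrow> a \<oplus>\<^bsub>M\<^esub> b \<in> S"
    and smult: "\<And>c a. c \<in> carrier R \<Longrightarrow> a \<in> S \<Longrightarrow> c \<odot>\<^bsub>M\<^esub> a \<in> S"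
  shows "submodule S R M"
proof -
  interpret M: module R M by fact
  have "\<ominus>\<^bsub>M\<^esub> a \<in> S" if "a \<in> S" for a
  proof -
    have "\<ominus>\<^bsub>M\<^esub> a = (\<ominus>\<^bsub>R\<^esub> \<one>\<^bsub>R\<^esub>) \<odot>\<^bsub>M\<^esub> a"
      using that assms(2) by (subst M.smult_l_minus) auto
    then show ?thesis using smult that by simp
  qed
  with assms show ?thesis by (intro M.submoduleI) auto
qed

lemma cyclic_submodule:
  assumes M: "module R M" and m: "m \<in> carrier M"
  shows "submodule ((\<lambda>c. c \<odot>\<^bsub>M\<^esub> m) ` carrier R) R M"
proof -
  interpret M: module R M by fact
  show ?thesis
  proof (rule submoduleI'[OF M])
    have "\<zero>\<^bsub>R\<^esub> \<odot>\<^bsub>M\<^esub> m \<in> (\<lambda>c. c \<odot>\<^bsub>M\<^esub> m) ` carrier R" by (rule imageI) simp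
    then show "\<zero>\<^bsub>M\<^esub> \<in> (\<lambda>c. c \<odot>\<^bsub>M\<^esub> m) ` carrier R" using m by simp
  qed (use m in \<open>auto simp: M.smult_l_distr[symmetric] M.smult_assoc1[symmetric]\<close>)
qed

text \<open>Cosets depend on the addition of M alone. This lets the kernel of the induced map, a
  part of the quotient by the inner derivations, be read as a quotient of the kernel of
  restriction.\<close>

lemma quot_module_restrict_carrier:
  "quot_module (M\<lparr>carrier := K\<rparr>) N = (quot_module M N)\<lparr>carrier := a_r_coset M N ` K\<rparr>"
  by (simp add: quot_module_def A_RCOSETS_def') auto

subsection \<open>The subalgebra \<open>A\<^sub>h\<close> in normal form\<close>

lemma weyl_expansion: "a = (\<Sum>j\<le>degree (nf a). weyl_poly (coeff (nf a) j) * weyl_y ^ j)"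
proof -
  have "nf (weyl_poly f * weyl_y ^ j) = monom f j" for f :: "'a poly" and j
    by (simp add: nf_mult_y_power nf_poly mult.commute[of "monom 1 j"] smult_monom)
  then show ?thesis
    by (subst nf_eq_iff[symmetric]) (simp only: nf_sum poly_as_sum_of_monoms)
qed

lemma symbol_choice:
  fixes Q :: "nat \<Rightarrow> 'k::field poly \<Rightarrow> bool"
  assumes "\<And>n. \<exists>c. Q n c" "\<And>n. n > N \<Longrightarrow> Q n 0"
  shows "\<exists>a. \<forall>n. Q n (coeff (nf a) n)"
  using poly_choice[of Q, OF assms] nf_surj by metis

lemma power_dvd_pderiv: "h ^ Suc n dvd f \<Longrightarrow> h ^ n dvd pderiv (f :: 'k::field poly)"
proof -
  assume "h ^ Suc n dvd f"
  then obtain g where "f = h ^ Suc n * g" by (rule dvdE)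
  then have "pderiv f = h ^ n * (h * pderiv g + Polynomial.smult (of_nat (Suc n)) (pderiv h * g))"
    by (simp add: pderiv_mult pderiv_power_Suc del: of_nat_Suc power_Suc) (simp add: algebra_simps)
  then show ?thesis by simp
qed

lemma A_alg_gen:
  "weyl_x \<in> A_alg h" "weyl_y * weyl_poly h \<in> A_alg h" "weyl_const c \<in> A_alg h"
  by (simp_all add: A_alg_def subalgebra_gen.intros)

lemma A_alg_add: "a \<in> A_alg h \<Longrightarrow> b \<in> A_alg h \<Longrightarrow> a + b \<in> A_alg h"
  and A_alg_mult: "a \<in> A_alg h \<Longrightarrow> b \<in> A_alg h \<Longrightarrow> a * b \<in> A_alg h"
  by (simp_all add: A_alg_def subalgebra_gen.intros)

lemma A_alg_0 [simp]: "0 \<in> A_alg h" and A_alg_1 [simp]: "1 \<in> A_alg h"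
  using A_alg_gen(3)[of 0] A_alg_gen(3)[of 1] by (simp_all add: weyl_const_hom)

lemma A_alg_uminus: "a \<in> A_alg h \<Longrightarrow> - a \<in> A_alg h"
  using A_alg_mult[OF A_alg_gen(3)[of "-1"]] by (fastforce simp: weyl_const_uminus weyl_const_hom)

lemma A_alg_diff: "a \<in> A_alg h \<Longrightarrow> b \<in> A_alg h \<Longrightarrow> a - b \<in> A_alg h"
  using A_alg_add[of a h "- b"] A_alg_uminus[of b h] by simp

lemma A_alg_poly: "weyl_poly f \<in> A_alg h"
  by (induction f) (simp_all add: weyl_poly_pCons A_alg_add A_alg_mult A_alg_gen)

lemma A_alg_power: "a \<in> A_alg h \<Longrightarrow> a ^ n \<in> A_alg h"
  by (induction n) (simp_all add: A_alg_mult)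

lemma A_alg_sum: "(\<And>i. i \<in> S \<Longrightarrow> f i \<in> A_alg h) \<Longrightarrow> sum f S \<in> A_alg h"
  by (induction S rule: infinite_finite_induct) (simp_all add: A_alg_add)

text \<open>For the converse it suffices that h^j y^j lies in the subalgebra. By induction, h^(j+1)
  y^(j+1) is (y h - (j+1) h') times h^j y^j.\<close>

lemma A_alg_iff: "a \<in> A_alg h \<longleftrightarrow> (\<forall>j. h ^ j dvd coeff (nf a) j)"
proof
  \<comment> \<open>Closure under products is hard to see on symbols. Elements whose left
    multiplication preserves the divisibility condition are visibly closed under products, and
    evaluation at 1 recovers the condition itself.\<close>
  have closed: "\<forall>b. (\<forall>j. h ^ j dvd coeff (nf b) j) \<longrightarrow> (\<forall>j. h ^ j dvd coeff (nf (a * b)) j)"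
    if "a \<in> subalgebra_gen {weyl_x, weyl_y * weyl_poly h}" for a
    using that
  proof (induction rule: subalgebra_gen.induct)
    case (gen a)
    then consider "a = weyl_x" | "a = weyl_y * weyl_poly h" by blast
    then show ?case
    proof cases
      case 2
      have "h ^ j dvd coeff (nf (weyl_y * weyl_poly h * b)) j" if "\<forall>j. h ^ j dvd coeff (nf b) j"
          for b j
      proof -
        have dvd: "h ^ Suc i dvd h * coeff (nf b) i" for i using that by simp
        then have "h ^ j dvd pderiv (h * coeff (nf b) j)" by (rule power_dvd_pderiv)
        with dvd show ?thesis
          by (cases j) (simp_all add: mult.assoc nf_y_mult nf_poly_mult coeff_pCons)
      qed
      with 2 show ?thesis by simp
    qed (simp add: nf_x_mult dvd_mult del: mult_pCons_left)
  next
    case (add a b)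
    then show ?case by (simp add: distrib_right nf_add)
  next
    case (mult a b)
    then show ?case by (simp add: mult.assoc)
  qed (simp add: nf_const_mult dvd_smult)
  moreover have "h ^ j dvd coeff (nf 1) j" for j
    by (cases j) simp_all
  moreover assume "a \<in> A_alg h"
  ultimately show "\<forall>j. h ^ j dvd coeff (nf a) j"
    unfolding A_alg_def by (metis mult.right_neutral)
next
  assume *: "\<forall>j. h ^ j dvd coeff (nf a) j"
  have y: "weyl_poly (h ^ j) * weyl_y ^ j \<in> A_alg h" for j
  proof (induction j)
    case (Suc j)
    have "weyl_y * weyl_poly (h ^ Suc j) = weyl_poly (h ^ Suc j) * weyl_y + weyl_poly (pderiv (h ^
        Suc j))"
      by (rule weyl_y_poly)
    then have "weyl_poly (h ^ Suc j) * weyl_y ^ Suc j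
        = (weyl_y * weyl_poly (h ^ Suc j) - weyl_poly (pderiv (h ^ Suc j))) * weyl_y ^ j"
      by (simp add: mult.assoc del: power_Suc) (simp add: mult.assoc power_commutes)
    also have "\<dots> = weyl_y * weyl_poly h * (weyl_poly (h ^ j) * weyl_y ^ j)
        - weyl_poly (Polynomial.smult (of_nat (Suc j)) (pderiv h)) * (weyl_poly (h ^ j) * weyl_y ^
            j)"
      by (simp add: pderiv_power_Suc weyl_poly_mult left_diff_distrib mult.assoc weyl_poly_smult
          weyl_poly_commute[of "h ^ j"] del: of_nat_Suc power_Suc)
        (simp add: weyl_poly_mult[symmetric] mult.assoc[symmetric] mult.commute[of h])
    also have "\<dots> \<in> A_alg h"
      by (intro A_alg_diff A_alg_mult[OF _ Suc] A_alg_gen A_alg_mult A_alg_poly)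
    finally show ?case .
  qed (simp add: A_alg_poly)
  have "weyl_poly (coeff (nf a) j) * weyl_y ^ j \<in> A_alg h" for j
  proof -
    obtain g where "coeff (nf a) j = h ^ j * g" using * by (meson dvdE)
    then have "weyl_poly (coeff (nf a) j) * weyl_y ^ j = weyl_poly g * (weyl_poly (h ^ j) * weyl_y
        ^ j)"
      by (simp add: weyl_poly_mult weyl_poly_commute mult.assoc[symmetric])
    then show ?thesis using y by (simp add: A_alg_mult A_alg_poly)
  qed
  then show "a \<in> A_alg h"
    by (subst weyl_expansion) (simp add: A_alg_sum)
qed

text \<open>If z commutes with x, so does c = [y, z]. Commuting with y h then says c h = h c = 0,
  and h is not a zero divisor.\<close>

lemma center_A_alg:
  assumes "h \<noteq> 0"
  shows "center (A_alg h) = A_alg h \<inter> center UNIV"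
proof (intro equalityI subsetI)
  fix z assume z: "z \<in> center (A_alg h)"
  then have "z \<in> A_alg h" and x: "z * weyl_x = weyl_x * z"
    and yh: "z * (weyl_y * weyl_poly h) = weyl_y * weyl_poly h * z"
    by (simp_all add: center_def A_alg_gen)
  define c where "c = weyl_y * z - z * weyl_y"
  have "pderiv (nf c) = coeff_deriv (pderiv (nf z))"
    by (rule poly_eqI)
      (simp add: c_def nf_commutator_y coeff_pderiv pderiv_mult flip: of_nat_Suc)
  then have "pderiv (nf c) = 0"
    using x by (simp add: commutes_x_iff_nf)
  then have "c * weyl_x = weyl_x * c" by (simp add: commutes_x_iff_nf)
  then have "weyl_poly h * c = c * weyl_poly h"
    by (simp add: commute_poly)
  also have "\<dots> = 0"
    using yh commute_poly[OF x, of h] by (simp add: c_def left_diff_distrib mult.assoc)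
  finally have "Polynomial.smult h (nf c) = 0" using nf_poly_mult[of h c] by simp
  with assms have "c = 0" by simp
  then have "z * weyl_y = weyl_y * z" by (simp add: c_def)
  with x \<open>z \<in> A_alg h\<close> show "z \<in> A_alg h \<inter> center UNIV" by (simp add: center_UNIV_iff)
qed (auto simp: center_def)

lemma center_closed:
  assumes "y \<in> center UNIV" "z \<in> center UNIV"
  shows "y + z \<in> center UNIV" "y * z \<in> center UNIV" "- y \<in> center UNIV" "y - z \<in> center UNIV"
proof -
  have c: "y * a = a * y" "z * a = a * z" for a using assms by (auto simp: center_def)
  show "y + z \<in> center UNIV" "- y \<in> center UNIV" "y - z \<in> center UNIV"
    by (simp_all add: center_def c algebra_simps)
  have "y * z * a = a * (y * z)" for a by (metis c mult.assoc)
  then show "y * z \<in> center UNIV" by (simp add: center_def)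
qed

lemma center_commute: "z \<in> center UNIV \<Longrightarrow> z * a = a * z"
  by (simp add: center_def)

lemma poly_in_center_iff: "weyl_poly f \<in> center UNIV \<longleftrightarrow> pderiv f = 0"
  by (simp add: center_UNIV_iff_nf nf_poly pderiv_pCons coeff_deriv_pCons)

lemma poly_mult_eq_0: "weyl_poly f * a = 0 \<Longrightarrow> f \<noteq> 0 \<Longrightarrow> a = 0"
  by (metis nf_0 nf_eq_0_iff nf_poly_mult smult_eq_0_iff)

lemma poly_mult_cancel: "weyl_poly f * a = weyl_poly f * b \<Longrightarrow> f \<noteq> 0 \<Longrightarrow> a = b"
  using poly_mult_eq_0[of f "a - b"] by (simp add: right_diff_distrib)

subsection \<open>Derivations\<close>

text \<open>Neither extensionality nor values in A are required. This admits restrictions of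
  derivations of the Weyl algebra and commutators with elements outside A, and allows pointwise sums
  and multiples.\<close>

definition deriv_on :: "'k::field weyl set \<Rightarrow> ('k weyl \<Rightarrow> 'k weyl) \<Rightarrow> bool" where
  "deriv_on A d \<longleftrightarrow> (\<forall>a\<in>A. \<forall>b\<in>A. d (a + b) = d a + d b) \<and>
     (\<forall>c. \<forall>a\<in>A. d (weyl_const c * a) = weyl_const c * d a) \<and>
     (\<forall>a\<in>A. \<forall>b\<in>A. d (a * b) = d a * b + a * d b)"

lemma derivations_iff: "d \<in> derivations A \<longleftrightarrow> d \<in> A \<rightarrow>\<^sub>E A \<and> deriv_on A d"
  by (auto simp: derivations_def deriv_on_def)

lemma derivations_deriv_on: "d \<in> derivations A \<Longrightarrow> deriv_on A d"
  by (simp add: derivations_iff)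

lemma derivations_mem: "d \<in> derivations A \<Longrightarrow> a \<in> A \<Longrightarrow> d a \<in> A"
  by (auto simp: derivations_iff)

lemma derivations_ext: "d \<in> derivations S \<Longrightarrow> restrict d S = d"
  by (simp add: derivations_iff PiE_def extensional_restrict)

lemma deriv_onD:
  assumes "deriv_on A d" "a \<in> A" "b \<in> A"
  shows "d (a + b) = d a + d b" "d (weyl_const c * a) = weyl_const c * d a" "d (a * b) = d a * b +
      a * d b"
  using assms by (auto simp: deriv_on_def)

lemma deriv_on_subset: "deriv_on A d \<Longrightarrow> B \<subseteq> A \<Longrightarrow> deriv_on B d"
  unfolding deriv_on_def by blast

lemma deriv_on_restrict:
  assumes "deriv_on A d"
    and "\<And>a b. a \<in> A \<Longrightarrow> b \<in> A \<Longrightarrow> a + b \<in> A" "\<And>a b. a \<in> A \<Longrightarrow> b \<in> A \<Longrightarrow> a * b \<in> A"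
    and "\<And>c. weyl_const c \<in> A"
  shows "deriv_on A (restrict d A)"
  unfolding deriv_on_def
proof (intro conjI ballI allI)
  fix c a assume "a \<in> A"
  then show "restrict d A (weyl_const c * a) = weyl_const c * restrict d A a"
    using assms deriv_onD(2)[OF assms(1), of a a c] by simp
qed (use assms in \<open>simp_all add: deriv_onD\<close>)

lemma deriv_on_A_restrict: "deriv_on (A_alg h) d \<Longrightarrow> deriv_on (A_alg h) (restrict d (A_alg h))"
  by (rule deriv_on_restrict) (auto simp: A_alg_add A_alg_mult A_alg_gen)

lemma deriv_on_add: "deriv_on A d \<Longrightarrow> deriv_on A e \<Longrightarrow> deriv_on A (\<lambda>a. d a + e a)"
  by (auto simp: deriv_on_def algebra_simps)

lemma deriv_on_diff: "deriv_on A d \<Longrightarrow> deriv_on A e \<Longrightarrow> deriv_on A (\<lambda>a. d a - e a)"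
  by (auto simp: deriv_on_def algebra_simps)

lemma deriv_on_scale:
  assumes "deriv_on A d" "z \<in> center UNIV"
  shows "deriv_on A (\<lambda>a. z * d a)"
proof -
  have c: "z * a = a * z" for a using assms by (simp add: center_commute)
  have "z * (a * b) = a * (z * b)" for a b by (metis c mult.assoc)
  then show ?thesis using assms(1)
    by (auto simp: deriv_on_def algebra_simps)
qed

lemma deriv_on_ad: "deriv_on A (\<lambda>v. u * v - v * u)"
proof -
  have "u * (weyl_const c * a) = weyl_const c * (u * a)" for c a
    by (metis weyl_const_commute mult.assoc)
  then show ?thesis by (auto simp: deriv_on_def algebra_simps)
qed

context
  fixes A :: "'k::field weyl set" and d
  assumes d: "deriv_on A d" and const: "\<And>c. weyl_const c \<in> A"
begin

lemma deriv_on_const: "d (weyl_const c) = 0"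
proof -
  have "d 1 = 0"
    using deriv_onD(3)[OF d, of 1 1] const[of 1] by (simp add: weyl_const_hom)
  then show ?thesis
    using deriv_onD(2)[OF d, of 1 1 c] const[of 1] by (simp add: weyl_const_hom)
qed

lemma deriv_on_0: "d 0 = 0"
  using deriv_on_const[of 0] by (simp add: weyl_const_hom)

lemma deriv_on_sum:
  assumes add: "\<And>a b. a \<in> A \<Longrightarrow> b \<in> A \<Longrightarrow> a + b \<in> A" and f: "\<And>i. i \<in> S \<Longrightarrow> f i \<in> A"
  shows "d (sum f S) = (\<Sum>i\<in>S. d (f i))"
proof -
  have "sum f S \<in> A \<and> d (sum f S) = (\<Sum>i\<in>S. d (f i))"
    using f
  proof (induction S rule: infinite_finite_induct)
    case (insert i S)
    then show ?case using deriv_onD(1)[OF d] add by simp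
  qed (use const[of 0] in \<open>simp_all add: deriv_on_0 weyl_const_hom\<close>)
  then show ?thesis ..
qed

lemma deriv_on_power_eq_0:
  assumes mult: "\<And>a b. a \<in> A \<Longrightarrow> b \<in> A \<Longrightarrow> a * b \<in> A" and a: "a \<in> A" "d a = 0"
  shows "d (a ^ n) = 0"
proof -
  have "a ^ n \<in> A \<and> d (a ^ n) = 0"
  proof (induction n)
    case 0
    show ?case using const[of 1] deriv_on_const[of 1] by (simp add: weyl_const_hom)
  next
    case (Suc n)
    then show ?case using deriv_onD(3)[OF d] mult a by simp
  qed
  then show ?thesis ..
qed

end

lemma deriv_on_gen_maps:
  assumes d: "deriv_on (subalgebra_gen S) d" and gen: "\<And>s. s \<in> S \<Longrightarrow> d s \<in> subalgebra_gen S"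
    and a: "a \<in> subalgebra_gen S"
  shows "d a \<in> subalgebra_gen S"
proof -
  have 0: "weyl_const 0 \<in> subalgebra_gen S" by (rule subalgebra_gen.const)
  show ?thesis using a
  proof (induction rule: subalgebra_gen.induct)
    case (const c)
    then show ?case using 0 deriv_on_const[OF d subalgebra_gen.const] by (simp add: weyl_const_hom)
  qed (simp_all add: gen deriv_onD[OF d] subalgebra_gen.intros)
qed

lemma deriv_on_gen_eq:
  assumes d: "deriv_on (subalgebra_gen S) d" and e: "deriv_on (subalgebra_gen S) e"
    and gen: "\<And>s. s \<in> S \<Longrightarrow> d s = e s" and a: "a \<in> subalgebra_gen S"
  shows "d a = e a"
  using a
proof (induction rule: subalgebra_gen.induct)
  case (const c)
  then show ?case using deriv_on_const[OF d subalgebra_gen.const] deriv_on_const[OF e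
      subalgebra_gen.const] by simp
qed (simp_all add: gen deriv_onD[OF d] deriv_onD[OF e])

lemma deriv_on_A_alg_eqI:
  assumes "deriv_on (A_alg h) d" "deriv_on (A_alg h) e" "d weyl_x = e weyl_x"
    "d (weyl_y * weyl_poly h) = e (weyl_y * weyl_poly h)" "a \<in> A_alg h"
  shows "d a = e a"
  using deriv_on_gen_eq[of "{weyl_x, weyl_y * weyl_poly h}" d e a] assms by (auto simp: A_alg_def)

lemma derivations_A_alg_eqI:
  assumes "d \<in> derivations (A_alg h)" "e \<in> derivations (A_alg h)" "d weyl_x = e weyl_x"
    "d (weyl_y * weyl_poly h) = e (weyl_y * weyl_poly h)"
  shows "d = e"
  using assms deriv_on_A_alg_eqI[of h d e]
  by (intro extensionalityI[of _ "A_alg h"]) (auto simp: derivations_iff PiE_def)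

lemma subalgebra_gen_UNIV: "subalgebra_gen {weyl_x, weyl_y} = UNIV"
proof -
  have "a \<in> subalgebra_gen {weyl_x, weyl_y}" for a :: "'k::field weyl"
    by (induction a rule: weyl_induct) (simp_all add: subalgebra_gen.intros)
  then show ?thesis by auto
qed

lemma derivations_UNIV_eqI:
  assumes "d \<in> derivations UNIV" "e \<in> derivations UNIV" "d weyl_x = e weyl_x" "d weyl_y = e weyl_y"
  shows "d = e"
  using assms deriv_on_gen_eq[of "{weyl_x, weyl_y}" d e] unfolding subalgebra_gen_UNIV
  by (auto simp: derivations_iff)

text \<open>A derivation \<open>d\<close> is read off the module of pairs \<open>a + \<epsilon> b\<close> with \<open>\<epsilon>\<^sup>2 = 0\<close>, in which the
  generators act as \<open>x + \<epsilon> d x\<close> and \<open>y + \<epsilon> d y\<close>.\<close>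

lemma exists_derivation:
  fixes X Y :: "'k::field weyl"
  assumes "Y * weyl_x - weyl_x * Y + (weyl_y * X - X * weyl_y) = 0"
  shows "\<exists>d\<in>derivations UNIV. d weyl_x = X \<and> d weyl_y = Y"
proof -
  define sc :: "'k \<Rightarrow> 'k weyl \<times> 'k weyl \<Rightarrow> 'k weyl \<times> 'k weyl" where
    "sc c v = (weyl_const c * fst v, weyl_const c * snd v)" for c v
  define opx where "opx v = (weyl_x * fst v, X * fst v + weyl_x * snd v)" for v
  define opy where "opy v = (weyl_y * fst v, Y * fst v + weyl_y * snd v)" for v
  have yx: "weyl_y * (weyl_x * a) = weyl_x * (weyl_y * a) + (a :: 'k weyl)" for a
    using arg_cong[OF weyl_relation, of "\<lambda>r. r * a"] by (simp add: left_diff_distrib mult.assoc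
        diff_eq_eq add.commute)
  have rel: "Y * (weyl_x * a) + weyl_y * (X * a) = weyl_x * (Y * a) + X * (weyl_y * a)" for a
    using arg_cong[OF assms, of "\<lambda>r. r * a"]
    by (simp add: algebra_simps)
  have lc: "a * (weyl_const c * b) = weyl_const c * (a * b)" for a b :: "'k weyl" and c
    unfolding mult.assoc[symmetric] weyl_const_commute ..
  interpret D: weyl_module sc opx opy
  proof
    fix v :: "'k weyl \<times> 'k weyl"
    show "opy (opx v) = opx (opy v) + v"
      using rel[of "fst v"] by (simp add: opx_def opy_def prod_eq_iff distrib_left yx flip:
          add.assoc)
  qed (simp_all add: sc_def opx_def opy_def prod_eq_iff weyl_const_hom distrib_left distrib_right
      lc[of weyl_x] lc[of weyl_y] lc[of X] lc[of Y] mult.assoc add_ac)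
  define d where "d a = snd (D.act a (1, 0))" for a
  \<comment> \<open>Each a acts as left multiplication by a + \<epsilon> d a, so multiplicativity of
    the action becomes the product rule for d.\<close>
  have act: "D.act a v = (a * fst v, d a * fst v + a * snd v)" for a v
  proof (induction a arbitrary: v rule: weyl_induct)
    case (const c)
    then show ?case by (simp only: D.act_const d_def) (simp add: sc_def)
  next
    case (add a b)
    have "d (a + b) = d a + d b" by (simp add: d_def D.act_add_left)
    with add show ?case by (simp add: D.act_add_left algebra_simps)
  next
    case (x a)
    have "d (weyl_x * a) = snd (opx (D.act a (1, 0)))" by (simp only: d_def D.act_mult D.act_x)
    also have "\<dots> = X * a + weyl_x * d a" unfolding x by (simp add: opx_def)
    finally have "d (weyl_x * a) = X * a + weyl_x * d a" .
    with x show ?case by (simp only: D.act_mult D.act_x) (simp add: opx_def algebra_simps)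
  next
    case (y a)
    have "d (weyl_y * a) = snd (opy (D.act a (1, 0)))" by (simp only: d_def D.act_mult D.act_y)
    also have "\<dots> = Y * a + weyl_y * d a" unfolding y by (simp add: opy_def)
    finally have "d (weyl_y * a) = Y * a + weyl_y * d a" .
    with y show ?case by (simp only: D.act_mult D.act_y) (simp add: opy_def algebra_simps)
  qed
  have "d (weyl_const c * a) = weyl_const c * d a" for c a
    by (simp only: d_def D.act_mult D.act_const) (simp add: sc_def)
  moreover have "d (a * b) = d a * b + a * d b" for a b
  proof -
    have "d (a * b) = snd (D.act a (D.act b (1, 0)))" by (simp only: d_def D.act_mult)
    then show ?thesis unfolding act by simp
  qed
  ultimately have "d \<in> derivations UNIV"
    using D.act_add_left[of _ _ "(1, 0)"] by (simp add: derivations_iff deriv_on_def act)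
  moreover have "d weyl_x = X" "d weyl_y = Y"
    by (simp_all only: d_def D.act_x D.act_y) (simp_all add: opx_def opy_def)
  ultimately show ?thesis by blast
qed

lemma deriv_on_poly_eq_0:
  assumes d: "deriv_on A d" "A_alg h \<subseteq> A" and x: "d weyl_x = 0"
  shows "d (weyl_poly f) = 0"
proof -
  have d': "deriv_on (A_alg h) d" using d deriv_on_subset by blast
  note D = deriv_onD[OF d'] and mem = A_alg_gen A_alg_poly A_alg_mult
  show ?thesis
  proof (induction f)
    case 0
    show ?case using deriv_on_0[OF d' A_alg_gen(3)] by simp
  next
    case (pCons c f)
    then show ?case
      using deriv_on_const[OF d' A_alg_gen(3)] by (simp add: weyl_poly_pCons D mem x)
  qed
qed

text \<open>A central nonzero polynomial can be cancelled on the left and moved past every factor,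
  so the quotient of E by it inherits linearity and the product rule. Divisibility on generators
  spreads to the subalgebra. With c = h^p this produces \<open>D_der h r\<close>.\<close>

lemma deriv_on_div:
  fixes c :: "'k::field poly"
  assumes E: "deriv_on UNIV E" and c: "c \<noteq> 0" "weyl_poly c \<in> center UNIV"
    and gen: "\<And>s. s \<in> S \<Longrightarrow> \<exists>b\<in>subalgebra_gen S. E s = weyl_poly c * b"
  shows "\<exists>d\<in>derivations (subalgebra_gen S). \<forall>a\<in>subalgebra_gen S. E a = weyl_poly c * d a"
proof -
  let ?A = "subalgebra_gen S" and ?c = "weyl_poly c"
  have comm: "?c * (a * b) = a * (?c * b)" for a b
    by (metis center_commute[OF c(2)] mult.assoc)
  have E': "E (a + b) = E a + E b" "E (weyl_const k * a) = weyl_const k * E a" "E (a * b) = E a *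
      b + a * E b" for a b k
    using deriv_onD(1,3)[OF E, of a b] deriv_onD(2)[OF E, of a a k] by simp_all
  have "\<exists>b\<in>?A. E a = ?c * b" if "a \<in> ?A" for a
    using that
  proof (induction rule: subalgebra_gen.induct)
    case (const k)
    have "E (weyl_const k) = ?c * weyl_const 0"
      using deriv_on_const[OF E] by (simp add: weyl_const_hom)
    then show ?case using subalgebra_gen.const by blast
  next
    case (add a b)
    then obtain a' b' where "a' \<in> ?A" "b' \<in> ?A" "E a = ?c * a'" "E b = ?c * b'" by blast
    then have "E (a + b) = ?c * (a' + b')" "a' + b' \<in> ?A"
      by (simp_all add: E' distrib_left subalgebra_gen.add)
    then show ?case by blast
  next
    case (mult a b)
    then obtain a' b' where "a' \<in> ?A" "b' \<in> ?A" "E a = ?c * a'" "E b = ?c * b'" by blast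
    then have "E (a * b) = ?c * (a' * b + a * b')" "a' * b + a * b' \<in> ?A"
      using mult by (simp_all add: E' distrib_left subalgebra_gen.intros comm mult.assoc)
    then show ?case by blast
  qed (use gen in blast)
  then obtain d where d: "\<And>a. a \<in> ?A \<Longrightarrow> d a \<in> ?A \<and> E a = ?c * d a" by metis
  have cancel: "a = b" if "?c * a = ?c * b" for a b
    using poly_mult_cancel[OF that c(1)] .
  have "deriv_on ?A d"
    unfolding deriv_on_def
  proof (intro conjI ballI allI)
    fix a b assume ab: "a \<in> ?A" "b \<in> ?A"
    then have "a + b \<in> ?A" "a * b \<in> ?A" by (simp_all add: subalgebra_gen.intros)
    note eqs = d[OF ab(1), THEN conjunct2] d[OF ab(2), THEN conjunct2] d[OF this(1), THEN
        conjunct2] d[OF this(2), THEN conjunct2]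
    have "?c * d (a + b) = ?c * d a + ?c * d b"
      using E'(1)[of a b] unfolding eqs .
    from this[folded distrib_left] show "d (a + b) = d a + d b"
      by (rule cancel)
    have "?c * d (a * b) = ?c * d a * b + a * (?c * d b)"
      using E'(3)[of a b] unfolding eqs .
    also have "\<dots> = ?c * (d a * b + a * d b)"
      by (simp only: distrib_left comm mult.assoc)
    finally show "d (a * b) = d a * b + a * d b"
      by (rule cancel)
  next
    fix k a assume a: "a \<in> ?A"
    then have "weyl_const k * a \<in> ?A" by (simp add: subalgebra_gen.intros)
    note eqs = d[OF a, THEN conjunct2] d[OF this, THEN conjunct2]
    have "?c * d (weyl_const k * a) = weyl_const k * (?c * d a)"
      using E'(2)[of k a] unfolding eqs .
    also have "\<dots> = ?c * (weyl_const k * d a)" by (simp only: comm)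
    finally show "d (weyl_const k * a) = weyl_const k * d a"
      by (rule cancel)
  qed
  then have "deriv_on ?A (restrict d ?A)"
    by (rule deriv_on_restrict) (auto intro: subalgebra_gen.intros)
  then have "restrict d ?A \<in> derivations ?A"
    using d by (auto simp: derivations_iff)
  then show ?thesis using d by (intro bexI[of _ "restrict d ?A"]) auto
qed

text \<open>D(x^p) is the sum of x^i D(x) x^(p-1-i). On symbols, left multiplication by x is
  multiplication by the coefficient x, and right multiplication adds the derivative in t, so the
  power sum applies with this derivative as l.\<close>

lemma nf_deriv_x_power_CHAR:
  fixes d :: "'k::field weyl \<Rightarrow> 'k weyl"
  assumes char: "CHAR('k) > 0" and d: "deriv_on (A_alg h) d"
  shows "nf (d (weyl_x ^ CHAR('k))) = (pderiv ^^ (CHAR('k) - 1)) (nf (d weyl_x))"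
proof -
  let ?\<tau> = "[:[:0, 1:]:] :: 'k poly poly"
  have \<tau>: "?\<tau> ^ n * P = Polynomial.smult ([:0, 1:] ^ n) P" for n P
    by (induction n) (simp_all add: mult.assoc)
  have "nf (d (weyl_x ^ Suc n)) = ?\<tau> * nf (d (weyl_x ^ n)) + pderiv (nf (d (weyl_x ^ n))) + ?\<tau> ^ n
      * nf (d weyl_x)" for n
  proof -
    have "d (weyl_x ^ Suc n) = d (weyl_x ^ n) * weyl_x + weyl_x ^ n * d weyl_x"
      unfolding power_Suc2 by (rule deriv_onD(3)[OF d]) (simp_all add: A_alg_power A_alg_gen)
    moreover have "nf (weyl_x ^ n * a) = ?\<tau> ^ n * nf a" for a
      unfolding \<tau> by (induction n arbitrary: a) (simp_all add: nf_x_mult mult.assoc)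
    ultimately show ?thesis by (simp add: nf_add nf_mult_x)
  qed
  then show ?thesis
    using char char_p_power_sum[of pderiv ?\<tau> "\<lambda>n. nf (d (weyl_x ^ n))" "nf (d weyl_x)"]
      deriv_on_const[OF d A_alg_gen(3), of 1]
    by (simp add: pderiv_add pderiv_smult weyl_const_hom)
qed

text \<open>The sides are exchanged: right multiplication by y is multiplication by t, and left
  multiplication adds the derivative in x.\<close>

lemma nf_deriv_y_power_CHAR:
  fixes d :: "'k::field weyl \<Rightarrow> 'k weyl"
  assumes char: "CHAR('k) > 0" and d: "deriv_on UNIV d"
  shows "nf (d (weyl_y ^ CHAR('k))) = (coeff_deriv ^^ (CHAR('k) - 1)) (nf (d weyl_y))"
proof -
  let ?\<tau> = "[:0, 1:] :: 'k poly poly"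
  have "nf (d (weyl_y ^ Suc n)) = ?\<tau> * nf (d (weyl_y ^ n)) + coeff_deriv (nf (d (weyl_y ^ n))) +
      ?\<tau> ^ n * nf (d weyl_y)" for n
  proof -
    have "d (weyl_y ^ Suc n) = d weyl_y * weyl_y ^ n + weyl_y * d (weyl_y ^ n)"
      unfolding power_Suc by (rule deriv_onD(3)[OF d]) simp_all
    moreover have "?\<tau> ^ n = monom 1 n" by (simp add: monom_altdef)
    ultimately show ?thesis by (simp add: nf_add nf_y_mult nf_mult_y_power)
  qed
  then show ?thesis
    using char char_p_power_sum[of coeff_deriv ?\<tau> "\<lambda>n. nf (d (weyl_y ^ n))" "nf (d weyl_y)"]
      deriv_on_const[OF d, of 1]
    by (simp add: coeff_deriv_add coeff_deriv_pCons weyl_const_hom)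
qed

subsection \<open>Derivations of \<open>A\<^sub>h\<close>\<close>

lemma coeff_higher_coeff_deriv: "coeff ((coeff_deriv ^^ n) P) j = (pderiv ^^ n) (coeff P j)"
  by (induction n) simp_all

text \<open>Moving f to the left of y^j produces only lower powers of y besides f y^j. So modulo g
  nothing appears above m, and at m the product behaves as if f commuted.\<close>

lemma nf_right_mult_poly:
  assumes "\<And>j. j > m \<Longrightarrow> g dvd coeff (nf a) j"
  shows "(\<forall>j>m. g dvd coeff (nf (a * weyl_poly f)) j) \<and>
    g dvd coeff (nf (a * weyl_poly f)) m - f * coeff (nf a) m"
proof (induction f)
  case (pCons c f)
  have eq: "a * weyl_poly (pCons c f) = weyl_const c * a + a * weyl_poly f * weyl_x"
    using weyl_poly_commute[of "[:0, 1:]" f]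
    by (simp add: weyl_poly_pCons distrib_left weyl_const_commute mult.assoc weyl_const_hom)
  have coeff: "coeff (nf (a * weyl_poly (pCons c f))) j = [:c:] * coeff (nf a) j
      + [:0, 1:] * coeff (nf (a * weyl_poly f)) j + of_nat (Suc j) * coeff (nf (a * weyl_poly f))
          (Suc j)" for j
    unfolding eq by (simp add: nf_add nf_const_mult nf_mult_x coeff_pderiv)
  have "coeff (nf (a * weyl_poly (pCons c f))) m - pCons c f * coeff (nf a) m
      = [:0, 1:] * (coeff (nf (a * weyl_poly f)) m - f * coeff (nf a) m)
        + of_nat (Suc m) * coeff (nf (a * weyl_poly f)) (Suc m)"
    unfolding coeff by (simp add: algebra_simps)
  also have "g dvd \<dots>"
    using pCons by (intro dvd_add dvd_mult) auto
  finally have "g dvd coeff (nf (a * weyl_poly (pCons c f))) m - pCons c f * coeff (nf a) m" .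
  moreover have "g dvd coeff (nf (a * weyl_poly (pCons c f))) j" if "j > m" for j
    unfolding coeff using pCons that assms by (intro dvd_add dvd_mult) auto
  ultimately show ?case by blast
qed simp

text \<open>As w commutes with x, so does [y, w]. Hence h moves to the left of it and [w, y h] = - h
  [y, w].\<close>

lemma nf_commutator_yh:
  assumes "pderiv (nf w) = 0"
  shows "nf (w * (weyl_y * weyl_poly h) - weyl_y * weyl_poly h * w) = - Polynomial.smult h
      (coeff_deriv (nf w))"
proof -
  have x: "w * weyl_x = weyl_x * w" using assms by (simp add: commutes_x_iff_nf)
  define c where "c = weyl_y * w - w * weyl_y"
  have "pderiv (nf c) = coeff_deriv (pderiv (nf w))"
    by (rule poly_eqI) (simp add: c_def nf_commutator_y coeff_pderiv pderiv_mult flip: of_nat_Suc)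
  then have "c * weyl_x = weyl_x * c" using assms by (simp add: commutes_x_iff_nf)
  then have "weyl_poly h * c = c * weyl_poly h" by (simp add: commute_poly)
  moreover have "w * (weyl_y * weyl_poly h) - weyl_y * weyl_poly h * w = - (c * weyl_poly h)"
    using commute_poly[OF x, of h] by (simp add: c_def left_diff_distrib mult.assoc)
  ultimately show ?thesis by (metis c_def nf_commutator_y nf_poly_mult nf_uminus)
qed

text \<open>Apply d to z a = a z and cancel the terms that contain d a, with which z
  commutes.\<close>

lemma derivations_center:
  assumes d: "d \<in> derivations (A_alg h)" and z: "z \<in> center (A_alg h)"
  shows "d z \<in> center (A_alg h)"
proof -
  have zA: "z \<in> A_alg h" and comm: "\<And>a. a \<in> A_alg h \<Longrightarrow> z * a = a * z"
    using z by (auto simp: center_def)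
  have "d z * a = a * d z" if a: "a \<in> A_alg h" for a
  proof -
    note D = deriv_onD(3)[OF derivations_deriv_on[OF d]]
    have "d z * a + z * d a = d a * z + a * d z"
      using D[OF zA a] D[OF a zA] comm[OF a] by simp
    moreover have "z * d a = d a * z"
      using comm derivations_mem[OF d a] by blast
    ultimately show ?thesis by (simp add: add.commute)
  qed
  then show ?thesis using derivations_mem[OF d zA] by (simp add: center_def)
qed

lemma nf_y_power_mult_poly:
  "coeff (nf (weyl_y ^ n * weyl_poly f)) n = f \<and> (\<forall>j>n. coeff (nf (weyl_y ^ n * weyl_poly f)) j =
      0)"
proof (induction n)
  case 0
  show ?case by (auto simp: nf_poly coeff_pCons split: nat.split)
next
  case (Suc n)
  have "coeff (nf (weyl_y ^ Suc n * weyl_poly f)) (Suc j) = pderiv (coeff (nf (weyl_y ^ n *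
      weyl_poly f)) (Suc j))
      + coeff (nf (weyl_y ^ n * weyl_poly f)) j" for j
    by (simp add: mult.assoc nf_y_mult)
  moreover have "coeff (nf (weyl_y ^ Suc n * weyl_poly f)) (Suc n) = f"
    using calculation[of n] Suc by simp
  moreover have "coeff (nf (weyl_y ^ Suc n * weyl_poly f)) j = 0" if j: "j > Suc n" for j
  proof -
    obtain i where "j = Suc i" "i > n" using j by (cases j) auto
    then show ?thesis using calculation(1)[of i] Suc by simp
  qed
  ultimately show ?case by blast
qed

section \<open>The derivations D_r and F for a fixed nonzero h\<close>

locale weyl_subalgebra =
  fixes h :: "'k::field poly"
  assumes char: "CHAR('k) > 0" and h: "h \<noteq> 0"
begin

abbreviation A :: "'k weyl set" where "A \<equiv> A_alg h"
abbreviation Z :: "'k weyl set" where "Z \<equiv> center (A_alg h)"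
abbreviation yh :: "'k weyl" where "yh \<equiv> weyl_y * weyl_poly h"
abbreviation pairing :: "'k poly \<Rightarrow> 'k poly" where
  "pairing r \<equiv> (pderiv ^^ (CHAR('k) - 1)) (r * h ^ (CHAR('k) - 1))"

lemma center_mem: "z \<in> Z \<longleftrightarrow> z \<in> A \<and> z \<in> center UNIV"
  by (simp add: center_A_alg[OF h])

lemma Fxp_in_center: "f \<in> Fxp \<Longrightarrow> weyl_poly f \<in> Z"
  using char by (simp add: center_mem A_alg_poly poly_in_center_iff Fxp_iff)

text \<open>The value at y would be r / h; multiplied by the central h^p it becomes the polynomial r
  h^(p-1). So h^p D_r exists on the whole Weyl algebra as E, and D_r is E divided by h^p. E stays in
  the statement because y^p, which need not lie in A_h, is needed to compute on the centre.\<close>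

lemma D_der_construction:
  "D_der h r \<in> derivations A \<and> D_der h r weyl_x = 0 \<and> D_der h r yh = weyl_poly r \<and>
   (\<exists>E. deriv_on UNIV E \<and> E weyl_x = 0 \<and> E weyl_y = weyl_poly (r * h ^ (CHAR('k) - 1)) \<and>
      (\<forall>a\<in>A. E a = weyl_poly (h ^ CHAR('k)) * D_der h r a))"
proof -
  let ?H = "weyl_poly (h ^ CHAR('k))"
  obtain E where E: "E \<in> derivations UNIV" "E weyl_x = 0" "E weyl_y = weyl_poly (r * h ^ (CHAR('k)
      - 1))"
    using exists_derivation[of "weyl_poly (r * h ^ (CHAR('k) - 1))" 0] weyl_poly_commute[of "[:0,
        1:]" "r * h ^ (CHAR('k) - 1)"]
    by (auto simp: weyl_poly_pCons weyl_const_hom)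
  have dE: "deriv_on UNIV E" using E(1) by (rule derivations_deriv_on)
  have "E (weyl_poly h) = 0" by (rule deriv_on_poly_eq_0[OF dE]) (simp_all add: E)
  then have Eyh: "E yh = ?H * weyl_poly r"
    using deriv_onD(3)[OF dE, of weyl_y "weyl_poly h"] power_CHAR[OF char, of h]
    by (simp add: E flip: weyl_poly_mult) (simp add: mult_ac)
  have H: "h ^ CHAR('k) \<noteq> 0" "?H \<in> center UNIV"
    using h by (simp_all add: poly_in_center_iff pderiv_power_CHAR)
  have gens: "\<exists>b\<in>A. E s = ?H * b" if "s \<in> {weyl_x, yh}" for s
  proof (cases "s = weyl_x")
    case True
    then have "E s = ?H * 0" by (simp add: E)
    then show ?thesis using A_alg_0 by blast
  next
    case False
    then have "E s = ?H * weyl_poly r" using that Eyh by simp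
    then show ?thesis using A_alg_poly by blast
  qed
  obtain d where d: "d \<in> derivations A" "\<And>a. a \<in> A \<Longrightarrow> E a = ?H * d a"
    using deriv_on_div[OF dE H gens[unfolded A_alg_def]] unfolding A_alg_def[symmetric] by blast
  have gens: "weyl_x \<in> A" "yh \<in> A" by (simp_all add: A_alg_gen)
  have "d weyl_x = 0" "d yh = weyl_poly r"
    using poly_mult_cancel[OF _ H(1)] d(2)[OF gens(1)] d(2)[OF gens(2)] E(2) Eyh by (metis
        mult_zero_right)+
  moreover from this d(1) have "D_der h r = d"
    unfolding D_der_def by (intro the_equality) (auto intro: derivations_A_alg_eqI)
  ultimately show ?thesis using d dE E by blast
qed

lemma D_der_derivation: "D_der h r \<in> derivations A"
  and D_der_x: "D_der h r weyl_x = 0"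
  and D_der_yh: "D_der h r yh = weyl_poly r"
  using D_der_construction[of r] by auto

lemmas D_der_deriv_on = derivations_deriv_on[OF D_der_derivation]

lemma D_der_eqI:
  assumes "d \<in> derivations A" "d weyl_x = 0" "d yh = weyl_poly r"
  shows "d = D_der h r"
  by (rule derivations_A_alg_eqI[of d h]) (simp_all add: assms D_der_derivation D_der_x D_der_yh)

lemma nf_z_central: "nf (z_central h) = monom (h ^ CHAR('k)) CHAR('k)"
  by (simp add: z_central_def nf_mult_y_power nf_poly mult.commute[of "monom 1 CHAR('k)"]
      smult_monom)

lemma z_central_in_center: "z_central h \<in> Z"
proof -
  have "h ^ j dvd coeff (nf (z_central h)) j" for j
    by (simp add: nf_z_central)
  then have "z_central h \<in> A" by (simp add: A_alg_iff)
  moreover have "coeff_deriv (monom (h ^ CHAR('k)) CHAR('k)) = 0"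
    by (rule poly_eqI) (auto simp: coeff_monom pderiv_power_CHAR)
  moreover have "pderiv (monom (h ^ CHAR('k)) CHAR('k)) = 0"
    by (simp add: pderiv_monom of_nat_poly)
  ultimately show ?thesis
    by (simp add: center_mem center_UNIV_iff_nf nf_z_central)
qed

text \<open>E kills h^p, so it suffices to know E(y^p), and E(y) has a symbol without t, to which
  the formula for y^p applies.\<close>

lemma D_der_z_central: "D_der h r (z_central h) = weyl_poly (pairing r)"
proof -
  obtain E where E: "deriv_on UNIV E" "E weyl_x = 0" "E weyl_y = weyl_poly (r * h ^ (CHAR('k) - 1))"
    "\<And>a. a \<in> A \<Longrightarrow> E a = weyl_poly (h ^ CHAR('k)) * D_der h r a"
    using D_der_construction[of r] by blast
  have "nf (E (weyl_y ^ CHAR('k))) = (coeff_deriv ^^ (CHAR('k) - 1)) [:r * h ^ (CHAR('k) - 1):]"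
    using nf_deriv_y_power_CHAR[OF char E(1)] by (simp add: E(3) nf_poly)
  also have "\<dots> = [:pairing r:]"
    by (induction "CHAR('k) - 1" rule: nat.induct) (rule poly_eqI, simp add:
        coeff_higher_coeff_deriv coeff_pCons split: nat.split)+
  finally have "E (weyl_y ^ CHAR('k)) = weyl_poly (pairing r)"
    by (metis nf_eq_iff nf_poly)
  then have "weyl_poly (h ^ CHAR('k)) * D_der h r (z_central h) = weyl_poly (h ^ CHAR('k)) *
      weyl_poly (pairing r)"
    using E(4)[of "z_central h"] z_central_in_center deriv_on_poly_eq_0[OF E(1) subset_UNIV E(2)]
    by (simp add: z_central_def deriv_onD(3)[OF E(1)] center_mem)
  then show ?thesis using poly_mult_cancel h by (metis power_not_zero)
qed

lemma zero_Der: "\<zero>\<^bsub>Der S\<^esub> = (\<lambda>a\<in>S. 0)"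
  by (simp add: Der_def)

text \<open>For the converse, a central element involves only powers y^j with p | j. The extension E
  kills polynomials in x, and it kills y^p when the pairing vanishes, hence it kills the whole
  centre; h^p is then cancelled.\<close>

lemma Theta_iff: "r \<in> Theta h \<longleftrightarrow> pairing r = 0"
proof
  assume "r \<in> Theta h"
  then have "Res A (D_der h r) = (\<lambda>a\<in>Z. 0)"
    by (simp add: Theta_def zero_Der)
  from fun_cong[OF this, of "z_central h"] have "D_der h r (z_central h) = 0"
    using z_central_in_center by (simp add: Res_def)
  then have "nf (weyl_poly (pairing r)) = 0" by (simp add: D_der_z_central)
  then show "pairing r = 0" by (simp add: nf_poly)
next
  assume r: "pairing r = 0"
  obtain E where E: "deriv_on UNIV E" "E weyl_x = 0" "E weyl_y = weyl_poly (r * h ^ (CHAR('k) - 1))"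
    "\<And>a. a \<in> A \<Longrightarrow> E a = weyl_poly (h ^ CHAR('k)) * D_der h r a"
    using D_der_construction[of r] by blast
  have E_poly: "E (weyl_poly f) = 0" for f
    by (rule deriv_on_poly_eq_0[OF E(1) subset_UNIV E(2)])
  have "weyl_poly (h ^ CHAR('k)) * E (weyl_y ^ CHAR('k)) = E (z_central h)"
    by (simp add: z_central_def deriv_onD(3)[OF E(1)] E_poly)
  also have "\<dots> = 0"
    using z_central_in_center r by (simp add: E(4) center_mem D_der_z_central)
  finally have Ey: "E (weyl_y ^ CHAR('k)) = 0" using poly_mult_eq_0 h by (metis power_not_zero)
  have "E ((weyl_y ^ CHAR('k)) ^ k) = 0" for k
    by (rule deriv_on_power_eq_0[OF E(1)]) (simp_all add: Ey)
  then have E_y: "E (weyl_y ^ j) = 0" if "CHAR('k) dvd j" for j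
    using that by (auto elim!: dvdE simp: power_mult)
  have "D_der h r z = 0" if z: "z \<in> Z" for z
  proof -
    have "pderiv (nf z) = 0" using z by (simp add: center_mem center_UNIV_iff_nf)
    then have "coeff (nf z) j = 0" if "\<not> CHAR('k) dvd j" for j
      using that by (simp add: pderiv_eq_0_iff_coeff)
    then have "E (weyl_poly (coeff (nf z) j) * weyl_y ^ j) = 0" for j
      using E_y by (cases "CHAR('k) dvd j") (simp_all add: deriv_onD(3)[OF E(1)] E_poly
          deriv_on_0[OF E(1)])
    then have "E z = 0"
      by (subst weyl_expansion) (simp add: deriv_on_sum[OF E(1)])
    then have "weyl_poly (h ^ CHAR('k)) * D_der h r z = 0" using z E(4) by (simp add: center_mem)
    then show ?thesis using poly_mult_eq_0 h by (metis power_not_zero)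
  qed
  then show "r \<in> Theta h"
    by (auto simp: Theta_def Res_def zero_Der restrict_def)
qed

text \<open>By \<open>power_dvd_power_div_rho\<close> and \<open>Fxp_dvd_by_power\<close>, this
  generates the ideal of elements of F[x^p] that are divisible by h^(p-1).\<close>

abbreviation q :: "'k poly" where "q \<equiv> h ^ CHAR('k) div rho h"

lemma q_rho: "h ^ CHAR('k) = rho h * q"
  using rho_dvd_power[OF char h] by simp

lemma q_neq_0: "q \<noteq> 0"
  using q_rho h by (metis mult_zero_right power_not_zero)

lemma q_Fxp: "q \<in> Fxp"
  using q_rho Fxp_cofactor[OF char, of "rho h" q] rho_Fxp[OF char h] rho_neq_0[OF char h]
      Fxp_closed(9)[OF char, of h]
  by simp

lemma E_x_props: "(E_x :: 'k weyl \<Rightarrow> 'k weyl) \<in> derivations UNIV" "E_x weyl_x = (weyl_y :: 'k weyl)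
    ^ (CHAR('k) - 1)" "E_x weyl_y = (0 :: 'k weyl)"
proof -
  obtain d :: "'k weyl \<Rightarrow> 'k weyl" where d: "d \<in> derivations UNIV" "d weyl_x = weyl_y ^ (CHAR('k) -
      1)" "d weyl_y = 0"
    using exists_derivation[of 0 "weyl_y ^ (CHAR('k) - 1)"] by (auto simp: power_commutes)
  then have "E_x = d"
    unfolding E_x_def by (intro the_equality) (auto intro: derivations_UNIV_eqI)
  with d show "(E_x :: 'k weyl \<Rightarrow> 'k weyl) \<in> derivations UNIV" "E_x weyl_x = (weyl_y :: 'k weyl) ^
      (CHAR('k) - 1)" "E_x weyl_y = (0 :: 'k weyl)"
    by auto
qed

text \<open>Each x in f contributes y^(p-1) plus lower terms, so the top term of E_x(f) is f'
  y^(p-1). Lower coefficients need no control: they get multiplied by \<open>q\<close>, which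
  h^(p-1) divides.\<close>

lemma E_x_poly:
  "coeff (nf (E_x (weyl_poly f))) (CHAR('k) - 1) = pderiv (f :: 'k poly) \<and> (\<forall>j\<ge>CHAR('k). coeff (nf
      (E_x (weyl_poly f))) j = 0)"
proof (induction f)
  case 0
  show ?case using deriv_on_0[OF derivations_deriv_on[OF E_x_props(1)]] by simp
next
  case (pCons c f)
  note D = derivations_deriv_on[OF E_x_props(1)]
  have eq: "nf (E_x (weyl_poly (pCons c f))) = nf (weyl_y ^ (CHAR('k) - 1) * weyl_poly f) +
      Polynomial.smult [:0, 1:] (nf (E_x (weyl_poly f)))"
    using deriv_on_const[OF D] by (simp add: weyl_poly_pCons deriv_onD[OF D] E_x_props nf_add
        nf_x_mult)
  have y: "coeff (nf (weyl_y ^ (CHAR('k) - 1) * weyl_poly f)) (CHAR('k) - 1) = f"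
    "\<And>j. j \<ge> CHAR('k) \<Longrightarrow> coeff (nf (weyl_y ^ (CHAR('k) - 1) * weyl_poly f)) j = 0"
    using nf_y_power_mult_poly[of "CHAR('k) - 1" f] char by auto
  show ?case using pCons y unfolding eq by (simp add: pderiv_pCons del: One_nat_def)
qed

text \<open>Below y^p the divisibility needed for A_h comes from h^(p-1) dividing \<open>q\<close>.
  At y^p the two parts of F(y h) cancel: \<open>q\<close> E_x(y h) contributes q h', and z_h h'/rho
  contributes h^p h'/rho, which is the same. Nothing lies above.\<close>

lemma F_breve_derivation: "F_breve h \<in> derivations A"
  and F_breve_x: "F_breve h weyl_x = - (weyl_poly q * weyl_y ^ (CHAR('k) - 1))"
proof -
  define F where "F a = z_central h * D_der h (pderiv h div rho h) a - weyl_poly q * E_x a" for a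
  have central: "z_central h \<in> center UNIV" "weyl_poly q \<in> center UNIV"
    using z_central_in_center Fxp_in_center[OF q_Fxp] by (simp_all add: center_mem)
  have "deriv_on A (\<lambda>a. z_central h * D_der h (pderiv h div rho h) a)"
    by (rule deriv_on_scale[OF D_der_deriv_on central(1)])
  moreover have "deriv_on A (\<lambda>a. weyl_poly q * E_x a)"
    by (rule deriv_on_scale[OF deriv_on_subset[OF derivations_deriv_on[OF E_x_props(1)]
        subset_UNIV] central(2)])
  ultimately have "deriv_on A (\<lambda>a. z_central h * D_der h (pderiv h div rho h) a - weyl_poly q *
      E_x a)"
    by (rule deriv_on_diff)
  then have dF: "deriv_on A F" by (simp add: F_def[abs_def])
  have q_dvd: "h ^ j dvd q" if "j < CHAR('k)" for j
  proof -
    have "h ^ j dvd h ^ (CHAR('k) - 1)" using that by (intro le_imp_power_dvd) simp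
    then show ?thesis using power_dvd_power_div_rho[OF char h] dvd_trans by blast
  qed
  have Fx: "F weyl_x = - (weyl_poly q * weyl_y ^ (CHAR('k) - 1))"
    by (simp add: F_def D_der_x E_x_props)
  have "F weyl_x \<in> A"
    unfolding A_alg_iff Fx using q_dvd char
    by (auto simp: nf_uminus nf_poly_mult nf_mult_y_power[of 1, simplified] coeff_monom)
  moreover have "F yh \<in> A"
  proof -
    let ?P = "nf (E_x (weyl_poly h))"
    have "E_x yh = weyl_y * E_x (weyl_poly h)"
      using deriv_onD(3)[OF derivations_deriv_on[OF E_x_props(1)], of weyl_y "weyl_poly h"] by
          (simp add: E_x_props)
    then have "nf (weyl_poly q * E_x yh) = Polynomial.smult q (coeff_deriv ?P + pCons 0 ?P)"
      by (simp add: nf_poly_mult nf_y_mult)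
    moreover have "nf (z_central h * weyl_poly (pderiv h div rho h)) = monom (q * pderiv h)
        CHAR('k)"
    proof -
      have "nf (z_central h * weyl_poly (pderiv h div rho h)) = monom (pderiv h div rho h * h ^
          CHAR('k)) CHAR('k)"
        using center_commute[OF central(1)] by (simp add: nf_poly_mult nf_z_central smult_monom)
      also have "pderiv h div rho h * h ^ CHAR('k) = pderiv h div rho h * rho h * q"
        using q_rho by (simp add: mult.assoc)
      also have "\<dots> = q * pderiv h"
        using rho_dvd_pderiv[OF char h] by simp
      finally show ?thesis .
    qed
    ultimately have nf_F: "nf (F yh) = monom (q * pderiv h) CHAR('k) - Polynomial.smult q
        (coeff_deriv ?P + pCons 0 ?P)"
      by (simp add: F_def D_der_yh nf_diff)
    have "h ^ j dvd coeff (nf (F yh)) j" for j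
    proof (cases "j < CHAR('k)")
      case True
      then show ?thesis using q_dvd unfolding nf_F by (auto intro!: dvd_diff simp: coeff_monom)
    next
      case False
      then obtain i where i: "j = Suc i" using char by (cases j) auto
      have "coeff ?P i = (if Suc i = CHAR('k) then pderiv h else 0)"
      proof (cases "Suc i = CHAR('k)")
        case True
        then have "i = CHAR('k) - 1" by simp
        then show ?thesis using True E_x_poly[of h] by simp
      qed (use False i E_x_poly[of h] in auto)
      moreover have "coeff ?P (Suc i) = 0" using False i E_x_poly[of h] by auto
      ultimately have "coeff (nf (F yh)) j = 0"
        unfolding nf_F i by (simp add: coeff_monom)
      then show ?thesis by simp
    qed
    then show ?thesis by (simp add: A_alg_iff)
  qed
  ultimately have maps: "F a \<in> A" if "a \<in> A" for a
    using deriv_on_gen_maps[of "{weyl_x, yh}" F a] dF that by (auto simp: A_alg_def)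
  have F_breve: "F_breve h = restrict F A" by (simp add: F_breve_def F_def[abs_def])
  show "F_breve h \<in> derivations A"
    using maps deriv_on_A_restrict[OF dF] by (simp add: derivations_iff F_breve)
  show "F_breve h weyl_x = - (weyl_poly q * weyl_y ^ (CHAR('k) - 1))"
    using Fx by (simp add: F_breve A_alg_gen)
qed

lemmas F_breve_deriv_on = derivations_deriv_on[OF F_breve_derivation]

lemma nf_F_breve_x: "nf (F_breve h weyl_x) = - monom q (CHAR('k) - 1)"
  using nf_mult_y_power[of "weyl_poly q"]
  by (simp add: F_breve_x nf_uminus nf_poly mult.commute[of "monom 1 _"] smult_monom)

text \<open>The (p-1)-st derivative turns t^(p-1) into (p-1)!. The nonzero value at x^p is what
  separates F from the derivations D_r, which kill x^p.\<close>

lemma F_breve_x_power: "F_breve h (weyl_x ^ CHAR('k)) = - weyl_poly (of_nat (fact (CHAR('k) - 1))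
    * q)"
proof -
  have "coeff ((pderiv ^^ (CHAR('k) - 1)) (- monom q (CHAR('k) - 1))) n = coeff [:- (of_nat (fact
      (CHAR('k) - 1)) * q):] n" for n
  proof -
    have "coeff ((pderiv ^^ (CHAR('k) - 1)) (- monom q (CHAR('k) - 1))) n
      = (if CHAR('k) dvd n then of_nat (fact (CHAR('k) - 1)) * coeff (- monom q (CHAR('k) - 1)) (n
          + (CHAR('k) - 1)) else 0)"
      using coeff_higher_pderiv_CHAR[where 'a = "'k poly" and f = "- monom q (CHAR('k) - 1)" and n
          = n] char by (simp only: semiring_char_poly)
    also have "\<dots> = coeff [:- (of_nat (fact (CHAR('k) - 1)) * q):] n"
      by (cases n) (auto simp: coeff_monom)
    finally show ?thesis .
  qed
  then have "nf (F_breve h (weyl_x ^ CHAR('k))) = [:- (of_nat (fact (CHAR('k) - 1)) * q):]"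
    unfolding nf_deriv_x_power_CHAR[OF char F_breve_deriv_on] nf_F_breve_x by (rule poly_eqI)
  then show ?thesis by (subst nf_eq_iff[symmetric]) (simp add: nf_uminus nf_poly)
qed

text \<open>The factor y may put c y outside A_h, its coefficient at y^(j+1) being divisible by h^j
  only. At n divisible by p nothing is lost: the coefficient of c at n-1 is zero, so modulo h^n
  those from n-1 on vanish, and the one at n-2 cancels because c h and h c agree at their top
  exponent modulo h^n.\<close>

lemma commutator_coeff_dvd:
  assumes c: "c \<in> A" and zero: "\<And>n. CHAR('k) dvd Suc n \<Longrightarrow> coeff (nf c) n = 0" and n: "CHAR('k) dvd n"
  shows "h ^ n dvd coeff (nf (c * weyl_y * yh - yh * (c * weyl_y))) n"
proof (cases "n = 0")
  case False
  \<comment> \<open>Since p is at least 2, so is n, and the exponent n - 2, called l, makes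
    sense.\<close>
  have "CHAR('k) > 1" using prime_gt_1_nat[OF prime_CHAR_semidom[OF char]] .
  moreover have "CHAR('k) \<le> n" using n False by (simp add: dvd_imp_le)
  ultimately have "2 \<le> n" by simp
  then obtain l where l: "n = Suc (Suc l)"
    by (metis add_2_eq_Suc le_Suc_ex)
  let ?h' = "weyl_poly (pderiv h)" and ?T = "\<lambda>a. coeff (nf a) (Suc l)"
  have dvd: "h ^ j dvd coeff (nf c) j" for j using c by (simp add: A_alg_iff)
  then have dvd': "h ^ k dvd coeff (nf c) j" if "k \<le> j" for k j
    using that by (meson dvd_trans le_imp_power_dvd)
  have c0: "coeff (nf c) (Suc l) = 0" using zero n l by simp
  have e1: "yh = weyl_poly h * weyl_y + ?h'"
    and e2: "weyl_y * ?h' = ?h' * weyl_y + weyl_poly (pderiv (pderiv h))" by (rule weyl_y_poly)+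
  have "weyl_y * (weyl_poly h * weyl_y + ?h') = yh * weyl_y + weyl_y * ?h'"
    by (simp only: distrib_left mult.assoc)
  then have e3: "weyl_y * yh = (weyl_poly h * weyl_y + ?h') * weyl_y + (?h' * weyl_y + weyl_poly
      (pderiv (pderiv h)))"
    unfolding e1[symmetric] e2 .
  have e4: "c * weyl_y * yh = c * (weyl_y * yh)" by (rule mult.assoc)
  \<comment> \<open>With y split off on the right, the coefficient at n becomes that of the bracket
    at n - 1, up to an element of A_h.\<close>
  have eq: "c * weyl_y * yh - yh * (c * weyl_y) =
      (c * weyl_poly h * weyl_y - weyl_poly h * (weyl_y * c) - ?h' * c + (c * ?h' + c * ?h')) *
          weyl_y
      + c * weyl_poly (pderiv (pderiv h))"
    (is "_ = ?S * weyl_y + _")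
    unfolding e4 e3 unfolding e1 by (simp add: algebra_simps)
  have "h ^ n dvd ?T (c * weyl_poly h * weyl_y) - ?T (weyl_poly h * (weyl_y * c))"
  proof -
    have "h ^ n dvd coeff (nf c) j" if "j > l" for j
      using that c0 dvd'[of n j] l by (cases "j = Suc l") auto
    from nf_right_mult_poly[OF this, of l h]
    have "h ^ n dvd coeff (nf (c * weyl_poly h)) l - h * coeff (nf c) l" by blast
    then show ?thesis by (simp add: nf_mult_y nf_poly_mult nf_y_mult c0)
  qed
  moreover have "h ^ n dvd ?T (c * ?h')"
  proof -
    have "h ^ n dvd coeff (nf c) j" if "j > Suc l" for j
      using that dvd'[of n j] l by simp
    from nf_right_mult_poly[OF this, of "Suc l" "pderiv h"] show ?thesis by (simp add: c0)
  qed
  moreover have "?T (?h' * c) = 0" by (simp add: nf_poly_mult c0)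
  ultimately have "h ^ n dvd ?T ?S"
    unfolding nf_add nf_diff coeff_add coeff_diff by (simp only: diff_zero dvd_add)
  moreover have "c * weyl_poly (pderiv (pderiv h)) \<in> A" by (simp add: A_alg_mult c A_alg_poly)
  ultimately show ?thesis
    unfolding eq by (simp add: nf_add nf_mult_y l A_alg_iff del: power_Suc)
qed simp

text \<open>The difference w = t - a commutes with x because D_r kills x, and so r = [w, y h] = - h
  [y, w]. Comparing symbols, the coefficients of w at positive powers of y have zero derivative, and
  r is - h times the derivative of the constant one. Thus w is central up to a polynomial in
  x.\<close>

lemma inner_D_der:
  assumes t: "t \<in> A"
    and eq: "\<And>b. b \<in> A \<Longrightarrow> D_der h r b + (a * b - b * a) = t * b - b * t"
  shows "r \<in> range (delta h) \<and> a \<in> A_plus_center h"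
proof -
  define w where "w = t - a"
  have "w * weyl_x - weyl_x * w = D_der h r weyl_x"
    using eq[OF A_alg_gen(1)] by (simp add: w_def algebra_simps)
  then have w: "pderiv (nf w) = 0"
    by (metis D_der_x nf_0 nf_commutator_x)
  have "w * yh - yh * w = D_der h r yh"
    using eq[OF A_alg_gen(2)] by (simp add: w_def left_diff_distrib right_diff_distrib) (simp add:
        algebra_simps)
  then have "[:r:] = - Polynomial.smult h (coeff_deriv (nf w))"
    using nf_commutator_yh[OF w, of h] by (simp add: D_der_yh nf_poly)
  then have "coeff [:r:] n = - (h * pderiv (coeff (nf w) n))" for n by simp
  from this[of 0] this[of "Suc _"] have r: "r = - (h * pderiv (coeff (nf w) 0))"
    and pos: "pderiv (coeff (nf w) (Suc n)) = 0" for n using h by auto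
  have "r = delta h (- coeff (nf w) 0)"
    using r by (simp add: delta_def pderiv_minus)
  moreover have "a \<in> A_plus_center h"
  proof -
    define c where "c = weyl_poly (coeff (nf w) 0) - w"
    have "pderiv (nf c) = 0"
      using w by (simp add: c_def nf_diff nf_poly pderiv_diff pderiv_pCons)
    moreover have "coeff_deriv (nf c) = 0"
    proof (rule poly_eqI)
      fix n
      show "coeff (coeff_deriv (nf c)) n = coeff 0 n"
        using pos by (cases n) (simp_all add: c_def nf_diff nf_poly pderiv_minus)
    qed
    ultimately have "c \<in> center UNIV" by (simp add: center_UNIV_iff_nf)
    moreover have "a = (t - weyl_poly (coeff (nf w) 0)) + c" by (simp add: c_def w_def)
    moreover have "t - weyl_poly (coeff (nf w) 0) \<in> A" by (simp add: A_alg_diff t A_alg_poly)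
    ultimately show ?thesis unfolding A_plus_center_def by blast
  qed
  ultimately show ?thesis by blast
qed

lemma delta_inner:
  assumes "b \<in> A"
  shows "D_der h (delta h f) b = b * weyl_poly f - weyl_poly f * b"
proof -
  have "deriv_on A (\<lambda>b. (- weyl_poly f) * b - b * (- weyl_poly f))" by (rule deriv_on_ad)
  then have d: "deriv_on A (\<lambda>b. b * weyl_poly f - weyl_poly f * b)" by (simp add: algebra_simps)
  show ?thesis
  proof (rule deriv_on_A_alg_eqI[OF D_der_deriv_on d _ _ assms])
    show "D_der h (delta h f) weyl_x = weyl_x * weyl_poly f - weyl_poly f * weyl_x"
      using weyl_poly_commute[of "[:0, 1:]" f] by (simp add: D_der_x weyl_poly_x)
    have "yh * weyl_poly f = weyl_y * weyl_poly f * weyl_poly h"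
      by (simp only: mult.assoc weyl_poly_commute)
    also have "\<dots> = weyl_poly f * yh + weyl_poly (pderiv f * h)"
      unfolding weyl_y_poly[of f] by (simp only: distrib_right mult.assoc weyl_poly_mult)
    finally show "D_der h (delta h f) yh = yh * weyl_poly f - weyl_poly f * yh"
      by (simp add: D_der_yh delta_def)
  qed
qed

end

text \<open>These two properties are the interface to \<open>qb\<close>: the values of the pairing
  are the F[x^p]-multiples of its value at \<open>qb\<close>, which is nonzero. The gcd and the
  Bezout coefficients enter only when they are verified.\<close>

locale weyl_subalgebra_qb = weyl_subalgebra h for h :: "'k::field poly" +
  fixes qb :: "'k poly"
  assumes pairing_qb: "pairing qb \<noteq> 0"
    and pairing_generated: "\<And>s. \<exists>e\<in>Fxp. pairing s = e * pairing qb"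
begin

text \<open>The system is triangular. At x^p the first derivation vanishes and F does not, which
  gives v = 0; then z_h detects u through the nonzero pairing of \<open>qb\<close>.\<close>

lemma restriction_eq_0:
  assumes u: "u \<in> Z" and v: "v \<in> Z"
    and x: "u * D_der h qb (weyl_x ^ CHAR('k)) + v * F_breve h (weyl_x ^ CHAR('k)) = 0"
    and z: "u * D_der h qb (z_central h) + v * F_breve h (z_central h) = 0"
  shows "u = 0 \<and> v = 0"
proof -
  have comm: "u * a = a * u" "v * a = a * v" for a
    using u v by (simp_all add: center_mem center_commute)
  have "D_der h qb (weyl_x ^ CHAR('k)) = 0"
    using deriv_on_poly_eq_0[OF D_der_deriv_on subset_refl D_der_x, of qb "[:0, 1:] ^ CHAR('k)"]
    by (simp add: weyl_poly_power weyl_poly_x)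
  then have "weyl_poly (of_nat (fact (CHAR('k) - 1)) * q) * v = 0"
    using x by (simp add: F_breve_x_power comm)
  moreover have "of_nat (fact (CHAR('k) - 1)) * q \<noteq> 0"
    using fact_CHAR_neq_0[where 'a = "'k poly"] char q_neq_0 by simp
  ultimately have "v = 0" by (rule poly_mult_eq_0)
  with z have "weyl_poly (pairing qb) * u = 0" by (simp add: D_der_z_central comm)
  then have "u = 0" using pairing_qb by (rule poly_mult_eq_0)
  with \<open>v = 0\<close> show ?thesis by simp
qed

section \<open>Decomposition of an arbitrary derivation of A_h\<close>

lemma CHAR_poly_pos: "CHAR('k poly) > 0"
  using char by simp

lemma central_symbolI:
  assumes "\<And>n. \<not> CHAR('k) dvd n \<Longrightarrow> coeff (nf v) n = 0" "\<And>n. pderiv (coeff (nf v) n) = 0"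
    "\<And>n. h ^ n dvd coeff (nf v) n"
  shows "v \<in> Z"
proof -
  have "pderiv (nf v) = 0" using assms(1) by (simp add: pderiv_eq_0_iff_coeff)
  moreover have "coeff_deriv (nf v) = 0" by (rule poly_eqI) (simp add: assms(2))
  ultimately show ?thesis using assms(3) by (simp add: center_mem center_UNIV_iff_nf A_alg_iff)
qed

lemma power_multiple_Fxp: "CHAR('k) dvd n \<Longrightarrow> h ^ n \<in> Fxp"
  by (auto elim!: dvdE simp: power_mult intro!: Fxp_closed(8)[OF char Fxp_closed(9)[OF char]])

lemma correct_by_F_breve:
  assumes D: "D \<in> derivations A"
  obtains v where "v \<in> Z" "\<And>n. CHAR('k) dvd Suc n \<Longrightarrow> coeff (nf (D weyl_x - v * F_breve h weyl_x)) n
      = 0"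
proof -
  let ?f = "\<lambda>n. coeff (nf (D weyl_x)) n"
  have xp: "weyl_x ^ CHAR('k) \<in> Z"
    using Fxp_in_center[of "[:0, 1:] ^ CHAR('k)"] Fxp_closed(9)[OF char] by (simp add:
        weyl_poly_power weyl_poly_x)
  have "D (weyl_x ^ CHAR('k)) \<in> center UNIV"
    using derivations_center[OF D xp] by (simp add: center_mem)
  then have const: "pderiv (coeff (nf (D (weyl_x ^ CHAR('k)))) m) = 0" for m
    by (metis center_UNIV_iff_nf coeff_0 coeff_coeff_deriv)
  have f_Fxp: "pderiv (?f (m + (CHAR('k) - 1))) = 0" if m: "CHAR('k) dvd m" for m
  proof -
    have "coeff (nf (D (weyl_x ^ CHAR('k)))) m = of_nat (fact (CHAR('k) - 1)) * ?f (m + (CHAR('k)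
        - 1))"
      unfolding nf_deriv_x_power_CHAR[OF char derivations_deriv_on[OF D]]
      using coeff_higher_pderiv_CHAR[OF CHAR_poly_pos, of "nf (D weyl_x)" m] m by (simp only:
          semiring_char_poly if_True)
    then have "of_nat (fact (CHAR('k) - 1)) * pderiv (?f (m + (CHAR('k) - 1))) = 0"
      using const[of m] by (simp add: pderiv_mult)
    then show ?thesis
      using fact_CHAR_neq_0[OF CHAR_poly_pos] by (metis mult_eq_0_iff semiring_char_poly)
  qed
  \<comment> \<open>F(x) lives at y^(p-1) alone, so the coefficient of v at m answers for that of
    D(x) at m + p - 1. The equation is solvable in F[x^p]: dividing by h^m, which lies in F[x^p],
    leaves an element of F[x^p] divisible by h^(p-1), hence a multiple of \<open>q\<close>. The
    power h^m is kept in c so that v lies in A_h.\<close>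
  define Q where "Q m c \<longleftrightarrow> (if CHAR('k) dvd m then q * c = - ?f (m + (CHAR('k) - 1)) \<and> h ^ m dvd c
      \<and> pderiv c = 0 else c = 0)"
    for m c
  have "\<exists>c. Q m c" for m
  proof (cases "CHAR('k) dvd m")
    case True
    have "h ^ (m + (CHAR('k) - 1)) dvd ?f (m + (CHAR('k) - 1))"
      using derivations_mem[OF D A_alg_gen(1)] by (simp only: A_alg_iff)
    then obtain g where g: "?f (m + (CHAR('k) - 1)) = h ^ m * (h ^ (CHAR('k) - 1) * g)"
      by (metis dvdE mult.assoc power_add)
    have hm: "h ^ m \<in> Fxp" using True by (rule power_multiple_Fxp)
    have "h ^ m * (h ^ (CHAR('k) - 1) * g) \<in> Fxp"
      using f_Fxp[OF True] unfolding g Fxp_iff[OF char] .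
    then have "h ^ (CHAR('k) - 1) * g \<in> Fxp"
      using hm h by (rule Fxp_cofactor[OF char _ _ power_not_zero])
    then obtain c where c: "c \<in> Fxp" "h ^ (CHAR('k) - 1) * g = q * c"
      using Fxp_dvd_by_power[OF char h] by (metis dvd_triv_left)
    have "pderiv (h ^ m * c) = 0"
      using Fxp_closed(6)[OF char hm c(1)] by (simp only: Fxp_iff[OF char])
    moreover have "q * - (h ^ m * c) = - ?f (m + (CHAR('k) - 1))"
      unfolding g c(2) by (simp only: mult_minus_right mult.left_commute)
    ultimately have "Q m (- (h ^ m * c))"
      unfolding Q_def using True by (simp only: pderiv_minus) simp
    then show ?thesis ..
  qed (simp add: Q_def)
  moreover have "Q m 0" if "m > degree (nf (D weyl_x))" for m
    using that by (simp add: Q_def coeff_eq_0)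
  ultimately have "\<exists>v. \<forall>m. Q m (coeff (nf v) m)" by (rule symbol_choice)
  then obtain v where v: "\<And>m. Q m (coeff (nf v) m)" by blast
  have "v \<in> Z"
    by (rule central_symbolI) (metis Q_def v pderiv_0 dvd_0_right)+
  moreover have "coeff (nf (D weyl_x - v * F_breve h weyl_x)) n = 0" if n: "CHAR('k) dvd Suc n"
      for n
  proof -
    define m where "m = Suc n - CHAR('k)"
    have m: "n = m + (CHAR('k) - 1)" "CHAR('k) dvd m"
      using dvd_imp_le[OF n] char n by (simp_all add: m_def dvd_diff_nat)
    have "v * F_breve h weyl_x = - (weyl_poly q * (v * weyl_y ^ (CHAR('k) - 1)))"
      using center_commute[of v "weyl_poly q"] \<open>v \<in> Z\<close> by (simp add: F_breve_x center_mem flip: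
          mult.assoc)
    then have "coeff (nf (D weyl_x - v * F_breve h weyl_x)) n = ?f n + q * coeff (nf v) m"
      by (simp add: nf_diff nf_add nf_uminus nf_poly_mult nf_mult_y_power coeff_monom_mult m(1)
          del: One_nat_def)
    also have "\<dots> = 0" using v[of m] m by (simp add: Q_def)
    finally show ?thesis .
  qed
  ultimately show ?thesis by (rule that)
qed

lemma adjust_pairing: "\<exists>e\<in>Fxp. pairing (s - e * qb) = 0"
proof -
  obtain e where e: "e \<in> Fxp" "pairing s = e * pairing qb" using pairing_generated by blast
  have eq: "(s - e * qb) * h ^ (CHAR('k) - 1) = s * h ^ (CHAR('k) - 1) + (- e) * (qb * h ^
      (CHAR('k) - 1))"
    by (simp add: algebra_simps)
  have "pderiv (- e) = 0" using e(1) by (simp add: Fxp_iff[OF char] pderiv_minus)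
  then have "pairing (s - e * qb) = 0"
    unfolding eq higher_pderiv_add by (simp only: higher_pderiv_mult_const e(2)) simp
  with e(1) show ?thesis by blast
qed

text \<open>The part of \<open>D (y h)\<close> of positive degree in \<open>y\<^sup>p\<close> is the image of an inner derivation,
  because \<open>r \<in> \<Theta>\<close> means that \<open>r h\<^sup>p\<^sup>-\<^sup>1\<close> has an antiderivative \<open>g\<close>, whence
  \<open>h\<^sup>n r = \<delta> (h\<^sup>n\<^sup>-\<^sup>p g)\<close> for positive multiples \<open>n\<close> of \<open>p\<close>.\<close>

lemma decompose_centralizing:
  assumes b: "b * weyl_x = weyl_x * b" and dvd: "\<And>n. CHAR('k) dvd n \<Longrightarrow> h ^ n dvd coeff (nf b) n"
  obtains u r c where "u \<in> Z" "r \<in> Theta h" "c * weyl_x = weyl_x * c"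
    "b = u * weyl_poly qb + weyl_poly r + (c * yh - yh * c)"
proof -
  have b_zero: "coeff (nf b) n = 0" if "\<not> CHAR('k) dvd n" for n
    using b that by (simp add: commutes_x_iff_nf pderiv_eq_0_iff_coeff)
  \<comment> \<open>The quotient of the coefficient by h^n is split into an F[x^p]-multiple of
    \<open>qb\<close> and a remainder \<theta> in \<open>Theta h\<close>. The factor h^n stays with
    c, which puts u into A_h.\<close>
  define Q where "Q n c \<longleftrightarrow> (if CHAR('k) dvd n then h ^ n dvd c \<and> pderiv c = 0 \<and>
      (\<exists>\<theta>. coeff (nf b) n = c * qb + h ^ n * \<theta> \<and> pairing \<theta> = 0) else c = 0)" for n c
  have "\<exists>c. Q n c" for n
  proof (cases "CHAR('k) dvd n")
    case True
    obtain s where s: "coeff (nf b) n = h ^ n * s" using dvd[OF True] by (rule dvdE)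
    obtain e where e: "e \<in> Fxp" "pairing (s - e * qb) = 0" using adjust_pairing by blast
    have "h ^ n * e \<in> Fxp" using e(1) power_multiple_Fxp[OF True] Fxp_closed(6)[OF char] by blast
    moreover have "h ^ n * s = h ^ n * e * qb + h ^ n * (s - e * qb)" by (simp add: algebra_simps)
    ultimately have "Q n (h ^ n * e)"
      using True e(2) unfolding Q_def s by (auto simp only: Fxp_iff[OF char] if_True dvd_triv_left)
    then show ?thesis ..
  qed (simp add: Q_def)
  moreover have "Q n 0" if "n > degree (nf b)" for n
    using that by (auto simp: Q_def coeff_eq_0 intro!: exI[of _ 0])
  ultimately have "\<exists>u. \<forall>n. Q n (coeff (nf u) n)" by (rule symbol_choice)
  then obtain u where u: "\<And>n. Q n (coeff (nf u) n)" by blast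
  have uZ: "u \<in> Z"
    by (rule central_symbolI) (metis Q_def u pderiv_0 dvd_0_right)+
  define r where "r = coeff (nf b) 0 - coeff (nf u) 0 * qb"
  have "\<exists>\<theta>. coeff (nf b) 0 = coeff (nf u) 0 * qb + h ^ 0 * \<theta> \<and> pairing \<theta> = 0"
    using u[of 0] unfolding Q_def by simp
  then have r: "r \<in> Theta h" by (auto simp: Theta_iff r_def)
  define Q' where "Q' n g \<longleftrightarrow> (if n = 0 \<or> \<not> CHAR('k) dvd n then g = 0
      else h * pderiv g = coeff (nf u) n * qb - coeff (nf b) n)" for n g
  have "\<exists>g. Q' n g" for n
  proof (cases "n = 0 \<or> \<not> CHAR('k) dvd n")
    case False
    then have n: "CHAR('k) dvd n" "CHAR('k) \<le> n" by (auto dest: dvd_imp_le)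
    obtain \<theta> where \<theta>: "coeff (nf b) n = coeff (nf u) n * qb + h ^ n * \<theta>" "pairing \<theta> = 0"
      using u[of n] n(1) unfolding Q_def by auto
    obtain g where g: "pderiv g = \<theta> * h ^ (CHAR('k) - 1)"
      using higher_pderiv_eq_0_imp_pderiv[OF char \<theta>(2)] by blast
    have "CHAR('k) dvd n - CHAR('k)" using n(1) by (simp add: dvd_diff_nat)
    then have const: "pderiv (h ^ (n - CHAR('k))) = 0"
      using power_multiple_Fxp by (simp add: Fxp_iff[OF char])
    have "h * pderiv (h ^ (n - CHAR('k)) * g) = h ^ (n - CHAR('k)) * (h * h ^ (CHAR('k) - 1)) * \<theta>"
      by (simp add: pderiv_mult const g mult_ac del: One_nat_def)
    also have "\<dots> = h ^ n * \<theta>"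
      unfolding power_CHAR[OF char, symmetric] power_add[symmetric] using n(2) by simp
    finally have "Q' n (- (h ^ (n - CHAR('k)) * g))"
      using False \<theta>(1) by (simp add: Q'_def pderiv_minus)
    then show ?thesis ..
  qed (simp add: Q'_def)
  moreover have "Q' n 0" if "n > max (degree (nf u)) (degree (nf b))" for n
    using that by (simp add: Q'_def coeff_eq_0)
  ultimately have "\<exists>c. \<forall>n. Q' n (coeff (nf c) n)" by (rule symbol_choice)
  then obtain c where c: "\<And>n. Q' n (coeff (nf c) n)" by blast
  have c': "pderiv (nf c) = 0"
    using c by (auto simp: pderiv_eq_0_iff_coeff Q'_def)
  have "nf b = nf (u * weyl_poly qb + weyl_poly r + (c * yh - yh * c))"
  proof (rule poly_eqI)
    fix n
    have "u * weyl_poly qb = weyl_poly qb * u" using uZ by (intro center_commute) (simp add: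
        center_mem)
    then have "coeff (nf (u * weyl_poly qb + weyl_poly r + (c * yh - yh * c))) n
        = qb * coeff (nf u) n + coeff [:r:] n - h * pderiv (coeff (nf c) n)"
      using nf_commutator_yh[OF c', of h] by (simp add: nf_add nf_poly_mult nf_poly)
    also have "\<dots> = coeff (nf b) n"
    proof (cases "CHAR('k) dvd n")
      case True
      then show ?thesis using c[of n]
        by (cases "n = 0") (auto simp: Q'_def r_def coeff_pCons mult.commute split: nat.split)
    next
      case False
      then have "n \<noteq> 0" by (metis dvd_0_right)
      then show ?thesis using False b_zero c[of n] u[of n]
        by (auto simp: Q'_def Q_def coeff_pCons split: nat.split)
    qed
    finally show "coeff (nf b) n = coeff (nf (u * weyl_poly qb + weyl_poly r + (c * yh - yh * c)))
        n" ..
  qed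
  then have "b = u * weyl_poly qb + weyl_poly r + (c * yh - yh * c)" by simp
  moreover have "c * weyl_x = weyl_x * c" using c' by (simp add: commutes_x_iff_nf)
  ultimately show ?thesis using uZ r that by blast
qed

lemma derivation_decomposition:
  assumes D: "D \<in> derivations A"
  obtains u v r a where "u \<in> Z" "v \<in> Z" "r \<in> Theta h" "a \<in> normalizer_A h"
    "\<And>b. b \<in> A \<Longrightarrow> D b = u * D_der h qb b + v * F_breve h b + D_der h r b + (a * b - b * a)"
proof -
  obtain v where v: "v \<in> Z"
    and zero: "\<And>n. CHAR('k) dvd Suc n \<Longrightarrow> coeff (nf (D weyl_x - v * F_breve h weyl_x)) n = 0"
    using correct_by_F_breve[OF D] by blast
  have vU: "v \<in> center UNIV" "v \<in> A" using v by (simp_all add: center_mem)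
  define D1 where "D1 b = D b - v * F_breve h b" for b
  have D1: "deriv_on A D1"
    unfolding D1_def[abs_def]
    by (rule deriv_on_diff[OF derivations_deriv_on[OF D] deriv_on_scale[OF F_breve_deriv_on vU(1)]])
  have D1_mem: "D1 b \<in> A" if "b \<in> A" for b
    using that D F_breve_derivation vU by (simp add: D1_def A_alg_diff A_alg_mult derivations_mem)
  have D1x_dvd: "h ^ n dvd coeff (nf (D1 weyl_x)) n" for n
    using D1_mem[OF A_alg_gen(1)] by (simp add: A_alg_iff)
  obtain g where g: "pderiv g = nf (D1 weyl_x)" "coeff g 0 = 0" "\<And>n. coeff (nf (D1 weyl_x)) n dvd
      coeff g (Suc n)"
    using antiderivative[OF CHAR_poly_pos, of "nf (D1 weyl_x)"] zero by (auto simp: D1_def)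
  \<comment> \<open>A vanishing constant term means that the antiderivative is t times a symbol,
    which is the symbol of c y. So c has the coefficients of the antiderivative shifted down by one,
    and is in A_h since those of D1(x) divide them.\<close>
  obtain g' where g': "g = pCons 0 g'" using g(2) by (cases g) auto
  obtain c where c: "nf c = g'" using nf_surj by blast
  have nf_c: "coeff (nf (D1 weyl_x)) n dvd coeff (nf c) n" for n
    using g(3)[of n] by (simp add: g' c)
  have cA: "c \<in> A" using D1x_dvd nf_c dvd_trans by (metis A_alg_iff)
  have c_zero: "coeff (nf c) n = 0" if "CHAR('k) dvd Suc n" for n
    using nf_c[of n] zero[OF that] by (simp add: D1_def)
  define t where "t = c * weyl_y"
  have t_x: "t * weyl_x - weyl_x * t = D1 weyl_x"
    by (subst nf_eq_iff[symmetric]) (simp add: nf_commutator_x t_def nf_mult_y c g(1) flip: g')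
  define D2 where "D2 b = D1 b - (t * b - b * t)" for b
  have D2: "deriv_on A D2"
    unfolding D2_def[abs_def] by (rule deriv_on_diff[OF D1 deriv_on_ad])
  have D2x: "D2 weyl_x = 0" by (simp add: D2_def t_x)
  \<comment> \<open>Obtained by applying D2 to y h x = x y h + h, where D2 kills x and h.\<close>
  have D2_comm: "D2 yh * weyl_x = weyl_x * D2 yh"
  proof -
    have "yh * weyl_x = weyl_x * yh + weyl_poly h"
    proof -
      have "yh * weyl_x = weyl_y * weyl_x * weyl_poly h"
        using weyl_poly_commute[of "[:0, 1:]" h] by (simp add: weyl_poly_x mult.assoc)
      also have "weyl_y * weyl_x = weyl_x * weyl_y + (1 :: 'k weyl)"
        using weyl_relation[where 'k = 'k] by (simp add: diff_eq_eq add.commute)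
      finally show ?thesis by (simp add: distrib_right mult.assoc)
    qed
    then have "D2 (yh * weyl_x) = D2 (weyl_x * yh + weyl_poly h)" by simp
    then show ?thesis
      using deriv_on_poly_eq_0[OF D2 subset_refl D2x]
      by (simp add: deriv_onD[OF D2] A_alg_gen A_alg_mult A_alg_poly D2x)
  qed
  \<comment> \<open>D2(y h) need not be in A_h, as c y need not be. Divisibility at the multiples of
    p is all that can be claimed and all that the next decomposition asks for.\<close>
  have dvd: "h ^ n dvd coeff (nf (D2 yh)) n" if n: "CHAR('k) dvd n" for n
  proof -
    have "h ^ n dvd coeff (nf (D1 yh)) n" using D1_mem[OF A_alg_gen(2)] by (simp add: A_alg_iff)
    with commutator_coeff_dvd[OF cA c_zero n] show ?thesis
      unfolding D2_def t_def nf_diff[of "D1 yh"] coeff_diff by (rule dvd_diff[rotated])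
  qed
  obtain u r s where u: "u \<in> Z" "r \<in> Theta h" "s * weyl_x = weyl_x * s"
    and D2_yh: "D2 yh = u * weyl_poly qb + weyl_poly r + (s * yh - yh * s)"
    using decompose_centralizing[OF D2_comm dvd] by blast
  have uU: "u \<in> center UNIV" "u \<in> A" using u by (simp_all add: center_mem)
  define a where "a = t + s"
  have eq: "D b = u * D_der h qb b + v * F_breve h b + D_der h r b + (a * b - b * a)" if b: "b \<in>
      A" for b
  proof (rule deriv_on_A_alg_eqI[OF derivations_deriv_on[OF D] _ _ _ b])
    show "deriv_on A (\<lambda>b. u * D_der h qb b + v * F_breve h b + D_der h r b + (a * b - b * a))"
      by (intro deriv_on_add deriv_on_ad deriv_on_scale uU vU D_der_deriv_on F_breve_deriv_on)
    show "D weyl_x = u * D_der h qb weyl_x + v * F_breve h weyl_x + D_der h r weyl_x + (a * weyl_x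
        - weyl_x * a)"
      using t_x u(3) by (simp add: D_der_x a_def D1_def distrib_left distrib_right)
    have "D yh = v * F_breve h yh + (t * yh - yh * t) + D2 yh" by (simp add: D2_def D1_def)
    also have "\<dots> = u * weyl_poly qb + v * F_breve h yh + weyl_poly r + (a * yh - yh * a)"
      unfolding D2_yh a_def distrib_left distrib_right by simp
    finally show "D yh = u * D_der h qb yh + v * F_breve h yh + D_der h r yh + (a * yh - yh * a)"
      unfolding D_der_yh .
  qed
  \<comment> \<open>Neither t nor s is shown to normalize A_h on its own; the sum does, because
    every other term of the identity maps A_h to itself.\<close>
  have "a * b - b * a \<in> A" if b: "b \<in> A" for b
  proof -
    have "a * b - b * a = D b - u * D_der h qb b - v * F_breve h b - D_der h r b"
      using eq[OF b] by simp
    also have "\<dots> \<in> A"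
      using uU vU derivations_mem[OF _ b] D D_der_derivation F_breve_derivation
      by (simp add: A_alg_diff A_alg_mult)
    finally show ?thesis .
  qed
  then have "a \<in> normalizer_A h" by (simp add: normalizer_A_def)
  with u v eq that show ?thesis by blast
qed

end

section \<open>The derivations of A_h as a module over the centre, and the kernel of
  restriction\<close>

lemma Der_simps:
  "carrier (Der S) = derivations S" "\<zero>\<^bsub>Der S\<^esub> = (\<lambda>a\<in>S. 0)"
  "d \<oplus>\<^bsub>Der S\<^esub> e = (\<lambda>a\<in>S. d a + e a)" "z \<odot>\<^bsub>Der S\<^esub> d = (\<lambda>a\<in>S. z * d a)"
  by (simp_all add: Der_def)

lemma ring_on_simps:
  "carrier (ring_on S) = S" "\<zero>\<^bsub>ring_on S\<^esub> = 0" "\<one>\<^bsub>ring_on S\<^esub> = 1"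
  "a \<oplus>\<^bsub>ring_on S\<^esub> b = a + b" "a \<otimes>\<^bsub>ring_on S\<^esub> b = a * b"
  by (simp_all add: ring_on_def)

context weyl_subalgebra_qb
begin

abbreviation "ZR \<equiv> ring_on Z"
abbreviation "DA \<equiv> Der A"
abbreviation "ker_Res \<equiv> {d \<in> derivations A. \<forall>z\<in>Z. d z = 0}"

lemma ZA: "z \<in> Z \<Longrightarrow> z \<in> A" and ZU: "z \<in> Z \<Longrightarrow> z \<in> center UNIV"
  by (simp_all add: center_mem)

lemma cring_ZR: "cring ZR"
proof (rule cring_ring_on)
  have "1 \<in> center UNIV" "0 \<in> center UNIV" by (simp_all add: center_def)
  then show "0 \<in> Z" "1 \<in> Z" by (simp_all add: center_mem)
qed (auto simp: center_mem center_closed A_alg_add A_alg_mult A_alg_uminus intro: center_commute)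

lemma derivationsI: "deriv_on A d \<Longrightarrow> (\<And>a. a \<in> A \<Longrightarrow> d a \<in> A) \<Longrightarrow> restrict d A \<in> derivations A"
  by (simp add: derivations_iff deriv_on_A_restrict)

lemma module_DA: "module ZR DA"
proof (rule moduleI[OF cring_ZR])
  have add: "(\<lambda>a\<in>A. d a + e a) \<in> derivations A" if "d \<in> derivations A" "e \<in> derivations A" for d e
    using that by (intro derivationsI deriv_on_add) (auto simp: derivations_deriv_on
        derivations_mem A_alg_add)
  have scale: "(\<lambda>a\<in>A. z * d a) \<in> derivations A" if "z \<in> Z" "d \<in> derivations A" for z d
    using that by (intro derivationsI deriv_on_scale) (auto simp: derivations_deriv_on
        derivations_mem ZA ZU A_alg_mult)
  have zero: "(\<lambda>a\<in>A. 0) \<in> derivations A"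
    by (rule derivationsI) (simp_all add: deriv_on_def)
  show "abelian_group DA"
  proof (rule abelian_groupI)
    fix d assume d: "d \<in> carrier DA"
    then have "(\<lambda>a\<in>A. (- 1) * d a) \<in> derivations A"
      using cring.cring_simprules(3)[OF cring_ZR, of "\<one>\<^bsub>ZR\<^esub>"] cring.cring_simprules(6)[OF cring_ZR]
      by (intro scale) (auto simp: Der_simps ring_on_simps center_def A_alg_uminus)
    moreover have "(\<lambda>a\<in>A. (- 1) * d a) \<oplus>\<^bsub>DA\<^esub> d = \<zero>\<^bsub>DA\<^esub>"
      by (auto simp: Der_simps)
    ultimately show "\<exists>e\<in>carrier DA. e \<oplus>\<^bsub>DA\<^esub> d = \<zero>\<^bsub>DA\<^esub>"
      by (metis Der_simps(1))
    show "\<zero>\<^bsub>DA\<^esub> \<oplus>\<^bsub>DA\<^esub> d = d"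
      using derivations_ext[of d] d by (simp add: Der_simps restrict_def cong: if_cong)
  qed (auto simp: Der_simps add zero algebra_simps)
  show "z \<odot>\<^bsub>DA\<^esub> d \<in> carrier DA" if "z \<in> carrier ZR" "d \<in> carrier DA" for z d
    using scale that by (simp add: Der_simps ring_on_simps)
  show "\<one>\<^bsub>ZR\<^esub> \<odot>\<^bsub>DA\<^esub> d = d" if "d \<in> carrier DA" for d
    using derivations_ext[of d] that by (simp add: Der_simps ring_on_simps)
qed (auto simp: Der_simps ring_on_simps distrib_left distrib_right mult.assoc)

interpretation DA: module ZR DA by (rule module_DA)

lemma ad_derivation: "a \<in> normalizer_A h \<Longrightarrow> ad A a \<in> derivations A"
  unfolding ad_def by (rule derivationsI) (auto simp: deriv_on_ad normalizer_A_def)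

lemma A_normalizer: "a \<in> A \<Longrightarrow> a \<in> normalizer_A h"
  by (simp add: normalizer_A_def A_alg_diff A_alg_mult)

lemma ad_add: "ad A (a + b) = ad A a \<oplus>\<^bsub>DA\<^esub> ad A b"
  by (auto simp: ad_def Der_simps algebra_simps)

lemma ad_scale: "z \<in> Z \<Longrightarrow> ad A (z * a) = z \<odot>\<^bsub>DA\<^esub> ad A a"
proof -
  assume "z \<in> Z"
  then have "b * (z * a) = z * (b * a)" for b
    by (metis ZU center_commute mult.assoc)
  then show ?thesis by (auto simp: ad_def Der_simps right_diff_distrib mult.assoc)
qed

lemma ad_0: "ad A 0 = \<zero>\<^bsub>DA\<^esub>"
  by (simp add: ad_def Der_simps)

lemma ad_center_eq_0: "z \<in> Z \<Longrightarrow> ad A a z = 0"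
  using center_commute[OF ZU, of z a] by (simp add: ad_def ZA)

lemma Inder_submodule: "submodule (Inder A) ZR DA"
proof (rule submoduleI'[OF module_DA])
  show "Inder A \<subseteq> carrier DA" by (auto simp: Inder_def Der_simps ad_derivation A_normalizer)
  show "\<zero>\<^bsub>DA\<^esub> \<in> Inder A" unfolding Inder_def ad_0[symmetric] by (rule imageI) simp
  fix d e assume "d \<in> Inder A" "e \<in> Inder A"
  then obtain s t where "s \<in> A" "t \<in> A" "d = ad A s" "e = ad A t" by (auto simp: Inder_def)
  then show "d \<oplus>\<^bsub>DA\<^esub> e \<in> Inder A" by (simp add: Inder_def ad_add[symmetric] A_alg_add)
next
  fix z d assume "z \<in> carrier ZR" "d \<in> Inder A"
  then obtain t where "z \<in> Z" "t \<in> A" "d = ad A t" by (auto simp: Inder_def ring_on_simps)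
  then show "z \<odot>\<^bsub>DA\<^esub> d \<in> Inder A" by (simp add: Inder_def ad_scale[symmetric] A_alg_mult ZA)
qed

lemma ker_Res_submodule: "submodule ker_Res ZR DA"
proof (rule submoduleI'[OF module_DA])
  show "\<zero>\<^bsub>DA\<^esub> \<in> ker_Res" using DA.zero_closed by (auto simp: Der_simps(1,2) ZA)
  fix d e assume "d \<in> ker_Res" "e \<in> ker_Res"
  then show "d \<oplus>\<^bsub>DA\<^esub> e \<in> ker_Res"
    using DA.M.add.m_closed[of d e] by (auto simp: Der_simps(1,3) ZA)
next
  fix z d assume "z \<in> carrier ZR" "d \<in> ker_Res"
  then show "z \<odot>\<^bsub>DA\<^esub> d \<in> ker_Res"
    using DA.smult_closed[of z d] by (auto simp: Der_simps(1,4) ZA)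
qed (auto simp: Der_simps)

lemma Inder_ker_Res: "Inder A \<subseteq> ker_Res"
  by (auto simp: Inder_def ad_derivation A_normalizer ad_center_eq_0)

lemma Theta_ker_Res: "r \<in> Theta h \<Longrightarrow> D_der h r \<in> ker_Res"
proof -
  assume "r \<in> Theta h"
  then have eq: "Res A (D_der h r) = (\<lambda>a\<in>Z. 0)" by (simp add: Theta_def Der_simps)
  have "D_der h r z = 0" if "z \<in> Z" for z
    using fun_cong[OF eq, of z] that by (simp add: Res_def)
  then show ?thesis by (simp add: D_der_derivation)
qed

lemma ad_ker_Res: "a \<in> normalizer_A h \<Longrightarrow> ad A a \<in> ker_Res"
  by (simp add: ad_derivation ad_center_eq_0)

lemma x_power_in_Z: "weyl_x ^ CHAR('k) \<in> Z"
  using Fxp_in_center[of "[:0, 1:] ^ CHAR('k)"] Fxp_closed(9)[OF char] by (simp add: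
      weyl_poly_power weyl_poly_x)

lemma independent:
  assumes "u \<in> Z" "v \<in> Z" "(u \<odot>\<^bsub>DA\<^esub> D_der h qb) \<oplus>\<^bsub>DA\<^esub> (v \<odot>\<^bsub>DA\<^esub> F_breve h) \<in> ker_Res"
  shows "u = 0 \<and> v = 0"
proof (rule restriction_eq_0[OF assms(1,2)])
  have "u * D_der h qb z + v * F_breve h z = 0" if "z \<in> Z" for z
    using assms(3) that ZA[OF that] by (auto simp: Der_simps(3,4))
  then show "u * D_der h qb (weyl_x ^ CHAR('k)) + v * F_breve h (weyl_x ^ CHAR('k)) = 0"
    "u * D_der h qb (z_central h) + v * F_breve h (z_central h) = 0"
    using x_power_in_Z z_central_in_center by blast+
qed

lemma decomposition_DA:
  assumes "D \<in> derivations A"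
  obtains u v r a where "u \<in> Z" "v \<in> Z" "r \<in> Theta h" "a \<in> normalizer_A h"
    "D = (u \<odot>\<^bsub>DA\<^esub> D_der h qb) \<oplus>\<^bsub>DA\<^esub> (v \<odot>\<^bsub>DA\<^esub> F_breve h) \<oplus>\<^bsub>DA\<^esub> (D_der h r \<oplus>\<^bsub>DA\<^esub> ad A a)"
proof -
  obtain u v r a where *: "u \<in> Z" "v \<in> Z" "r \<in> Theta h" "a \<in> normalizer_A h"
    "\<And>b. b \<in> A \<Longrightarrow> D b = u * D_der h qb b + v * F_breve h b + D_der h r b + (a * b - b * a)"
    using derivation_decomposition[OF assms] by blast
  have "D = (u \<odot>\<^bsub>DA\<^esub> D_der h qb) \<oplus>\<^bsub>DA\<^esub> (v \<odot>\<^bsub>DA\<^esub> F_breve h) \<oplus>\<^bsub>DA\<^esub> (D_der h r \<oplus>\<^bsub>DA\<^esub> ad A a)"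
    unfolding Der_simps ad_def
    by (subst derivations_ext[OF assms, symmetric]) (auto simp: *(5) add.assoc)
  with * that show ?thesis by blast
qed

lemma ker_Res_mem:
  "r \<in> Theta h \<Longrightarrow> a \<in> normalizer_A h \<Longrightarrow> D_der h r \<oplus>\<^bsub>DA\<^esub> ad A a \<in> ker_Res"
  using DA.submoduleE(5)[OF ker_Res_submodule Theta_ker_Res ad_ker_Res] .

text \<open>The last two terms of the decomposition vanish on the centre, so the first two do so
  together, and independence makes them zero.\<close>

lemma ker_Res_obtain:
  assumes d: "d \<in> ker_Res"
  obtains r a where "r \<in> Theta h" "a \<in> normalizer_A h" "d = D_der h r \<oplus>\<^bsub>DA\<^esub> ad A a"
proof -
  have "d \<in> derivations A" using d by simp
  then obtain u v r a where *: "u \<in> Z" "v \<in> Z" "r \<in> Theta h" "a \<in> normalizer_A h"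
    and eq: "d = (u \<odot>\<^bsub>DA\<^esub> D_der h qb) \<oplus>\<^bsub>DA\<^esub> (v \<odot>\<^bsub>DA\<^esub> F_breve h) \<oplus>\<^bsub>DA\<^esub> (D_der h r \<oplus>\<^bsub>DA\<^esub> ad A a)"
    by (rule decomposition_DA)
  let ?w = "(u \<odot>\<^bsub>DA\<^esub> D_der h qb) \<oplus>\<^bsub>DA\<^esub> (v \<odot>\<^bsub>DA\<^esub> F_breve h)" and ?k = "D_der h r \<oplus>\<^bsub>DA\<^esub> ad A a"
  have k: "?k \<in> ker_Res" using * ker_Res_mem by blast
  have mem: "D_der h qb \<in> carrier DA" "F_breve h \<in> carrier DA" "?k \<in> carrier DA" "?w \<in> carrier DA"
    using k * DA.smult_closed[of u "D_der h qb"] DA.smult_closed[of v "F_breve h"] DA.M.add.m_closed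
    by (auto simp: Der_simps(1) D_der_derivation F_breve_derivation ring_on_simps)
  have "?w = d \<oplus>\<^bsub>DA\<^esub> \<ominus>\<^bsub>DA\<^esub> ?k"
    using mem unfolding eq by (simp add: DA.M.a_assoc DA.M.r_neg)
  also have "\<dots> \<in> ker_Res"
    by (rule DA.submoduleE(5)[OF ker_Res_submodule d DA.submoduleE(3)[OF ker_Res_submodule k]])
  finally have "u = 0 \<and> v = 0" using independent * by blast
  then have "?w = \<zero>\<^bsub>DA\<^esub>"
    using mem DA.smult_l_null by (simp add: ring_on_simps)
  then have "d = ?k" using mem unfolding eq by simp
  with * that show ?thesis by blast
qed

text \<open>Inner derivations vanish on the centre, so restriction is constant on a coset and
  \<open>the_elem\<close> is applied to a singleton.\<close>

lemma Res_bar_coset: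
  assumes d: "d \<in> derivations A"
  shows "Res_bar A (Inder A +>\<^bsub>DA\<^esub> d) = Res A d"
proof -
  have "Res A e = Res A d" if e: "e \<in> Inder A +>\<^bsub>DA\<^esub> d" for e
  proof -
    obtain n where n: "n \<in> Inder A" "e = n \<oplus>\<^bsub>DA\<^esub> d"
      using e unfolding quot_coset_mem[OF module_DA Inder_submodule] by blast
    then have "n z = 0" if "z \<in> Z" for z using Inder_ker_Res that by blast
    then show ?thesis using n by (auto simp: Res_def Der_simps ZA)
  qed
  moreover have "\<zero>\<^bsub>DA\<^esub> \<oplus>\<^bsub>DA\<^esub> d \<in> Inder A +>\<^bsub>DA\<^esub> d"
    using quot_coset_mem[OF module_DA Inder_submodule] DA.submoduleE(2)[OF Inder_submodule]
      subgroup.one_closed[OF submodule.axioms(1)[OF Inder_submodule]] by auto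
  ultimately have "Res A ` (Inder A +>\<^bsub>DA\<^esub> d) = {Res A d}"
    using image_cong[OF refl, of "Inder A +>\<^bsub>DA\<^esub> d" "Res A" "\<lambda>_. Res A d"] image_constant by metis
  then show ?thesis by (simp add: Res_bar_def)
qed

lemma ker_Res_bar_eq: "ker_Res_bar A = (quot_module DA (Inder A))\<lparr>carrier := a_r_coset DA (Inder
    A) ` ker_Res\<rparr>"
proof -
  have "Res A d = (\<lambda>a\<in>Z. 0) \<longleftrightarrow> (\<forall>z\<in>Z. d z = 0)" for d
    by (auto simp: Res_def restrict_def fun_eq_iff)
  then have "{C \<in> carrier (HH1 A). Res_bar A C = \<zero>\<^bsub>Der Z\<^esub>} = a_r_coset DA (Inder A) ` ker_Res"
    using Res_bar_coset by (auto simp: HH1_def carrier_quot_module Der_simps)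
  then show ?thesis by (simp add: ker_Res_bar_def HH1_def)
qed

lemma set_add_ker_Res: "D_der h ` Theta h <+>\<^bsub>DA\<^esub> ad A ` normalizer_A h = ker_Res"
proof
  show "D_der h ` Theta h <+>\<^bsub>DA\<^esub> ad A ` normalizer_A h \<subseteq> ker_Res"
    using ker_Res_mem by (auto simp: set_add_def' simp del: mem_Collect_eq)
  show "ker_Res \<subseteq> D_der h ` Theta h <+>\<^bsub>DA\<^esub> ad A ` normalizer_A h"
  proof
    fix d assume "d \<in> ker_Res"
    then obtain r a where "r \<in> Theta h" "a \<in> normalizer_A h" "d = D_der h r \<oplus>\<^bsub>DA\<^esub> ad A a"
      by (rule ker_Res_obtain)
    then show "d \<in> D_der h ` Theta h <+>\<^bsub>DA\<^esub> ad A ` normalizer_A h"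
      by (auto simp: set_add_def')
  qed
qed

lemma D_der_delta: "D_der h (delta h f) = ad A (- weyl_poly f)"
  using delta_inner[of _ f]
  by (subst derivations_ext[OF D_der_derivation, symmetric]) (auto simp: ad_def)

text \<open>The first summand is already inner, \<open>D_der h (delta h f)\<close> being minus the
  commutator with f; f = 0 gives the other inclusion.\<close>

lemma set_add_Inder: "D_der h ` range (delta h) <+>\<^bsub>DA\<^esub> ad A ` A = Inder A"
proof
  show "D_der h ` range (delta h) <+>\<^bsub>DA\<^esub> ad A ` A \<subseteq> Inder A"
    by (auto simp: set_add_def' D_der_delta ad_add[symmetric] Inder_def intro!: imageI A_alg_diff
        A_alg_poly)
  have "ad A a = D_der h (delta h 0) \<oplus>\<^bsub>DA\<^esub> ad A a" for a
    unfolding D_der_delta ad_add[symmetric] by simp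
  then show "Inder A \<subseteq> D_der h ` range (delta h) <+>\<^bsub>DA\<^esub> ad A ` A"
    unfolding Inder_def set_add_def' by blast
qed

lemma inner_iff:
  assumes "r \<in> Theta h" "a \<in> normalizer_A h" "D_der h r \<oplus>\<^bsub>DA\<^esub> ad A a \<in> Inder A"
  shows "r \<in> range (delta h) \<and> a \<in> A_plus_center h"
proof -
  obtain t where t: "t \<in> A" "D_der h r \<oplus>\<^bsub>DA\<^esub> ad A a = ad A t" using assms(3) by (auto simp:
      Inder_def)
  have "D_der h r b + (a * b - b * a) = t * b - b * t" if "b \<in> A" for b
    using fun_cong[OF t(2), of b] that by (simp add: Der_simps ad_def)
  then show ?thesis using inner_D_der t(1) by blast
qed

text \<open>An inner derivation and the last two terms vanish on the centre, which isolates u and v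
  there. Once both are zero, only the part inside the kernel of restriction remains, and
  \<open>inner_iff\<close> treats it.\<close>

lemma inner_imp_trivial:
  assumes u: "u \<in> Z" and v: "v \<in> Z" and r: "r \<in> Theta h" and a: "a \<in> normalizer_A h"
    and inner: "(u \<odot>\<^bsub>DA\<^esub> D_der h qb) \<oplus>\<^bsub>DA\<^esub> (v \<odot>\<^bsub>DA\<^esub> F_breve h) \<oplus>\<^bsub>DA\<^esub> D_der h r \<oplus>\<^bsub>DA\<^esub> ad A a \<in>
        Inder A"
  shows "u = 0 \<and> v = 0 \<and> r \<in> range (delta h) \<and> a \<in> A_plus_center h"
proof -
  let ?w = "(u \<odot>\<^bsub>DA\<^esub> D_der h qb) \<oplus>\<^bsub>DA\<^esub> (v \<odot>\<^bsub>DA\<^esub> F_breve h)" and ?k = "D_der h r \<oplus>\<^bsub>DA\<^esub> ad A a"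
  have k: "?k \<in> ker_Res" using ker_Res_mem r a .
  have mem: "D_der h qb \<in> carrier DA" "F_breve h \<in> carrier DA" "?k \<in> carrier DA" "?w \<in> carrier DA"
      "D_der h r \<in> carrier DA" "ad A a \<in> carrier DA"
    using k u v a DA.smult_closed[of u "D_der h qb"] DA.smult_closed[of v "F_breve h"]
        DA.M.add.m_closed
    by (auto simp: Der_simps(1) D_der_derivation F_breve_derivation ring_on_simps ad_derivation)
  have wk: "?w \<oplus>\<^bsub>DA\<^esub> ?k \<in> Inder A" using inner mem by (simp add: DA.M.a_assoc)
  have "?w = (?w \<oplus>\<^bsub>DA\<^esub> ?k) \<oplus>\<^bsub>DA\<^esub> \<ominus>\<^bsub>DA\<^esub> ?k"
    using mem by (simp add: DA.M.a_assoc DA.M.r_neg)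
  also have "\<dots> \<in> ker_Res"
    by (rule DA.submoduleE(5)[OF ker_Res_submodule subsetD[OF Inder_ker_Res wk]
          DA.submoduleE(3)[OF ker_Res_submodule k]])
  finally have uv: "u = 0 \<and> v = 0" using independent u v by blast
  then have "?w = \<zero>\<^bsub>DA\<^esub>"
    using mem DA.smult_l_null by (simp add: ring_on_simps)
  then have "?k \<in> Inder A" using wk mem by simp
  with inner_iff[OF r a] uv show ?thesis by blast
qed

section \<open>The module isomorphisms for HH^1 and for the kernel of the induced
  restriction\<close>

lemma HH1_decomposition:
  "(\<lambda>(d, e, C). (Inder A +>\<^bsub>DA\<^esub> (d \<oplus>\<^bsub>DA\<^esub> e)) \<oplus>\<^bsub>HH1 A\<^esub> C)
    \<in> module_iso ZR (direct_sum (DA\<lparr>carrier := (\<lambda>u. u \<odot>\<^bsub>DA\<^esub> D_der h qb) ` Z\<rparr>)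
        (direct_sum (DA\<lparr>carrier := (\<lambda>v. v \<odot>\<^bsub>DA\<^esub> F_breve h) ` Z\<rparr>) (ker_Res_bar A))) (HH1 A)"
  unfolding ker_Res_bar_eq unfolding HH1_def
proof (rule direct_sum_quot_iso[OF module_DA Inder_submodule _ _ ker_Res_submodule Inder_ker_Res])
  show "submodule ((\<lambda>u. u \<odot>\<^bsub>DA\<^esub> D_der h qb) ` Z) ZR DA"
    using cyclic_submodule[OF module_DA, of "D_der h qb"] by (simp add: ring_on_simps Der_simps(1)
        D_der_derivation)
  show "submodule ((\<lambda>v. v \<odot>\<^bsub>DA\<^esub> F_breve h) ` Z) ZR DA"
    using cyclic_submodule[OF module_DA, of "F_breve h"] by (simp add: ring_on_simps Der_simps(1)
        F_breve_derivation)
  show "\<exists>u\<in>(\<lambda>u. u \<odot>\<^bsub>DA\<^esub> D_der h qb) ` Z. \<exists>v\<in>(\<lambda>v. v \<odot>\<^bsub>DA\<^esub> F_breve h) ` Z. \<exists>k\<in>ker_Res.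
      m = u \<oplus>\<^bsub>DA\<^esub> v \<oplus>\<^bsub>DA\<^esub> k" if "m \<in> carrier DA" for m
  proof -
    have "m \<in> derivations A" using that by (simp add: Der_simps(1))
    then obtain u v r a where *: "u \<in> Z" "v \<in> Z" "r \<in> Theta h" "a \<in> normalizer_A h"
      "m = (u \<odot>\<^bsub>DA\<^esub> D_der h qb) \<oplus>\<^bsub>DA\<^esub> (v \<odot>\<^bsub>DA\<^esub> F_breve h) \<oplus>\<^bsub>DA\<^esub> (D_der h r \<oplus>\<^bsub>DA\<^esub> ad A a)"
      by (rule decomposition_DA)
    with ker_Res_mem[OF *(3,4)] show ?thesis by blast
  qed
  show "u = \<zero>\<^bsub>DA\<^esub> \<and> v = \<zero>\<^bsub>DA\<^esub>"
    if uv: "u \<in> (\<lambda>u. u \<odot>\<^bsub>DA\<^esub> D_der h qb) ` Z" "v \<in> (\<lambda>v. v \<odot>\<^bsub>DA\<^esub> F_breve h) ` Z" "u \<oplus>\<^bsub>DA\<^esub> v \<in>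
        ker_Res" for u v
  proof -
    obtain u' v' where *: "u' \<in> Z" "v' \<in> Z" "u = u' \<odot>\<^bsub>DA\<^esub> D_der h qb" "v = v' \<odot>\<^bsub>DA\<^esub> F_breve h"
      using uv(1,2) by blast
    then have "u' = 0 \<and> v' = 0" using independent uv(3) by simp
    then show ?thesis
      using * DA.smult_l_null by (simp add: ring_on_simps Der_simps(1) D_der_derivation
          F_breve_derivation)
  qed
qed

lemma ker_Res_bar_quotient:
  "ker_Res_bar A = quot_module (DA\<lparr>carrier := D_der h ` Theta h <+>\<^bsub>DA\<^esub> ad A ` normalizer_A h\<rparr>)
     (D_der h ` range (delta h) <+>\<^bsub>DA\<^esub> ad A ` A)"
  unfolding set_add_ker_Res set_add_Inder quot_module_restrict_carrier by (rule ker_Res_bar_eq)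

lemma D_der_add: "D_der h (r + s) = D_der h r \<oplus>\<^bsub>DA\<^esub> D_der h s"
proof (rule D_der_eqI[symmetric])
  show "D_der h r \<oplus>\<^bsub>DA\<^esub> D_der h s \<in> derivations A"
    using DA.M.add.m_closed[of "D_der h r" "D_der h s"] by (simp add: Der_simps(1) D_der_derivation)
qed (simp_all add: Der_simps A_alg_gen D_der_x D_der_yh weyl_poly_add)

lemma D_der_scale: "c \<in> Fxp \<Longrightarrow> D_der h (c * r) = weyl_poly c \<odot>\<^bsub>DA\<^esub> D_der h r"
proof (rule D_der_eqI[symmetric])
  assume "c \<in> Fxp"
  then show "weyl_poly c \<odot>\<^bsub>DA\<^esub> D_der h r \<in> derivations A"
    using DA.smult_closed[of "weyl_poly c" "D_der h r"] Fxp_in_center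
    by (simp add: Der_simps(1) D_der_derivation ring_on_simps)
qed (simp_all add: Der_simps A_alg_gen D_der_x D_der_yh weyl_poly_mult)

lemma cring_Fxp: "cring (ring_on (Fxp :: 'k poly set))"
  by (rule cring_ring_on) (auto simp: Fxp_closed[OF char] mult.commute)

lemma Theta_closed:
  "0 \<in> Theta h" "r \<in> Theta h \<Longrightarrow> s \<in> Theta h \<Longrightarrow> r + s \<in> Theta h" "r \<in> Theta h \<Longrightarrow> - r \<in> Theta h"
  "c \<in> Fxp \<Longrightarrow> r \<in> Theta h \<Longrightarrow> c * r \<in> Theta h"
proof -
  show *: "c * r \<in> Theta h" if "c \<in> Fxp" "r \<in> Theta h" for c r
    using that higher_pderiv_mult_const[of c "CHAR('k) - 1" "r * h ^ (CHAR('k) - 1)"]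
    by (simp add: Theta_iff Fxp_iff[OF char] mult.assoc)
  have "- r = [:- 1:] * r" by simp
  then show "r \<in> Theta h \<Longrightarrow> - r \<in> Theta h" using *[of "[:- 1:]" r] Fxp_closed(3)[OF char] by metis
qed (simp_all add: Theta_iff distrib_right higher_pderiv_add)

lemma delta_Theta: "delta h f \<in> Theta h"
proof -
  have "\<forall>z\<in>Z. D_der h (delta h f) z = 0" unfolding D_der_delta by (simp add: ad_center_eq_0)
  then show ?thesis by (auto simp: Theta_def Res_def Der_simps restrict_def fun_eq_iff)
qed

lemma normalizer_closed:
  "0 \<in> normalizer_A h" "a \<in> normalizer_A h \<Longrightarrow> b \<in> normalizer_A h \<Longrightarrow> a + b \<in> normalizer_A h"
  "a \<in> normalizer_A h \<Longrightarrow> - a \<in> normalizer_A h" "z \<in> Z \<Longrightarrow> a \<in> normalizer_A h \<Longrightarrow> z * a \<in> normalizer_A h"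
proof -
  show "z * a \<in> normalizer_A h" if z: "z \<in> Z" and a: "a \<in> normalizer_A h"
  proof -
    have "c * (z * a) = z * (c * a)" for c
      using z by (metis ZU center_commute mult.assoc)
    then have "z * a * c - c * (z * a) = z * (a * c - c * a)" for c
      by (simp add: right_diff_distrib mult.assoc)
    then show ?thesis using a A_alg_mult[OF ZA[OF z]] by (simp add: normalizer_A_def)
  qed
  show "a + b \<in> normalizer_A h" if "a \<in> normalizer_A h" "b \<in> normalizer_A h"
  proof -
    have "(a + b) * c - c * (a + b) = (a * c - c * a) + (b * c - c * b)" for c
      by (simp add: algebra_simps)
    then show ?thesis using that by (simp add: normalizer_A_def A_alg_add)
  qed
  show "- a \<in> normalizer_A h" if "a \<in> normalizer_A h"
  proof -
    have "- a * c - c * - a \<in> A" if "c \<in> A" for c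
      using A_alg_uminus[of "a * c - c * a" h] \<open>a \<in> normalizer_A h\<close> that by (simp add:
          normalizer_A_def)
    then show ?thesis by (simp add: normalizer_A_def)
  qed
qed (simp add: normalizer_A_def)

lemma A_plus_center_ad:
  assumes "a \<in> A_plus_center h"
  shows "ad A a \<in> Inder A"
proof -
  obtain t z where "t \<in> A" "z \<in> center UNIV" "a = t + z" using assms by (auto simp:
      A_plus_center_def)
  then have "ad A a = ad A t"
    using center_commute[of z] by (auto simp: ad_def algebra_simps)
  then show ?thesis using \<open>t \<in> A\<close> by (simp add: Inder_def)
qed

lemma A_plus_center_closed:
  "0 \<in> A_plus_center h" "a \<in> A_plus_center h \<Longrightarrow> b \<in> A_plus_center h \<Longrightarrow> a + b \<in> A_plus_center h"
  "a \<in> A_plus_center h \<Longrightarrow> - a \<in> A_plus_center h" "z \<in> Z \<Longrightarrow> a \<in> A_plus_center h \<Longrightarrow> z * a \<in>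
      A_plus_center h"
  "a \<in> A_plus_center h \<Longrightarrow> a \<in> normalizer_A h"
proof -
  have mem: "t + z \<in> A_plus_center h" if "t \<in> A" "z \<in> center UNIV" for t z
    using that by (auto simp: A_plus_center_def)
  have "0 \<in> center UNIV" by (simp add: center_def)
  from mem[OF A_alg_0 this] show "0 \<in> A_plus_center h" by simp
  {
    assume "a \<in> A_plus_center h"
    then obtain t y where a: "t \<in> A" "y \<in> center UNIV" "a = t + y" by (auto simp: A_plus_center_def)
    have "- a = - t + - y" by (simp add: a)
    then show "- a \<in> A_plus_center h" using mem a A_alg_uminus center_closed by metis
    have "a * c - c * a = t * c - c * t" for c
      using center_commute[OF a(2), of c] by (simp add: a algebra_simps)
    then show "a \<in> normalizer_A h" using a(1) by (simp add: normalizer_A_def A_alg_diff A_alg_mult)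
    {
      assume "b \<in> A_plus_center h"
      then obtain s y' where b: "s \<in> A" "y' \<in> center UNIV" "b = s + y'" by (auto simp:
          A_plus_center_def)
      have "a + b = (t + s) + (y + y')" by (simp add: a b)
      then show "a + b \<in> A_plus_center h" using mem a b A_alg_add center_closed by metis
    }
    assume "z \<in> Z"
    have "z * a = z * t + z * y" by (simp add: a distrib_left)
    then show "z * a \<in> A_plus_center h" using mem a A_alg_mult center_closed ZA ZU \<open>z \<in> Z\<close> by metis
  }
qed

text \<open>Scalars are restricted to F[x^p] because \<open>Theta h\<close> consists of polynomials
  in x: multiplication by z_h leaves them, whereas for c in F[x^p] the derivation of c r is c times
  that of r. The sum of the two maps to cosets has the expected kernel by \<open>inner_iff\<close>
  and is onto by \<open>ker_Res_obtain\<close>.\<close>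

lemma ker_Res_bar_direct_sum:
  "\<exists>\<phi> \<in> module_iso (ring_on Fxp)
      (direct_sum (quot_module (module_on (Theta h) (*)) (range (delta h)))
        (quot_module (module_on (normalizer_A h) (\<lambda>c a. weyl_poly c * a)) (A_plus_center h)))
      (restrict_scalars weyl_poly (ker_Res_bar A)).
    \<forall>r\<in>Theta h. \<forall>a\<in>normalizer_A h.
      \<phi> (range (delta h) +>\<^bsub>module_on (Theta h) (*)\<^esub> r,
         A_plus_center h +>\<^bsub>module_on (normalizer_A h) (\<lambda>c a. weyl_poly c * a)\<^esub> a)
      = Inder A +>\<^bsub>DA\<^esub> (D_der h r \<oplus>\<^bsub>DA\<^esub> ad A a)"
proof -
  let ?M1 = "module_on (Theta h) (*)" and ?M2 = "module_on (normalizer_A h) (\<lambda>c a. weyl_poly c * a)"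
  let ?Q = "quot_module DA (Inder A)" and ?S = "ring_on (Fxp :: 'k poly set)"
  let ?P = "restrict_scalars weyl_poly (ker_Res_bar A)"
  note Q = quot_module_module[OF module_DA Inder_submodule]
  note add = quot_add[OF module_DA Inder_submodule] and smult = quot_smult[OF module_DA
      Inder_submodule]
  have FZ: "c \<in> carrier ?S \<Longrightarrow> weyl_poly c \<in> Z" for c :: "'k poly" by (simp add: ring_on_simps
      Fxp_in_center)
  have M1: "module ?S ?M1"
    by (rule module_on_module[OF cring_Fxp]) (auto simp: ring_on_simps Theta_closed algebra_simps)
  have M2: "module ?S ?M2"
    by (rule module_on_module[OF cring_Fxp])
      (auto simp: normalizer_closed FZ, auto simp: ring_on_simps weyl_poly_add weyl_poly_mult
          algebra_simps)
  have N1: "submodule (range (delta h)) ?S ?M1"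
  proof (rule module_on_submodule[OF M1])
    have eqs: "delta h f + delta h g = delta h (f + g)" "- delta h f = delta h (- f)" "0 = delta h
        0" for f g
      by (simp_all add: delta_def pderiv_add pderiv_minus distrib_right)
    show "0 \<in> range (delta h)" by (subst eqs(3)) (rule rangeI)
    show "a \<in> range (delta h) \<Longrightarrow> b \<in> range (delta h) \<Longrightarrow> a + b \<in> range (delta h)"
      "a \<in> range (delta h) \<Longrightarrow> - a \<in> range (delta h)" for a b by (auto simp: eqs(1,2))
    show "c * a \<in> range (delta h)" if c: "c \<in> carrier ?S" and a: "a \<in> range (delta h)" for c a
    proof -
      obtain f where "a = delta h f" using a by blast
      then have "c * a = delta h (c * f)"
        using c by (simp add: ring_on_simps Fxp_iff[OF char] delta_def pderiv_mult mult.assoc)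
      then show ?thesis by simp
    qed
  qed (auto simp: delta_Theta)
  have N2: "submodule (A_plus_center h) ?S ?M2"
    by (rule module_on_submodule[OF M2]) (auto simp: A_plus_center_closed FZ)
  have kerP: "module ZR (ker_Res_bar A)"
    unfolding ker_Res_bar_eq
    by (rule submodule.submodule_is_module[OF quot_submodule[OF module_DA Inder_submodule
        ker_Res_submodule] Q])
  have P: "module ?S ?P"
    by (rule restrict_scalars_module[OF kerP cring_Fxp])
      (auto simp: ring_on_simps Fxp_in_center weyl_poly_add weyl_poly_mult)
  have P_simps: "carrier ?P = a_r_coset DA (Inder A) ` ker_Res" "\<zero>\<^bsub>?P\<^esub> = Inder A"
    "C \<oplus>\<^bsub>?P\<^esub> C' = C <+>\<^bsub>DA\<^esub> C'" "c \<odot>\<^bsub>?P\<^esub> C = weyl_poly c \<odot>\<^bsub>?Q\<^esub> C" for C C' c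
    by (simp_all add: restrict_scalars_def ker_Res_bar_eq)
  let ?f = "\<lambda>r. Inder A +>\<^bsub>DA\<^esub> D_der h r" and ?g = "\<lambda>a. Inder A +>\<^bsub>DA\<^esub> ad A a"
  have D: "D_der h r \<in> carrier DA" for r by (simp add: Der_simps(1) D_der_derivation)
  have ad: "ad A a \<in> carrier DA" if "a \<in> normalizer_A h" for a using that by (simp add:
      Der_simps(1) ad_derivation)
  have fg: "?f r \<oplus>\<^bsub>?P\<^esub> ?g a = Inder A +>\<^bsub>DA\<^esub> (D_der h r \<oplus>\<^bsub>DA\<^esub> ad A a)" if "a \<in> normalizer_A h" for
      r a
    using D ad[OF that] by (simp add: P_simps add)
  have "\<exists>\<phi> \<in> module_iso ?S (direct_sum (quot_module ?M1 (range (delta h))) (quot_module ?M2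
      (A_plus_center h))) ?P.
    \<forall>r\<in>carrier ?M1. \<forall>a\<in>carrier ?M2. \<phi> (range (delta h) +>\<^bsub>?M1\<^esub> r, A_plus_center h +>\<^bsub>?M2\<^esub> a) = ?f
        r \<oplus>\<^bsub>?P\<^esub> ?g a"
  proof (rule direct_sum_of_quots_iso[OF M1 M2 P N1 N2])
    show "module_hom_on ?M1 ?S ?P ?f"
      using Theta_ker_Res D FZ unfolding module_hom_on_def P_simps
      by (auto simp: module_on_def ring_on_simps D_der_add D_der_scale add smult simp del:
          mem_Collect_eq)
    show "module_hom_on ?M2 ?S ?P ?g"
      using ad_ker_Res ad FZ unfolding module_hom_on_def P_simps
      by (auto simp: module_on_def ring_on_simps ad_add ad_scale add smult simp del: mem_Collect_eq)
    show "?f r = \<zero>\<^bsub>?P\<^esub>" if "r \<in> range (delta h)" for r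
    proof -
      have "D_der h r \<in> Inder A"
        using that by (auto simp: D_der_delta Inder_def intro!: imageI A_alg_uminus A_alg_poly)
      then show ?thesis using quot_coset_eq_N_iff[OF module_DA Inder_submodule D] by (simp add:
          P_simps)
    qed
    show "?g a = \<zero>\<^bsub>?P\<^esub>" if "a \<in> A_plus_center h" for a
      using quot_coset_eq_N_iff[OF module_DA Inder_submodule ad] A_plus_center_ad[OF that]
          A_plus_center_closed(5)[OF that]
      by (simp add: P_simps)
    show "r \<in> range (delta h) \<and> a \<in> A_plus_center h"
      if "r \<in> carrier ?M1" "a \<in> carrier ?M2" "?f r \<oplus>\<^bsub>?P\<^esub> ?g a = \<zero>\<^bsub>?P\<^esub>" for r a
    proof -
      have ra: "r \<in> Theta h" "a \<in> normalizer_A h" using that by (simp_all add: module_on_def)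
      have "Inder A +>\<^bsub>DA\<^esub> (D_der h r \<oplus>\<^bsub>DA\<^esub> ad A a) = Inder A"
        using that(3) unfolding fg[OF ra(2)] P_simps(2) .
      then have "D_der h r \<oplus>\<^bsub>DA\<^esub> ad A a \<in> Inder A"
        by (rule iffD1[OF quot_coset_eq_N_iff[OF module_DA Inder_submodule DA.M.a_closed[OF D
            ad[OF ra(2)]]]])
      with ra show ?thesis by (rule inner_iff)
    qed
    show "\<exists>r\<in>carrier ?M1. \<exists>a\<in>carrier ?M2. C = ?f r \<oplus>\<^bsub>?P\<^esub> ?g a" if C: "C \<in> carrier ?P" for C
    proof -
      obtain d where d: "d \<in> ker_Res" "C = Inder A +>\<^bsub>DA\<^esub> d" using C unfolding P_simps by blast
      from d(1) obtain r a where "r \<in> Theta h" "a \<in> normalizer_A h" "d = D_der h r \<oplus>\<^bsub>DA\<^esub> ad A a"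
        by (rule ker_Res_obtain)
      with d(2) fg show ?thesis by (auto simp: module_on_def)
    qed
  qed
  then show ?thesis using fg by (auto simp: module_on_def)
qed

end

text \<open>What has to be supplied is the behaviour of \<open>qb\<close> under the pairing. A
  polynomial with dual coordinates \<alpha> i has the value (p-1)! times the sum of
  \<open>\<alpha> i * hs i\<close>, so the values form the ideal of F[x^p] generated by
  \<open>hbar\<close>, and the Bezout coefficients reach its generator. The sign in
  \<open>qb\<close> turns -(p-1)! into 1 by Wilson's theorem.\<close>

theorem proposition6p27:
  fixes h hbar qb :: "'k::field poly"
    and hs qs :: "nat \<Rightarrow> 'k poly"
  assumes char: "CHAR('k) > 0"
    and h: "h \<noteq> 0"
    and hs: "\<forall>i<CHAR('k). hs i \<in> Fxp"
    and h_power: "h ^ (CHAR('k) - 1) = (\<Sum>i<CHAR('k). hs i * monom 1 i)"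
    and hbar: "is_monic_gcd_Fxp (hs ` {..<CHAR('k)}) hbar"
    and qs: "\<forall>i<CHAR('k). qs i \<in> Fxp"
    and bezout: "hbar = (\<Sum>i<CHAR('k). qs i * hs i)"
    and qb: "qb = - (\<Sum>i<CHAR('k). qs i * monom 1 (CHAR('k) - 1 - i))"
  shows
    "(\<forall>u\<in>center (A_alg h). \<forall>v\<in>center (A_alg h). \<forall>r\<in>Theta h. \<forall>a\<in>normalizer_A h.
        (u \<odot>\<^bsub>Der (A_alg h)\<^esub> D_der h qb) \<oplus>\<^bsub>Der (A_alg h)\<^esub> (v \<odot>\<^bsub>Der (A_alg h)\<^esub> F_breve h)
          \<oplus>\<^bsub>Der (A_alg h)\<^esub> D_der h r \<oplus>\<^bsub>Der (A_alg h)\<^esub> ad (A_alg h) a \<in> Inder (A_alg h)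
        \<longrightarrow> u = 0 \<and> v = 0 \<and> r \<in> range (delta h) \<and> a \<in> A_plus_center h)
   \<and> (\<lambda>(d, e, C). (Inder (A_alg h) +>\<^bsub>Der (A_alg h)\<^esub> (d \<oplus>\<^bsub>Der (A_alg h)\<^esub> e)) \<oplus>\<^bsub>HH1 (A_alg h)\<^esub> C)
        \<in> module_iso (ring_on (center (A_alg h)))
            (direct_sum ((Der (A_alg h))\<lparr>carrier := (\<lambda>u. u \<odot>\<^bsub>Der (A_alg h)\<^esub> D_der h qb) ` center (A_alg h)\<rparr>)
              (direct_sum ((Der (A_alg h))\<lparr>carrier := (\<lambda>v. v \<odot>\<^bsub>Der (A_alg h)\<^esub> F_breve h) ` center (A_alg h)\<rparr>)
                (ker_Res_bar (A_alg h))))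
            (HH1 (A_alg h))
   \<and> ker_Res_bar (A_alg h) =
        quot_module
          ((Der (A_alg h))\<lparr>carrier := D_der h ` Theta h <+>\<^bsub>Der (A_alg h)\<^esub> ad (A_alg h) ` normalizer_A h\<rparr>)
          (D_der h ` range (delta h) <+>\<^bsub>Der (A_alg h)\<^esub> ad (A_alg h) ` A_alg h)
   \<and> (\<exists>\<phi> \<in> module_iso (ring_on Fxp)
            (direct_sum
              (quot_module (module_on (Theta h) (*)) (range (delta h)))
              (quot_module (module_on (normalizer_A h) (\<lambda>c a. weyl_poly c * a)) (A_plus_center h)))
            (restrict_scalars weyl_poly (ker_Res_bar (A_alg h))).
        \<forall>r\<in>Theta h. \<forall>a\<in>normalizer_A h.
          \<phi> (range (delta h) +>\<^bsub>module_on (Theta h) (*)\<^esub> r,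
             A_plus_center h +>\<^bsub>module_on (normalizer_A h) (\<lambda>c a. weyl_poly c * a)\<^esub> a)
          = Inder (A_alg h) +>\<^bsub>Der (A_alg h)\<^esub> (D_der h r \<oplus>\<^bsub>Der (A_alg h)\<^esub> ad (A_alg h) a))"
proof -
  let ?p = "CHAR('k)" and ?w = "of_nat (fact (CHAR('k) - 1)) :: 'k poly"
  let ?pairing = "\<lambda>r. (pderiv ^^ (?p - 1)) (r * h ^ (?p - 1))"
  have w: "?w \<noteq> 0" using fact_CHAR_neq_0[where 'a = "'k poly"] char by simp
  have pairing: "?pairing (\<Sum>i<?p. \<alpha> i * monom 1 (?p - 1 - i)) = ?w * (\<Sum>i<?p. \<alpha> i * hs i)"
    if "\<And>i. i < ?p \<Longrightarrow> \<alpha> i \<in> Fxp" for \<alpha>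
    unfolding h_power using that hs by (intro higher_pderiv_pairing[OF char]) auto
  have "?pairing (- s) = - ?pairing s" for s
    using higher_pderiv_smult[of "?p - 1" "- 1" "s * h ^ (?p - 1)"] by simp
  then have pairing_qb: "?pairing qb = - (?w * hbar)"
    using pairing[of qs] qs unfolding qb bezout by simp
  have hbar_neq_0: "hbar \<noteq> 0" using hbar by (auto simp: is_monic_gcd_Fxp_def)
  have dvd: "\<exists>c\<in>Fxp. hs i = hbar * c" if "i < ?p" for i
    using hbar that by (auto simp: is_monic_gcd_Fxp_def factor_def ring_on_simps)
  then obtain c where c: "\<And>i. i < ?p \<Longrightarrow> c i \<in> Fxp \<and> hs i = hbar * c i" by metis
  have generated: "\<exists>e\<in>Fxp. ?pairing s = e * ?pairing qb" for s
  proof -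
    obtain \<beta> where \<beta>: "\<forall>i. \<beta> i \<in> Fxp" "s = (\<Sum>i<?p. \<beta> i * monom 1 i)"
      using Fxp_coordinates[OF char] by blast
    \<comment> \<open>Reversing the index writes s in the basis dual to the one used for
      h^(p-1).\<close>
    have "s = (\<Sum>i<?p. \<beta> (?p - 1 - i) * monom 1 (?p - 1 - i))"
      unfolding \<beta>(2) by (subst sum.nat_diff_reindex[symmetric]) simp
    then have "?pairing s = ?w * (\<Sum>i<?p. \<beta> (?p - 1 - i) * hs i)"
      using pairing[of "\<lambda>i. \<beta> (?p - 1 - i)"] \<beta>(1) by simp
    also have "\<dots> = - (\<Sum>i<?p. \<beta> (?p - 1 - i) * c i) * ?pairing qb"
    proof -
      have "(\<Sum>i<?p. \<beta> (?p - 1 - i) * hs i) = hbar * (\<Sum>i<?p. \<beta> (?p - 1 - i) * c i)"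
        unfolding sum_distrib_left by (rule sum.cong) (use c in \<open>auto simp: mult.left_commute\<close>)
      then show ?thesis unfolding pairing_qb by (simp add: mult_ac)
    qed
    finally show ?thesis
      using \<beta>(1) c by (intro bexI[of _ "- (\<Sum>i<?p. \<beta> (?p - 1 - i) * c i)"] Fxp_closed[OF char]
          Fxp_sum[OF char]) auto
  qed
  have nz: "?pairing qb \<noteq> 0" unfolding pairing_qb using w hbar_neq_0 by simp
  interpret weyl_subalgebra_qb h qb
    using char h nz generated by unfold_locales
  show ?thesis
    using inner_imp_trivial by (intro conjI HH1_decomposition ker_Res_bar_quotient
        ker_Res_bar_direct_sum) blast
qed

end
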